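(* There is an absolute constant $C>0$ such that for all integers $d\ge 1$, $1\le r\le d$, $M\ge 1$ and all reals $\epsilon>0$, $B>0$ the following holds with some number of copies $n\le \lceil C\,\sqrt{rB}\,\epsilon^{-2}\log(M+1)\rceil$. There exist a (joint) quantum measurement on $(\mathbb C^d)^{\otimes n}$, producing a classical outcome $s$, and a classical post-processing function $E(s,O)$ such that for every state $\chi\in\mathbb C^{d\times d}$ of rank at most $r$ and all Hermitian observables $O_1,\dots,O_M\in\mathbb C^{d\times d}$ with $\|O_i\|_\infty\le 1$ and $\operatorname{Tr}(O_i^2)\le B$ for every $i$: if $s$ is the outcome of the measurement applied to $\chi^{\otimes n}$, then with probability at least $2/3$, $|E(s,O_i)-\operatorname{Tr}(O_i\chi)|\le\epsilon$ for all $i=1,\dots,M$ simultaneously. That is, the multi-copy sample complexity of the classical shadows task for rank-$r$ states is $O(\sqrt{rB}\,\epsilon^{-2}\log M)$.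
   Context: A state is a positive semidefinite matrix $\chi\in\mathbb C^{d\times d}$ of trace one. $\|\cdot\|_\infty$ is the spectral norm. In the classical shadows task, the measurement of the copies of the unknown state must not depend on the observables (it may depend on $d,r,M,\epsilon,B$): one first measures $\chi^{\otimes n}$ to get a classical record ("shadow") $s$, and only afterwards receives the observables and estimates $\operatorname{Tr}(O_i\chi)$ from $s$. A quantum measurement means a POVM (possibly with continuous outcomes, possibly implemented adaptively in several stages). *)

theory Defs
  imports
    "HOL-Analysis.Analysis"
    "Jordan_Normal_Form.DL_Rank"
    "Jordan_Normal_Form.Schur_Decomposition"
begin

definition mat_trace :: "complex mat \<Rightarrow> complex" where
  "mat_trace A = (\<Sum>i<dim_row A. A $$ (i, i))"

definition hermitian_mat :: "nat \<Rightarrow> complex mat \<Rightarrow> bool" where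
  "hermitian_mat d A \<longleftrightarrow> A \<in> carrier_mat d d \<and> mat_adjoint A = A"

text \<open>The operation \<^term>\<open>v \<bullet>c w\<close> is conjugate-linear in its second argument.\<close>

definition psd_mat :: "nat \<Rightarrow> complex mat \<Rightarrow> bool" where
  "psd_mat d A \<longleftrightarrow> hermitian_mat d A \<and> (\<forall>v \<in> carrier_vec d. 0 \<le> Re ((A *\<^sub>v v) \<bullet>c v))"

definition quantum_state :: "nat \<Rightarrow> complex mat \<Rightarrow> bool" where
  "quantum_state d \<rho> \<longleftrightarrow> psd_mat d \<rho> \<and> mat_trace \<rho> = 1"

definition l2_norm_vec :: "complex vec \<Rightarrow> real" where
  "l2_norm_vec v = sqrt (Re (v \<bullet>c v))"

definition spectral_norm :: "complex mat \<Rightarrow> real" where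
  "spectral_norm A =
     (SUP v \<in> {v \<in> carrier_vec (dim_col A). l2_norm_vec v \<le> 1}. l2_norm_vec (A *\<^sub>v v))"

abbreviation mat_rank :: "nat \<Rightarrow> complex mat \<Rightarrow> nat" where
  "mat_rank d A \<equiv> vec_space.rank d A"

text \<open>
  The tensor product of the basis vectors numbered \<open>i < m\<close> and \<open>j < k\<close> is the basis vector
  numbered \<open>i * k + j\<close>, so \<open>n\<close>-fold tensor powers of \<open>d\<close>-dimensional space have dimension
  \<open>d ^ n\<close>.
\<close>

definition kronecker :: "complex mat \<Rightarrow> complex mat \<Rightarrow> complex mat" where
  "kronecker A B = mat (dim_row A * dim_row B) (dim_col A * dim_col B)
     (\<lambda>(i, j). A $$ (i div dim_row B, j div dim_col B) * B $$ (i mod dim_row B, j mod dim_col B))"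

fun tensor_power :: "complex mat \<Rightarrow> nat \<Rightarrow> complex mat" where
  "tensor_power A 0 = 1\<^sub>m 1"
| "tensor_power A (Suc n) = kronecker A (tensor_power A n)"

text \<open>
  A POVM on \<open>D\<close>-dimensional space with outcomes in the measurable space \<open>\<Omega>\<close> (only the space and
  the sigma-algebra of \<open>\<Omega>\<close> matter): a countably additive assignment of effects to events.
  Countable additivity is stated entrywise, which in finite dimension is convergence in norm.
\<close>

definition povm :: "nat \<Rightarrow> 's measure \<Rightarrow> ('s set \<Rightarrow> complex mat) \<Rightarrow> bool" where
  "povm D \<Omega> Q \<longleftrightarrow>
     (\<forall>A \<in> sets \<Omega>. psd_mat D (Q A)) \<and>
     Q (space \<Omega>) = 1\<^sub>m D \<and>
     (\<forall>A :: nat \<Rightarrow> 's set. range A \<subseteq> sets \<Omega> \<longrightarrow> disjoint_family A \<longrightarrow>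
        (\<forall>i < D. \<forall>j < D. (\<lambda>k. Q (A k) $$ (i, j)) sums (Q (\<Union>k. A k) $$ (i, j))))"

text \<open>The law of the outcome when the POVM \<open>Q\<close> is applied to the state \<open>\<rho>\<close> (Born rule).\<close>

definition outcome_law :: "'s measure \<Rightarrow> ('s set \<Rightarrow> complex mat) \<Rightarrow> complex mat \<Rightarrow> 's measure" where
  "outcome_law \<Omega> Q \<rho> =
     measure_of (space \<Omega>) (sets \<Omega>) (\<lambda>A. ennreal (Re (mat_trace (Q A * \<rho>))))"

text \<open>
  A classical record is a sequence of real numbers. The set of possible records and its
  sigma-algebra are arbitrary, so every standard Borel outcome space (finite, countable or
  continuous, including the transcripts of adaptive multi-stage measurements) embeds.
\<close>

type_synonym shadow = "nat \<Rightarrow> real"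

text \<open>
  \<open>E s Ob\<close> is the estimate computed from the record \<open>s\<close> for the observable \<open>Ob\<close>; it is a random
  variable for every fixed observable.
\<close>

definition post_processing ::
    "nat \<Rightarrow> shadow measure \<Rightarrow> (shadow \<Rightarrow> complex mat \<Rightarrow> real) \<Rightarrow> bool" where
  "post_processing d \<Omega> E \<longleftrightarrow>
     (\<forall>Ob. hermitian_mat d Ob \<longrightarrow> (\<lambda>s. E s Ob) \<in> borel_measurable \<Omega>)"

end

theory Submission
  imports Defs "HOL-Computational_Algebra.Fundamental_Theorem_Algebra"
begin

text \<open>
  Let \<open>X\<close> be a \<open>d \<times> r\<close> matrix of independent standard complex Gaussians, \<open>G = X X\<^sup>*\<close> and
  \<open>A\<^sub>k = \<E>[G\<^sup>\<otimes>\<^sup>k]\<close>. Gaussian integration by parts gives \<open>A\<^bsub>k+1\<^esub> = (A\<^sub>k \<otimes> 1) (r + \<Sum>\<^sub>l (l, k+1))\<close>,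
  where \<open>(l, k+1)\<close> swaps two tensor factors. Measure \<open>k\<close> copies with the pretty good measurement
  \<open>M\<^sub>G = A\<^sub>k\<^sup>-\<^sup>1\<^sup>/\<^sup>2 G\<^sup>\<otimes>\<^sup>k A\<^sub>k\<^sup>-\<^sup>1\<^sup>/\<^sup>2\<close>. All operators \<open>\<rho>\<^sup>\<otimes>\<^sup>k\<close> commute with \<open>A\<^sub>k\<close> and, if \<open>\<rho>\<close> has rank at most
  \<open>r\<close>, are supported on its range. So \<open>A\<^sub>k\<close> cancels in the moments of the outcome, and the recursion
  shows that \<open>(Tr (O G) - r Tr O) / k\<close> is an unbiased estimate of \<open>Tr (O \<rho>)\<close> of variance at most
  \<open>r Tr (O\<^sup>2) / k\<^sup>2 + 2 Tr (O\<^sup>2 \<rho>) / k\<close>. Batches of \<open>k \<approx> \<surd>(r B / min 1 B)\<close> copies have variance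
  \<open>O (min 1 B)\<close>; averaging over batches and a majority vote finish the proof.

  Only moments of order at most \<open>k + 2\<close> matter, so the Gaussians are replaced by variables with
  finite support, and all measurements have finitely many outcomes.
\<close>

section \<open>Complex matrices and the spectral theorem\<close>

no_notation Finite_Cartesian_Product.vec.vec_nth (infixl "$" 90)

declare index_mult_mat(1) [simp del]

text \<open>The rate is a balance. Let \<open>\<beta> = min 1 B\<close>, a bound for
  \<open>Tr (O^2 \<rho>)\<close>. The bound \<open>r B / k^2\<close> drops to \<open>\<beta>\<close>
  when \<open>k\<close> reaches \<open>sqrt (r B / \<beta>)\<close>; about
  \<open>\<beta> / \<epsilon>^2\<close> batches then suffice, and the product is
  \<open>sqrt (r B \<beta>) / \<epsilon>^2\<close>, at most
  \<open>sqrt (r B) / \<epsilon>^2\<close>. Rounding both factors up costs only constants because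
  \<open>\<beta> \<le> B\<close> and because \<open>\<beta> > \<epsilon>^2\<close> may be assumed.

  The obstacle is that \<open>A_k\<close> is singular once \<open>r < min d k\<close>: the
  \<open>r\<close> columns of \<open>X\<close> cannot produce antisymmetric tensors of order
  \<open>r + 1\<close>. Hence the pseudoinverse, and the need to show that
  \<open>\<rho>^\<otimes>k\<close> lives on the range of \<open>A_k\<close>. For true Gaussians a
  polynomial that vanishes almost surely is zero; with finite support it might vanish on all sample
  points. Matching moments exclude this, since they make the second moment of a form of degree
  \<open>k\<close> a positive definite function of its coefficients.

  The order \<open>k + 2\<close> arises because Born probabilities have degree \<open>k\<close> in
  \<open>G\<close> and the squared estimate adds two factors.\<close>

lemma mat_adjoint_dim [simp]:
  "dim_row (mat_adjoint A) = dim_col A" "dim_col (mat_adjoint A) = dim_row A"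
  by (auto simp: mat_adjoint_def mat_of_rows_def)

lemma mat_adjoint_carrier [simp]:
  "A \<in> carrier_mat n m \<Longrightarrow> mat_adjoint A \<in> carrier_mat m n"
  by (rule carrier_matI) (simp_all add: carrier_matD)

lemma mat_adjoint_index [simp]:
  fixes A :: "complex mat"
  shows "i < dim_col A \<Longrightarrow> j < dim_row A \<Longrightarrow> mat_adjoint A $$ (i, j) = cnj (A $$ (j, i))"
  by (auto simp: mat_adjoint_def mat_of_rows_def)

lemma mat_adjoint_adjoint [simp]: "mat_adjoint (mat_adjoint A) = (A :: complex mat)"
  by (intro eq_matI) auto

lemma index_mult_mat_sum:
  assumes "A \<in> carrier_mat n m" "B \<in> carrier_mat m k" "i < n" "j < k"
  shows "(A * B) $$ (i, j) = (\<Sum>l<m. A $$ (i, l) * B $$ (l, j))"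
  using assms by (auto simp: scalar_prod_def atLeast0LessThan index_mult_mat(1))

lemma mat_adjoint_mult:
  assumes "(A :: complex mat) \<in> carrier_mat n m" "B \<in> carrier_mat m k"
  shows "mat_adjoint (A * B) = mat_adjoint B * mat_adjoint A"
proof (rule eq_matI)
  fix i j assume "i < dim_row (mat_adjoint B * mat_adjoint A)"
    "j < dim_col (mat_adjoint B * mat_adjoint A)"
  then have ij: "i < k" "j < n" using assms by auto
  have "mat_adjoint (A * B) $$ (i, j) = cnj ((A * B) $$ (j, i))"
    using assms ij by simp
  also have "\<dots> = (\<Sum>l<m. cnj (A $$ (j, l) * B $$ (l, i)))"
    using assms ij by (subst index_mult_mat_sum[of _ n m _ k]) (auto simp: cnj_sum)
  also have "\<dots> = (mat_adjoint B * mat_adjoint A) $$ (i, j)"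
    using assms ij by (subst index_mult_mat_sum[of _ k m _ n]) (auto intro!: sum.cong)
  finally show "mat_adjoint (A * B) $$ (i, j) = (mat_adjoint B * mat_adjoint A) $$ (i, j)" .
qed (use assms in auto)

lemma mat_adjoint_one [simp]: "mat_adjoint (1\<^sub>m n :: complex mat) = 1\<^sub>m n"
  by (intro eq_matI) auto

lemma mat_adjoint_add:
  assumes "(A :: complex mat) \<in> carrier_mat n m" "B \<in> carrier_mat n m"
  shows "mat_adjoint (A + B) = mat_adjoint A + mat_adjoint B"
  using assms by (intro eq_matI) auto

lemma hermitian_matD:
  assumes "hermitian_mat n A"
  shows "A \<in> carrier_mat n n" "mat_adjoint A = A"
    "\<And>i j. i < n \<Longrightarrow> j < n \<Longrightarrow> cnj (A $$ (i, j)) = A $$ (j, i)"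
proof -
  show A: "A \<in> carrier_mat n n" "mat_adjoint A = A"
    using assms by (simp_all add: hermitian_mat_def)
  fix i j assume "i < n" "j < n"
  then have "mat_adjoint A $$ (j, i) = cnj (A $$ (i, j))"
    using A(1) by simp
  then show "cnj (A $$ (i, j)) = A $$ (j, i)" by (simp add: A(2))
qed

lemma mat_trace_mult:
  assumes "A \<in> carrier_mat n m" "B \<in> carrier_mat m n"
  shows "mat_trace (A * B) = (\<Sum>i<n. \<Sum>j<m. A $$ (i, j) * B $$ (j, i))"
  unfolding mat_trace_def using assms
  by (auto simp: index_mult_mat_sum[OF assms] intro!: sum.cong)

lemma mat_trace_comm:
  assumes "A \<in> carrier_mat n m" "B \<in> carrier_mat m n"
  shows "mat_trace (A * B) = mat_trace (B * A)"
  unfolding mat_trace_mult[OF assms] mat_trace_mult[OF assms(2,1)]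
  by (subst sum.swap) (simp add: mult.commute)

lemma mat_trace_add:
  assumes "A \<in> carrier_mat n n" "B \<in> carrier_mat n n"
  shows "mat_trace (A + B) = mat_trace A + mat_trace B"
  using assms by (auto simp: mat_trace_def sum.distrib)

lemma quadratic_form_sum:
  assumes "A \<in> carrier_mat n n" "v \<in> carrier_vec n"
  shows "(A *\<^sub>v v) \<bullet>c v = (\<Sum>i<n. \<Sum>j<n. A $$ (i, j) * v $ j * cnj (v $ i))"
  using assms
  by (auto simp: scalar_prod_def atLeast0LessThan sum_distrib_right intro!: sum.cong)

text \<open>The quadratic form at \<open>v\<close> is the squared norm of the adjoint of
  \<open>B\<close> applied to \<open>v\<close>; \<open>?h l\<close> is the complex conjugate of its
  entry \<open>l\<close>.\<close>

lemma psd_mat_gram: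
  assumes "B \<in> carrier_mat n m"
  shows "psd_mat n (B * mat_adjoint B)"
  unfolding psd_mat_def hermitian_mat_def
proof (intro conjI ballI)
  show "B * mat_adjoint B \<in> carrier_mat n n" using assms by auto
  show "mat_adjoint (B * mat_adjoint B) = B * mat_adjoint B"
    using mat_adjoint_mult[OF assms mat_adjoint_carrier[OF assms]] by simp
  fix v :: "complex vec" assume v: "v \<in> carrier_vec n"
  let ?h = "\<lambda>l. \<Sum>i<n. cnj (v $ i) * B $$ (i, l)"
  have "((B * mat_adjoint B) *\<^sub>v v) \<bullet>c v =
      (\<Sum>i<n. \<Sum>j<n. (\<Sum>l<m. B $$ (i, l) * cnj (B $$ (j, l))) * v $ j * cnj (v $ i))"
    using assms v by (subst quadratic_form_sum[of _ n])
      (auto simp: index_mult_mat_sum[OF assms mat_adjoint_carrier[OF assms]] intro!: sum.cong)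
  also have "\<dots> = (\<Sum>i<n. \<Sum>j<n. \<Sum>l<m. (cnj (v $ i) * B $$ (i, l)) * (v $ j * cnj (B $$ (j, l))))"
    by (simp add: sum_distrib_left sum_distrib_right mult_ac)
  also have "\<dots> = (\<Sum>l<m. \<Sum>i<n. \<Sum>j<n. (cnj (v $ i) * B $$ (i, l)) * (v $ j * cnj (B $$ (j, l))))"
    by (subst (2) sum.swap, subst sum.swap) simp
  also have "\<dots> = (\<Sum>l<m. ?h l * cnj (?h l))"
    by (simp add: sum_product cnj_sum)
  also have "\<dots> = (\<Sum>l<m. complex_of_real ((cmod (?h l))\<^sup>2))"
    by (simp only: complex_norm_square)
  finally have "((B * mat_adjoint B) *\<^sub>v v) \<bullet>c v = complex_of_real (\<Sum>l<m. (cmod (?h l))\<^sup>2)"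
    by simp
  then show "0 \<le> Re (((B * mat_adjoint B) *\<^sub>v v) \<bullet>c v)"
    by (simp only: Re_complex_of_real) (intro sum_nonneg, simp)
qed

lemma psd_mat_add:
  assumes "psd_mat n A" "psd_mat n B"
  shows "psd_mat n (A + B)"
  using assms unfolding psd_mat_def hermitian_mat_def
  by (auto simp: mat_adjoint_add add_mult_distrib_mat_vec[of _ n n] add_scalar_prod_distrib[of _ n])

lemma psd_mat_smult:
  assumes "psd_mat n A" "0 \<le> c"
  shows "psd_mat n (complex_of_real c \<cdot>\<^sub>m A)"
proof -
  have A: "A \<in> carrier_mat n n" "mat_adjoint A = A"
    using assms by (auto simp: psd_mat_def hermitian_mat_def)
  have "mat_adjoint (complex_of_real c \<cdot>\<^sub>m A) = complex_of_real c \<cdot>\<^sub>m mat_adjoint A"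
    using A(1) by (intro eq_matI) auto
  moreover have "Re ((complex_of_real c \<cdot>\<^sub>m A *\<^sub>v v) \<bullet>c v) = c * Re ((A *\<^sub>v v) \<bullet>c v)"
    if "v \<in> carrier_vec n" for v
    using A that by (simp add: quadratic_form_sum[of _ n] sum_distrib_left mult.assoc)
  ultimately show ?thesis using assms A by (auto simp: psd_mat_def hermitian_mat_def)
qed

section \<open>Diagonalisation of Hermitian matrices\<close>

definition diag_real :: "nat \<Rightarrow> (nat \<Rightarrow> real) \<Rightarrow> complex mat" where
  "diag_real n l = mat n n (\<lambda>(i, j). if i = j then complex_of_real (l i) else 0)"

lemma diag_real_carrier [simp]: "diag_real n l \<in> carrier_mat n n"
  and diag_real_dim [simp]: "dim_row (diag_real n l) = n" "dim_col (diag_real n l) = n"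
  by (auto simp: diag_real_def)

lemma diag_real_mult: "diag_real n l * diag_real n m = diag_real n (\<lambda>i. l i * m i)"
  by (intro eq_matI)
    (auto simp: index_mult_mat_sum[of _ n n _ n] diag_real_def if_distrib[of "\<lambda>x. x * _"]
      cong: if_cong)

lemma mat_adjoint_diag_real [simp]: "mat_adjoint (diag_real n l) = diag_real n l"
  by (intro eq_matI) (auto simp: diag_real_def)

definition unitary_mat :: "nat \<Rightarrow> complex mat \<Rightarrow> bool" where
  "unitary_mat n U \<longleftrightarrow> U \<in> carrier_mat n n \<and> mat_adjoint U * U = 1\<^sub>m n \<and> U * mat_adjoint U = 1\<^sub>m n"

lemma unitary_matI:
  assumes "U \<in> carrier_mat n n" "mat_adjoint U * U = 1\<^sub>m n"
  shows "unitary_mat n U"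
  using assms mat_mult_left_right_inverse[of "mat_adjoint U" n U] by (auto simp: unitary_mat_def)

text \<open>Gram-Schmidt does not change the first vector of a basis, so \<open>v\<close> only gets
  rescaled. The vectors it returns are orthogonal but not normalised; \<open>g\<close> supplies the
  missing factors.\<close>

lemma unitary_completion:
  assumes v: "(v :: complex vec) \<in> carrier_vec n" "v \<noteq> 0\<^sub>v n"
  shows "\<exists>W c. unitary_mat n W \<and> col W 0 = c \<cdot>\<^sub>v v \<and> 0 < n"
proof -
  interpret cof_vec_space n "TYPE(complex)" .
  define b where "b = basis_completion v"
  define ws where "ws = gram_schmidt n b"
  from basis_completion[OF v, folded b_def]
  have span_b: "span (set b) = carrier_vec n" and dist_b: "distinct b"
    and indep: "\<not> lin_dep (set b)" and b: "set b \<subseteq> carrier_vec n" and hdb: "hd b = v"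
    and len_b: "length b = n" by auto
  have n: "0 < n" using v by (cases n) auto
  from hdb len_b n obtain vs where bv: "b = v # vs" by (cases b) auto
  from gram_schmidt_result[OF b dist_b indep refl, folded ws_def]
  have ws: "set ws \<subseteq> carrier_vec n" "corthogonal ws" "length ws = n"
    by (auto simp: len_b)
  from gram_schmidt_hd[OF v(1), of vs, folded bv] have hdws: "hd ws = v" unfolding ws_def .
  have wsi: "ws ! i \<in> carrier_vec n" if "i < n" for i using ws that by auto
  define g where "g = (\<lambda>i. complex_of_real (1 / sqrt (Re (ws ! i \<bullet>c ws ! i))))"
  define W where "W = mat n n (\<lambda>(i, j). g j * (ws ! j) $ i)"
  have pos: "ws ! i \<bullet>c ws ! i = complex_of_real (Re (ws ! i \<bullet>c ws ! i))"
    "0 < Re (ws ! i \<bullet>c ws ! i)" if "i < n" for i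
  proof -
    have "0 < ws ! i \<bullet>c ws ! i"
      using ws(2) that ws(3) wsi[OF that] corthogonalD[OF ws(2), of i i]
        conjugate_square_ge_0_vec[of "ws ! i"] by (auto simp: order.order_iff_strict)
    then show "0 < Re (ws ! i \<bullet>c ws ! i)" "ws ! i \<bullet>c ws ! i = complex_of_real (Re (ws ! i \<bullet>c ws ! i))"
      by (auto simp: less_complex_def complex_eq_iff)
  qed
  have "mat_adjoint W * W = 1\<^sub>m n"
  proof (rule eq_matI)
    fix i j assume "i < dim_row (1\<^sub>m n :: complex mat)" "j < dim_col (1\<^sub>m n :: complex mat)"
    then have ij: "i < n" "j < n" by auto
    have "(mat_adjoint W * W) $$ (i, j) = (\<Sum>l<n. cnj (g i * (ws ! i) $ l) * (g j * (ws ! j) $ l))"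
      using ij by (subst index_mult_mat_sum[of _ n n _ n]) (auto simp: W_def)
    also have "\<dots> = cnj (g i) * g j * (\<Sum>l<n. (ws ! j) $ l * cnj ((ws ! i) $ l))"
      by (simp add: sum_distrib_left mult_ac)
    also have "(\<Sum>l<n. (ws ! j) $ l * cnj ((ws ! i) $ l)) = ws ! j \<bullet>c ws ! i"
      using wsi[OF ij(1)] wsi[OF ij(2)] by (simp add: scalar_prod_def atLeast0LessThan)
    also have "cnj (g i) * g j * (ws ! j \<bullet>c ws ! i) = 1\<^sub>m n $$ (i, j)"
    proof (cases "i = j")
      case True
      have "cnj (g i) * g i * complex_of_real (Re (ws ! i \<bullet>c ws ! i)) = 1"
        using pos(2)[OF ij(1)] by (simp add: g_def of_real_mult[symmetric] del: of_real_mult)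
      then show ?thesis using True ij pos(1)[OF ij(1)] by simp
    next
      case False
      then show ?thesis using corthogonalD[OF ws(2), of j i] ij ws(3) by simp
    qed
    finally show "(mat_adjoint W * W) $$ (i, j) = 1\<^sub>m n $$ (i, j)" .
  qed (auto simp: W_def)
  then have "unitary_mat n W" by (intro unitary_matI) (auto simp: W_def)
  moreover have ws0: "ws ! 0 = v" using hdws ws(3) n by (cases ws) auto
  have "col W 0 = g 0 \<cdot>\<^sub>v v"
    using n v(1) ws0 by (intro eq_vecI) (auto simp: W_def)
  ultimately show ?thesis using n by blast
qed

text \<open>Deflation: a unitary \<open>W\<close> with an eigenvector as first column turns
  \<open>A\<close> into the block sum of a real eigenvalue and a smaller Hermitian matrix
  \<open>H3\<close>, which the induction hypothesis diagonalises.\<close>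

lemma spectral_theorem:
  assumes "hermitian_mat n A"
  shows "\<exists>U l. unitary_mat n U \<and> A = U * diag_real n l * mat_adjoint U"
  using assms
proof (induction n arbitrary: A)
  case 0
  then have "A = 1\<^sub>m 0 * diag_real 0 (\<lambda>_. 0) * mat_adjoint (1\<^sub>m 0)" "unitary_mat 0 (1\<^sub>m 0)"
    by (auto simp: hermitian_mat_def unitary_mat_def)
  then show ?case by blast
next
  case (Suc n)
  have A: "A \<in> carrier_mat (Suc n) (Suc n)" and hA: "mat_adjoint A = A"
    using Suc.prems by (auto dest: hermitian_matD)
  have "degree (char_poly A) = Suc n" using degree_monic_char_poly[OF A] by simp
  then obtain e where "poly (char_poly A) e = 0"
    using fundamental_theorem_of_algebra[of "char_poly A"] by (auto simp: constant_degree)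
  then have "eigenvalue A e" using eigenvalue_root_char_poly[OF A] by simp
  then obtain v where v: "v \<in> carrier_vec (Suc n)" "v \<noteq> 0\<^sub>v (Suc n)" "A *\<^sub>v v = e \<cdot>\<^sub>v v"
    using A by (auto simp: eigenvalue_def eigenvector_def)
  obtain W c where W: "unitary_mat (Suc n) W" "col W 0 = c \<cdot>\<^sub>v v"
    using unitary_completion[OF v(1,2)] by blast
  have Wc: "W \<in> carrier_mat (Suc n) (Suc n)" and W1: "mat_adjoint W * W = 1\<^sub>m (Suc n)"
    and W2: "W * mat_adjoint W = 1\<^sub>m (Suc n)" using W(1) by (auto simp: unitary_mat_def)
  note Wa = mat_adjoint_carrier[OF Wc]
  define H where "H = mat_adjoint W * (A * W)"
  have H: "H \<in> carrier_mat (Suc n) (Suc n)" using A Wc by (auto simp: H_def)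
  have hH: "mat_adjoint H = H"
    using A Wc Wa hA unfolding H_def
    by (subst mat_adjoint_mult[of _ "Suc n" "Suc n" _ "Suc n"], simp, simp,
        subst mat_adjoint_mult[of _ "Suc n" "Suc n" _ "Suc n"]) (auto simp: assoc_mult_mat[OF Wa A Wc])
  have AW: "col (A * W) 0 = e \<cdot>\<^sub>v col W 0"
    using v A Wc W(2) by (subst col_mult2[OF A Wc]) (auto simp: mult_mat_vec[OF A v(1)] smult_smult_assoc mult.commute)
  \<comment> \<open>\<open>A\<close> maps the first column of \<open>W\<close> to \<open>e\<close>
    times itself, and the adjoint of \<open>W\<close> maps that column to the first unit vector.
    Hermitian symmetry then clears the first row and makes \<open>e\<close> real.\<close>
  have H0: "H $$ (i, 0) = (if i = 0 then e else 0)" if "i < Suc n" for i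
  proof -
    have "H $$ (i, 0) = row (mat_adjoint W) i \<bullet> col (A * W) 0"
      unfolding H_def using that A Wc by (simp add: index_mult_mat(1))
    also have "\<dots> = e * (row (mat_adjoint W) i \<bullet> col W 0)"
      unfolding AW using that Wc by simp
    also have "row (mat_adjoint W) i \<bullet> col W 0 = (mat_adjoint W * W) $$ (i, 0)"
      using that Wc by (simp add: index_mult_mat(1))
    finally show ?thesis using that by (simp add: W1)
  qed
  have H0': "H $$ (0, i) = cnj (if i = 0 then e else 0)" if "i < Suc n" for i
    using H0[OF that] mat_adjoint_index[of 0 H i] hH H that by auto
  have er: "cnj e = e" using H0[of 0] H0'[of 0] by simp
  define H3 where "H3 = mat n n (\<lambda>(i, j). H $$ (Suc i, Suc j))"
  have "hermitian_mat n H3" unfolding hermitian_mat_def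
  proof (intro conjI eq_matI)
    fix i j assume "i < dim_row H3" "j < dim_col H3"
    then show "mat_adjoint H3 $$ (i, j) = H3 $$ (i, j)"
      using mat_adjoint_index[of "Suc i" H "Suc j"] hH H by (simp add: H3_def)
  qed (auto simp: H3_def)
  from Suc.IH[OF this] obtain U l where U: "unitary_mat n U" and H3: "H3 = U * diag_real n l * mat_adjoint U"
    by blast
  have Uc: "U \<in> carrier_mat n n" using U by (auto simp: unitary_mat_def)
  \<comment> \<open>\<open>V\<close> is the block sum of the number 1 and \<open>U\<close>; with the
    eigenvalues \<open>m\<close> it diagonalises the block matrix \<open>H\<close>.\<close>
  define V where "V = mat (Suc n) (Suc n) (\<lambda>(i, j). case (i, j) of
      (Suc i', Suc j') \<Rightarrow> U $$ (i', j') | (0, 0) \<Rightarrow> 1 | _ \<Rightarrow> 0)"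
  define m where "m = (\<lambda>i. case i of 0 \<Rightarrow> Re e | Suc i \<Rightarrow> l i)"
  have Vc: "V \<in> carrier_mat (Suc n) (Suc n)" by (simp add: V_def)
  have split: "(\<Sum>l<Suc n. f l) = f 0 + (\<Sum>l<n. f (Suc l))" for f :: "nat \<Rightarrow> complex"
    by (rule sum.lessThan_Suc_shift)
  have "mat_adjoint V * V = 1\<^sub>m (Suc n)"
  proof (rule eq_matI)
    fix i j assume "i < dim_row (1\<^sub>m (Suc n) :: complex mat)" "j < dim_col (1\<^sub>m (Suc n) :: complex mat)"
    then have ij: "i < Suc n" "j < Suc n" by auto
    have UU: "(\<Sum>l<n. cnj (U $$ (l, i)) * U $$ (l, j)) = (if i = j then 1 else 0)" if "i < n" "j < n" for i j
    proof -
      have "(mat_adjoint U * U) $$ (i, j) = (\<Sum>l<n. cnj (U $$ (l, i)) * U $$ (l, j))"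
        using that Uc by (subst index_mult_mat_sum[of _ n n _ n]) auto
      then show ?thesis using U that by (simp add: unitary_mat_def)
    qed
    show "(mat_adjoint V * V) $$ (i, j) = 1\<^sub>m (Suc n) $$ (i, j)"
      using ij Vc by (subst index_mult_mat_sum[of _ "Suc n" "Suc n" _ "Suc n"])
        (auto simp: split V_def UU simp del: sum.lessThan_Suc split: nat.split)
  qed (use Vc in auto)
  then have uV: "unitary_mat (Suc n) V" by (intro unitary_matI) (use Vc in auto)
  have HV: "H = V * diag_real (Suc n) m * mat_adjoint V"
  proof (rule eq_matI)
    fix i j assume "i < dim_row (V * diag_real (Suc n) m * mat_adjoint V)"
      "j < dim_col (V * diag_real (Suc n) m * mat_adjoint V)"
    then have ij: "i < Suc n" "j < Suc n" using Vc by auto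
    have VD: "(V * diag_real (Suc n) m) $$ (i, j) = V $$ (i, j) * m j" if "i < Suc n" "j < Suc n" for i j
      using that Vc by (subst index_mult_mat_sum[of _ "Suc n" "Suc n" _ "Suc n"])
        (auto simp: diag_real_def if_distrib[of "\<lambda>x. _ * x"] simp del: sum.lessThan_Suc cong: if_cong)
    have UD: "(U * diag_real n l) $$ (i, j) = U $$ (i, j) * l j" if "i < n" "j < n" for i j
      using that Uc by (subst index_mult_mat_sum[of _ "n" "n" _ "n"])
        (auto simp: diag_real_def if_distrib[of "\<lambda>x. _ * x"] cong: if_cong)
    have "(V * diag_real (Suc n) m * mat_adjoint V) $$ (i, j) =
        (\<Sum>l<Suc n. V $$ (i, l) * m l * cnj (V $$ (j, l)))"
      using ij Vc by (subst index_mult_mat_sum[of _ "Suc n" "Suc n" _ "Suc n"])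
        (auto simp: VD simp del: sum.lessThan_Suc)
    also have "\<dots> = H $$ (i, j)"
    proof (cases "i = 0 \<or> j = 0")
      case True
      then show ?thesis using ij H0 H0' er
        by (auto simp: split V_def m_def complex_eq_iff simp del: sum.lessThan_Suc split: nat.split)
    next
      case False
      then obtain i' j' where s: "i = Suc i'" "j = Suc j'" by (metis not0_implies_Suc)
      have "H3 $$ (i', j') = (\<Sum>k<n. U $$ (i', k) * l k * cnj (U $$ (j', k)))"
        unfolding H3 using ij s Uc
        by (subst index_mult_mat_sum[of _ "n" "n" _ "n"]) (auto simp: UD)
      then show ?thesis using ij s
        by (simp add: split V_def m_def H3_def del: sum.lessThan_Suc)
    qed
    finally show "H $$ (i, j) = (V * diag_real (Suc n) m * mat_adjoint V) $$ (i, j)" by simp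
  qed (use Vc H in auto)
  note Va = mat_adjoint_carrier[OF Vc]
  have AWc: "A * W \<in> carrier_mat (Suc n) (Suc n)" using A Wc by simp
  have "W * H = (W * mat_adjoint W) * (A * W)"
    unfolding H_def by (rule assoc_mult_mat[OF Wc Wa AWc, symmetric])
  then have WH: "W * H = A * W" using left_mult_one_mat[OF AWc] by (simp add: W2)
  have "W * H * mat_adjoint W = A"
    unfolding WH assoc_mult_mat[OF A Wc Wa] W2 using A by simp
  moreover have "W * H * mat_adjoint W = (W * V) * diag_real (Suc n) m * (mat_adjoint V * mat_adjoint W)"
  proof -
    let ?D = "diag_real (Suc n) m"
    have c: "V * ?D \<in> carrier_mat (Suc n) (Suc n)" "W * V * ?D \<in> carrier_mat (Suc n) (Suc n)"
      using Vc Wc by (auto intro!: mult_carrier_mat)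
    have "W * H = W * V * ?D * mat_adjoint V"
      unfolding HV assoc_mult_mat[OF Wc c(1) Va, symmetric]
      by (simp add: assoc_mult_mat[OF Wc Vc diag_real_carrier])
    then show ?thesis by (simp add: assoc_mult_mat[OF c(2) Va Wa])
  qed
  ultimately have "A = (W * V) * diag_real (Suc n) m * (mat_adjoint V * mat_adjoint W)" by simp
  also have "mat_adjoint V * mat_adjoint W = mat_adjoint (W * V)"
    using mat_adjoint_mult[OF Wc Vc] by simp
  finally have "A = (W * V) * diag_real (Suc n) m * mat_adjoint (W * V)" .
  moreover have "mat_adjoint (W * V) * (W * V) = 1\<^sub>m (Suc n)"
  proof -
    have WV: "W * V \<in> carrier_mat (Suc n) (Suc n)" using Wc Vc by simp
    have "mat_adjoint (W * V) * (W * V) = mat_adjoint V * (mat_adjoint W * (W * V))"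
      unfolding mat_adjoint_mult[OF Wc Vc] by (rule assoc_mult_mat[OF Va Wa WV])
    also have "mat_adjoint W * (W * V) = V"
      using left_mult_one_mat[OF Vc] by (simp add: assoc_mult_mat[OF Wa Wc Vc, symmetric] W1)
    finally show ?thesis using uV by (simp add: unitary_mat_def)
  qed
  then have "unitary_mat (Suc n) (W * V)" by (intro unitary_matI) (use Vc Wc in auto)
  ultimately show ?case by blast
qed

section \<open>Functional calculus and pseudoinverse\<close>

lemma mult_carrier_square [simp]:
  "A \<in> carrier_mat n n \<Longrightarrow> B \<in> carrier_mat n n \<Longrightarrow> A * B \<in> carrier_mat n n"
  by (rule mult_carrier_mat)

lemma assoc_mult_square:
  "A \<in> carrier_mat n n \<Longrightarrow> B \<in> carrier_mat n n \<Longrightarrow> C \<in> carrier_mat n n \<Longrightarrow>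
    (A * B) * C = A * (B * (C :: 'a :: semiring_0 mat))"
  by (rule assoc_mult_mat)

lemma unitary_matD:
  assumes "unitary_mat n U"
  shows "U \<in> carrier_mat n n" "mat_adjoint U * U = 1\<^sub>m n" "U * mat_adjoint U = 1\<^sub>m n"
    "mat_adjoint U \<in> carrier_mat n n"
  using assms by (auto simp: unitary_mat_def)

lemma mult_diag_real_index:
  assumes "A \<in> carrier_mat n n" "i < n" "j < n"
  shows "(A * diag_real n f) $$ (i, j) = A $$ (i, j) * f j" "(diag_real n f * A) $$ (i, j) = f i * A $$ (i, j)"
  using assms by (auto simp: index_mult_mat_sum[of _ n n _ n] diag_real_def if_distrib[of "\<lambda>x. _ * x"]
      if_distrib[of "\<lambda>x. x * _"] cong: if_cong)

lemma unitary_cancel: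
  assumes "unitary_mat n U" "B \<in> carrier_mat n n"
  shows "mat_adjoint U * (U * B) = B" "U * (mat_adjoint U * B) = B"
    "(B * mat_adjoint U) * U = B" "(B * U) * mat_adjoint U = B"
proof -
  note U = unitary_matD[OF assms(1)]
  show "mat_adjoint U * (U * B) = B"
    using left_mult_one_mat[OF assms(2)] by (simp add: assoc_mult_square[OF U(4,1) assms(2), symmetric] U(2))
  show "U * (mat_adjoint U * B) = B"
    using left_mult_one_mat[OF assms(2)] by (simp add: assoc_mult_square[OF U(1,4) assms(2), symmetric] U(3))
  show "(B * mat_adjoint U) * U = B"
    using right_mult_one_mat[OF assms(2)] by (simp add: assoc_mult_square[OF assms(2) U(4,1)] U(2))
  show "(B * U) * mat_adjoint U = B"
    using right_mult_one_mat[OF assms(2)] by (simp add: assoc_mult_square[OF assms(2) U(1,4)] U(3))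
qed

text \<open>Functional calculus with the values indexed by the columns of \<open>U\<close> rather
  than by eigenvalues, so that multiplicities play no part in the algebra.\<close>

definition spectral_fun :: "nat \<Rightarrow> complex mat \<Rightarrow> (nat \<Rightarrow> real) \<Rightarrow> complex mat" where
  "spectral_fun n U f = U * diag_real n f * mat_adjoint U"

lemma spectral_fun_carrier [simp]:
  "unitary_mat n U \<Longrightarrow> spectral_fun n U f \<in> carrier_mat n n"
  unfolding spectral_fun_def by (simp add: unitary_matD)

lemma spectral_fun_cong:
  "(\<And>i. i < n \<Longrightarrow> f i = g i) \<Longrightarrow> spectral_fun n U f = spectral_fun n U g"
  unfolding spectral_fun_def
  by (rule arg_cong[where f = "\<lambda>D. U * D * mat_adjoint U"]) (auto simp: diag_real_def intro!: eq_matI)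

lemma spectral_fun_one:
  assumes "unitary_mat n U"
  shows "spectral_fun n U (\<lambda>i. 1) = 1\<^sub>m n"
proof -
  have "diag_real n (\<lambda>i. 1) = 1\<^sub>m n" by (auto simp: diag_real_def intro!: eq_matI)
  then show ?thesis using unitary_matD[OF assms] by (simp add: spectral_fun_def)
qed

lemma spectral_fun_mult:
  assumes U: "unitary_mat n U"
  shows "spectral_fun n U f * spectral_fun n U g = spectral_fun n U (\<lambda>i. f i * g i)"
proof -
  note Uc = unitary_matD[OF U]
  have "spectral_fun n U f * spectral_fun n U g =
      ((U * diag_real n f) * mat_adjoint U) * (U * (diag_real n g * mat_adjoint U))"
    unfolding spectral_fun_def using Uc by (simp add: assoc_mult_square[of U n "diag_real n g"])
  also have "\<dots> = (U * diag_real n f) * (diag_real n g * mat_adjoint U)"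
    using Uc by (subst assoc_mult_square[of _ n]) (simp_all add: unitary_cancel[OF U])
  also have "\<dots> = U * (diag_real n f * diag_real n g) * mat_adjoint U"
    using Uc by (simp add: assoc_mult_square[of _ n])
  finally show ?thesis by (simp add: diag_real_mult spectral_fun_def)
qed

lemma spectral_fun_adjoint:
  assumes U: "unitary_mat n U"
  shows "mat_adjoint (spectral_fun n U f) = spectral_fun n U f"
  unfolding spectral_fun_def using unitary_matD[OF U]
  by (simp add: mat_adjoint_mult[of _ n n _ n] assoc_mult_square[of _ n])

lemma spectral_fun_psd:
  assumes U: "unitary_mat n U" and "\<And>i. i < n \<Longrightarrow> 0 \<le> f i"
  shows "psd_mat n (spectral_fun n U f)"
proof -
  have "spectral_fun n U f = spectral_fun n U (\<lambda>i. sqrt (f i) * sqrt (f i))"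
    by (rule spectral_fun_cong) (use assms(2) in simp)
  also have "\<dots> = spectral_fun n U (\<lambda>i. sqrt (f i)) * mat_adjoint (spectral_fun n U (\<lambda>i. sqrt (f i)))"
    unfolding spectral_fun_adjoint[OF U] spectral_fun_mult[OF U] ..
  also have "psd_mat n \<dots>" using spectral_fun_carrier[OF U] by (rule psd_mat_gram)
  finally show ?thesis .
qed

text \<open>In the basis \<open>U\<close> the matrix of \<open>B\<close> has nonzero entries only at
  pairs \<open>(i, j)\<close> with \<open>f i = f j\<close>. The hypothesis on \<open>g\<close> says
  that \<open>g\<close> is a function of \<open>f\<close>, so its two values agree at those pairs as
  well.\<close>

lemma spectral_fun_commute:
  assumes U: "unitary_mat n U" and B: "B \<in> carrier_mat n n"
    and comm: "B * spectral_fun n U f = spectral_fun n U f * B"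
    and fg: "\<And>i j. i < n \<Longrightarrow> j < n \<Longrightarrow> f i = f j \<Longrightarrow> g i = g j"
  shows "B * spectral_fun n U g = spectral_fun n U g * B"
proof -
  note Uc = unitary_matD[OF U]
  define B' where "B' = mat_adjoint U * B * U"
  have B': "B' \<in> carrier_mat n n" using Uc B by (simp add: B'_def)
  have BU: "B = U * B' * mat_adjoint U"
    unfolding B'_def using Uc B
    by (simp add: assoc_mult_square[of _ n] unitary_cancel[OF U])
  have conj: "mat_adjoint U * (B * spectral_fun n U h) * U = B' * diag_real n h"
    "mat_adjoint U * (spectral_fun n U h * B) * U = diag_real n h * B'" for h
    unfolding B'_def spectral_fun_def using Uc B
    by (simp_all add: assoc_mult_square[of _ n] unitary_cancel[OF U])
  have unconj: "U * (mat_adjoint U * X * U) * mat_adjoint U = X" if "X \<in> carrier_mat n n" for X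
    using that Uc by (simp add: assoc_mult_square[of _ n] unitary_cancel[OF U])
  have e: "B' * diag_real n f = diag_real n f * B'"
    using conj[of f] comm by simp
  have "B' * diag_real n g = diag_real n g * B'"
  proof (rule eq_matI)
    fix i j assume "i < dim_row (diag_real n g * B')" "j < dim_col (diag_real n g * B')"
    then have ij: "i < n" "j < n" using B' by auto
    have "B' $$ (i, j) * f j = f i * B' $$ (i, j)"
      using arg_cong[OF e, of "\<lambda>M. M $$ (i, j)"] ij B' by (simp add: mult_diag_real_index)
    then have "B' $$ (i, j) = 0 \<or> f i = f j" by auto
    then show "(B' * diag_real n g) $$ (i, j) = (diag_real n g * B') $$ (i, j)"
      using ij B' fg[of i j] by (auto simp: mult_diag_real_index)
  qed (use B' in auto)
  then show ?thesis using conj[of g] unconj[of "B * spectral_fun n U g"] unconj[of "spectral_fun n U g * B"] B U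
    by simp
qed

text \<open>Each eigenvalue is the quadratic form at the corresponding column of
  \<open>U\<close>.\<close>

lemma psd_spectral:
  assumes "psd_mat n A"
  shows "\<exists>U l. unitary_mat n U \<and> A = spectral_fun n U l \<and> (\<forall>i < n. 0 \<le> l i)"
proof -
  obtain U l where U: "unitary_mat n U" and A: "A = spectral_fun n U l"
    using spectral_theorem[of n A] assms by (auto simp: psd_mat_def spectral_fun_def)
  note Uc = unitary_matD[OF U]
  have Ac: "A \<in> carrier_mat n n" using A U by simp
  have "0 \<le> l i" if i: "i < n" for i
  proof -
    have "mat_adjoint U * (A * U) = diag_real n l"
      unfolding A spectral_fun_def using Uc by (simp add: assoc_mult_square[of _ n] unitary_cancel[OF U])
    then have "complex_of_real (l i) = (mat_adjoint U * (A * U)) $$ (i, i)"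
      using i by (simp add: diag_real_def)
    also have "\<dots> = (\<Sum>a<n. cnj (U $$ (a, i)) * (\<Sum>b<n. A $$ (a, b) * U $$ (b, i)))"
      using i Uc Ac by (simp add: index_mult_mat_sum[of _ n n _ n])
    also have "\<dots> = (A *\<^sub>v col U i) \<bullet>c col U i"
      using i Uc Ac by (subst quadratic_form_sum[of _ n]) (auto simp: sum_distrib_left mult_ac intro!: sum.cong)
    finally have "l i = Re ((A *\<^sub>v col U i) \<bullet>c col U i)" by (metis Re_complex_of_real)
    then show ?thesis using assms i Uc by (auto simp: psd_mat_def)
  qed
  then show ?thesis using U A by blast
qed

text \<open>Converse of \<open>psd_mat_gram\<close>, used to carry positivity through Kronecker
  products factor by factor.\<close>

lemma psd_gram_exists:
  assumes "psd_mat n A"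
  shows "\<exists>B \<in> carrier_mat n n. A = B * mat_adjoint B"
proof -
  obtain U l where U: "unitary_mat n U" and A: "A = spectral_fun n U l" and l: "\<forall>i < n. 0 \<le> l i"
    using psd_spectral[OF assms] by blast
  let ?B = "spectral_fun n U (\<lambda>i. sqrt (l i))"
  have "?B * mat_adjoint ?B = A"
    unfolding spectral_fun_adjoint[OF U] spectral_fun_mult[OF U] A
    by (rule spectral_fun_cong) (use l in simp)
  then show ?thesis using spectral_fun_carrier[OF U] by metis
qed

text \<open>\<open>S\<close> acts as the inverse square root on the range of \<open>A\<close> and as
  zero on the kernel, so \<open>1 - S A S\<close> is the projection onto the kernel. Commutation
  passes from \<open>A\<close> to \<open>S\<close> because \<open>S\<close> is a function of
  \<open>A\<close>.\<close>

lemma pinv_sqrt_exists: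
  assumes "psd_mat n A"
  shows "\<exists>S. hermitian_mat n S \<and> (\<forall>B \<in> carrier_mat n n. B * A = A * B \<longrightarrow> B * S = S * B) \<and>
    psd_mat n (1\<^sub>m n - S * A * S) \<and> A * (1\<^sub>m n - S * A * S) = 0\<^sub>m n n"
proof -
  obtain U l where U: "unitary_mat n U" and A: "A = spectral_fun n U l" and l: "\<forall>i < n. 0 \<le> l i"
    using psd_spectral[OF assms] by blast
  define g where "g = (\<lambda>i. if l i > 0 then 1 / sqrt (l i) else 0)"
  define h where "h = (\<lambda>i. if l i > 0 then 0 else 1 :: real)"
  let ?S = "spectral_fun n U g"
  have "1\<^sub>m n - ?S * A * ?S = spectral_fun n U h"
  proof -
    have "?S * A * ?S + spectral_fun n U h = spectral_fun n U (\<lambda>i. g i * l i * g i) + spectral_fun n U h"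
      unfolding A by (simp add: spectral_fun_mult[OF U])
    also have "\<dots> = spectral_fun n U (\<lambda>i. g i * l i * g i + h i)"
    proof -
      have "U * diag_real n (\<lambda>i. g i * l i * g i) + U * diag_real n h = U * diag_real n (\<lambda>i. g i * l i * g i + h i)"
        using unitary_matD[OF U]
        by (intro eq_matI) (auto simp: mult_diag_real_index distrib_left)
      then show ?thesis unfolding spectral_fun_def using unitary_matD[OF U]
        by (subst add_mult_distrib_mat[symmetric, of _ n n _ _ n]) simp_all
    qed
    also have "(\<lambda>i. g i * l i * g i + h i) = (\<lambda>i. 1)"
      by (auto simp: g_def h_def fun_eq_iff)
    finally have "?S * A * ?S + spectral_fun n U h = 1\<^sub>m n" by (simp add: spectral_fun_one[OF U])
    then have e: "1\<^sub>m n = ?S * A * ?S + spectral_fun n U h" ..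
    have "?S * A * ?S \<in> carrier_mat n n" "spectral_fun n U h \<in> carrier_mat n n"
      using A U by simp_all
    moreover have "X + H - X = H" if "X \<in> carrier_mat n n" "H \<in> carrier_mat n n" for X H :: "complex mat"
      using that by (intro eq_matI) auto
    ultimately show ?thesis unfolding e by blast
  qed
  moreover have "psd_mat n (spectral_fun n U h)" by (rule spectral_fun_psd[OF U]) (simp add: h_def)
  moreover have "A * spectral_fun n U h = 0\<^sub>m n n"
  proof -
    have "A * spectral_fun n U h = spectral_fun n U (\<lambda>i. l i * h i)"
      unfolding A spectral_fun_mult[OF U] ..
    also have "diag_real n (\<lambda>i. l i * h i) = 0\<^sub>m n n"
      using l by (auto simp: diag_real_def h_def intro!: eq_matI)
    then have "spectral_fun n U (\<lambda>i. l i * h i) = 0\<^sub>m n n"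
      using unitary_matD[OF U] by (simp add: spectral_fun_def)
    finally show ?thesis .
  qed
  moreover have "hermitian_mat n ?S"
    using spectral_fun_adjoint[OF U] U by (simp add: hermitian_mat_def)
  moreover have "B * ?S = ?S * B" if "B \<in> carrier_mat n n" "B * A = A * B" for B
    using that unfolding A by (rule spectral_fun_commute[OF U]) (simp add: g_def)
  ultimately show ?thesis by metis
qed

section \<open>Norm and trace bounds\<close>

lemma cscalar_prod_self:
  "(v :: complex vec) \<bullet>c v = complex_of_real (\<Sum>i<dim_vec v. (cmod (v $ i))\<^sup>2)"
  by (simp add: scalar_prod_def atLeast0LessThan complex_norm_square flip: of_real_power)

lemma l2_norm_vec_sum: "l2_norm_vec v = sqrt (\<Sum>i<dim_vec v. (cmod (v $ i))\<^sup>2)"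
  by (simp only: l2_norm_vec_def cscalar_prod_self Re_complex_of_real)

text \<open>A real supremum bounds the members of its set only when the set is bounded above, which
  is what the proof has to supply; entrywise bounds on the unit ball are enough.\<close>

lemma l2_norm_vec_le_spectral_norm:
  assumes "A \<in> carrier_mat n m" "v \<in> carrier_vec m" "l2_norm_vec v \<le> 1"
  shows "l2_norm_vec (A *\<^sub>v v) \<le> spectral_norm A"
  unfolding spectral_norm_def
proof (rule cSUP_upper)
  show "v \<in> {v \<in> carrier_vec (dim_col A). l2_norm_vec v \<le> 1}" using assms by auto
  show "bdd_above ((\<lambda>v. l2_norm_vec (A *\<^sub>v v)) ` {v \<in> carrier_vec (dim_col A). l2_norm_vec v \<le> 1})"
  proof (rule bdd_aboveI2)
    fix w assume "w \<in> {v \<in> carrier_vec (dim_col A). l2_norm_vec v \<le> 1}"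
    then have w: "w \<in> carrier_vec m" "(\<Sum>i<m. (cmod (w $ i))\<^sup>2) \<le> 1"
      using assms by (auto simp: l2_norm_vec_sum)
    have wj: "cmod (w $ j) \<le> 1" if "j < m" for j
    proof -
      have "(cmod (w $ j))\<^sup>2 \<le> (\<Sum>i<m. (cmod (w $ i))\<^sup>2)"
        using that by (intro member_le_sum) auto
      then have "(cmod (w $ j))\<^sup>2 \<le> 1" using w(2) by linarith
      then show ?thesis by (simp add: power_le_one_iff)
    qed
    show "l2_norm_vec (A *\<^sub>v w) \<le> sqrt (\<Sum>i<n. (\<Sum>j<m. cmod (A $$ (i, j)))\<^sup>2)"
    proof -
      have "cmod ((A *\<^sub>v w) $ i) \<le> (\<Sum>j<m. cmod (A $$ (i, j)))" if "i < n" for i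
      proof -
        have "cmod ((A *\<^sub>v w) $ i) = cmod (\<Sum>j<m. A $$ (i, j) * w $ j)"
          using that assms w(1) by (simp add: scalar_prod_def atLeast0LessThan)
        also have "\<dots> \<le> (\<Sum>j<m. cmod (A $$ (i, j)) * cmod (w $ j))"
          by (rule order_trans[OF norm_sum]) (simp add: norm_mult)
        also have "\<dots> \<le> (\<Sum>j<m. cmod (A $$ (i, j)) * 1)"
          by (intro sum_mono mult_left_mono) (use wj in auto)
        finally show ?thesis by simp
      qed
      then show ?thesis using assms w(1)
        by (auto simp: l2_norm_vec_sum intro!: sum_mono power_mono)
    qed
  qed
qed

lemma mat_trace_spectral_fun:
  assumes U: "unitary_mat n U" and X: "X \<in> carrier_mat n n"
  shows "mat_trace (X * spectral_fun n U f) = (\<Sum>k<n. f k * ((X *\<^sub>v col U k) \<bullet>c col U k))"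
proof -
  note Uc = unitary_matD[OF U]
  have "mat_trace (X * spectral_fun n U f) = mat_trace (diag_real n f * (mat_adjoint U * (X * U)))"
  proof -
    have "mat_trace (X * spectral_fun n U f) = mat_trace ((X * U) * (diag_real n f * mat_adjoint U))"
      unfolding spectral_fun_def using Uc X by (simp add: assoc_mult_square[of _ n])
    also have "\<dots> = mat_trace ((diag_real n f * mat_adjoint U) * (X * U))"
      using Uc X by (intro mat_trace_comm[of _ n n]) simp_all
    finally show ?thesis using Uc X by (simp add: assoc_mult_square[of _ n])
  qed
  also have "\<dots> = (\<Sum>k<n. f k * (mat_adjoint U * (X * U)) $$ (k, k))"
    using Uc X unfolding mat_trace_def by (auto simp: mult_diag_real_index intro!: sum.cong)
  also have "\<dots> = (\<Sum>k<n. f k * ((X *\<^sub>v col U k) \<bullet>c col U k))"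
  proof (rule sum.cong)
    fix k assume "k \<in> {..<n}"
    then have k: "k < n" by simp
    have "(mat_adjoint U * (X * U)) $$ (k, k) = (\<Sum>a<n. cnj (U $$ (a, k)) * (\<Sum>b<n. X $$ (a, b) * U $$ (b, k)))"
      using k Uc X by (simp add: index_mult_mat_sum[of _ n n _ n])
    also have "\<dots> = (X *\<^sub>v col U k) \<bullet>c col U k"
      using k Uc X by (subst quadratic_form_sum[of _ n]) (auto simp: sum_distrib_left mult_ac intro!: sum.cong)
    finally show "f k * (mat_adjoint U * (X * U)) $$ (k, k) = f k * ((X *\<^sub>v col U k) \<bullet>c col U k)"
      by simp
  qed simp
  finally show ?thesis .
qed

lemma unitary_col_cscalar_prod:
  assumes "unitary_mat n U" "k < n"
  shows "col U k \<bullet>c col U k = 1"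
proof -
  have "(mat_adjoint U * U) $$ (k, k) = col U k \<bullet>c col U k"
    using unitary_matD[OF assms(1)] assms(2)
    by (subst index_mult_mat_sum[of _ n n _ n]) (auto simp: scalar_prod_def atLeast0LessThan mult.commute)
  then show ?thesis using unitary_matD[OF assms(1)] assms(2) by simp
qed

lemma hermitian_cscalar_prod:
  assumes "hermitian_mat n A" "v \<in> carrier_vec n" "w \<in> carrier_vec n"
  shows "(A *\<^sub>v v) \<bullet>c w = v \<bullet>c (A *\<^sub>v w)"
proof -
  note A = hermitian_matD[OF assms(1)]
  have "(A *\<^sub>v v) \<bullet>c w = (\<Sum>i<n. \<Sum>j<n. A $$ (i, j) * v $ j * cnj (w $ i))"
    using A(1) assms(2,3) by (auto simp: scalar_prod_def atLeast0LessThan sum_distrib_right intro!: sum.cong)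
  also have "\<dots> = (\<Sum>j<n. \<Sum>i<n. v $ j * cnj (A $$ (j, i) * w $ i))"
    by (subst sum.swap) (auto simp: A(3) intro!: sum.cong)
  also have "\<dots> = v \<bullet>c (A *\<^sub>v w)"
    using A(1) assms(2,3) by (auto simp: scalar_prod_def atLeast0LessThan sum_distrib_left cnj_sum intro!: sum.cong)
  finally show ?thesis .
qed

lemma mat_trace_hermitian_real:
  assumes "hermitian_mat n A" "hermitian_mat n B"
  shows "Im (mat_trace (A * B)) = 0"
proof -
  note A = hermitian_matD[OF assms(1)] and B = hermitian_matD[OF assms(2)]
  have "cnj (mat_trace (A * B)) = (\<Sum>i<n. \<Sum>j<n. A $$ (j, i) * B $$ (i, j))"
    unfolding mat_trace_mult[OF A(1) B(1)] by (auto simp: cnj_sum A(3) B(3) intro!: sum.cong)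
  also have "\<dots> = mat_trace (A * B)"
    unfolding mat_trace_mult[OF A(1) B(1)] by (subst sum.swap) (simp add: mult_ac)
  finally show ?thesis by (metis Reals_cnj_iff complex_is_Real_iff)
qed

lemma square_cscalar_prod:
  assumes "hermitian_mat n X" "v \<in> carrier_vec n"
  shows "((X * X) *\<^sub>v v) \<bullet>c v = complex_of_real ((l2_norm_vec (X *\<^sub>v v))\<^sup>2)"
proof -
  note X = hermitian_matD[OF assms(1)]
  have "((X * X) *\<^sub>v v) \<bullet>c v = (X *\<^sub>v (X *\<^sub>v v)) \<bullet>c v"
    using X(1) assms(2) by (simp add: assoc_mult_mat_vec[of _ n n _ n])
  also have "\<dots> = (X *\<^sub>v v) \<bullet>c (X *\<^sub>v v)"
    using X(1) assms by (intro hermitian_cscalar_prod[of n]) auto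
  finally show ?thesis unfolding cscalar_prod_self l2_norm_vec_sum
    by (simp only: real_sqrt_pow2 sum_nonneg zero_le_power2)
qed

text \<open>Expansion of the squared norm of \<open>X v - t v\<close>, which is nonnegative. A free
  \<open>t\<close>, the same for all \<open>v\<close>, is what later gives the variance inequality
  for a mixture of eigenvectors.\<close>

lemma l2_norm_vec_diff:
  assumes "hermitian_mat n X" "v \<in> carrier_vec n" "v \<bullet>c v = 1"
  shows "2 * t * Re ((X *\<^sub>v v) \<bullet>c v) - t\<^sup>2 \<le> (l2_norm_vec (X *\<^sub>v v))\<^sup>2"
proof -
  note X = hermitian_matD[OF assms(1)]
  let ?w = "X *\<^sub>v v"
  have wc: "?w \<in> carrier_vec n" using X assms by auto
  have "0 \<le> (\<Sum>i<n. (cmod (?w $ i - t * v $ i))\<^sup>2)" by (intro sum_nonneg) auto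
  also have "\<dots> = (\<Sum>i<n. (cmod (?w $ i))\<^sup>2 + t\<^sup>2 * (cmod (v $ i))\<^sup>2 - 2 * t * Re (?w $ i * cnj (v $ i)))"
    by (intro sum.cong refl, unfold cmod_power2) (simp add: power2_eq_square algebra_simps)
  also have "\<dots> = (\<Sum>i<n. (cmod (?w $ i))\<^sup>2) + t\<^sup>2 * (\<Sum>i<n. (cmod (v $ i))\<^sup>2) - 2 * t * Re (?w \<bullet>c v)"
    using wc assms(2) by (simp add: sum.distrib sum_subtractf sum_distrib_left scalar_prod_def atLeast0LessThan Re_sum algebra_simps)
  also have "(\<Sum>i<n. (cmod (v $ i))\<^sup>2) = 1"
    using arg_cong[OF assms(3)[unfolded cscalar_prod_self], of Re] assms(2) by simp
  also have "(\<Sum>i<n. (cmod (?w $ i))\<^sup>2) = (l2_norm_vec ?w)\<^sup>2"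
    using X(1) by (simp add: l2_norm_vec_sum sum_nonneg)
  finally show ?thesis by simp
qed

text \<open>In the eigenbasis of the state all traces against it are averages over the probability
  vector \<open>l\<close>: the first bound is the nonnegativity of a variance, the second uses
  \<open>l k \<le> 1\<close>, the third the operator norm on unit vectors.\<close>

lemma state_observable_bounds:
  assumes \<rho>: "quantum_state n \<rho>" and X: "hermitian_mat n X"
  shows "(Re (mat_trace (X * \<rho>)))\<^sup>2 \<le> Re (mat_trace (X * X * \<rho>))"
    "Re (mat_trace (X * X * \<rho>)) \<le> Re (mat_trace (X * X))"
    "spectral_norm X \<le> 1 \<Longrightarrow> Re (mat_trace (X * X * \<rho>)) \<le> 1"
proof -
  have "psd_mat n \<rho>" and tr: "mat_trace \<rho> = 1" using \<rho> by (auto simp: quantum_state_def)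
  then obtain U l where U: "unitary_mat n U" and \<rho>l: "\<rho> = spectral_fun n U l" and l: "\<forall>i < n. 0 \<le> l i"
    using psd_spectral by blast
  note Uc = unitary_matD[OF U] and Xc = hermitian_matD[OF X]
  have uc: "col U k \<in> carrier_vec n" for k using Uc by auto
  let ?q = "\<lambda>k. (l2_norm_vec (X *\<^sub>v col U k))\<^sup>2"
  have suml: "(\<Sum>k<n. l k) = 1"
  proof -
    have "mat_trace (1\<^sub>m n * \<rho>) = (\<Sum>k<n. complex_of_real (l k))"
      unfolding \<rho>l mat_trace_spectral_fun[OF U one_carrier_mat]
      by (intro sum.cong) (simp_all add: one_mult_mat_vec[OF uc] unitary_col_cscalar_prod[OF U])
    then have "complex_of_real (\<Sum>k<n. l k) = 1"
      using tr \<rho>l U by (simp add: left_mult_one_mat[of _ n n])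
    then show ?thesis by (metis of_real_eq_1_iff)
  qed
  have q: "Re (mat_trace (X * X * spectral_fun n U f)) = (\<Sum>k<n. f k * ?q k)" for f
    unfolding mat_trace_spectral_fun[OF U mult_carrier_square[OF Xc(1) Xc(1)]]
    by (simp add: square_cscalar_prod[OF X uc] flip: of_real_power)
  have m: "Re (mat_trace (X * \<rho>)) = (\<Sum>k<n. l k * Re ((X *\<^sub>v col U k) \<bullet>c col U k))" (is "?t = _")
    unfolding \<rho>l mat_trace_spectral_fun[OF U Xc(1)] by simp
  \<comment> \<open>Taking \<open>t\<close> equal to the mean \<open>?t\<close> makes the left-hand
    side collapse to \<open>?t^2\<close> after averaging.\<close>
  have "(\<Sum>k<n. l k * (2 * ?t * Re ((X *\<^sub>v col U k) \<bullet>c col U k) - ?t\<^sup>2)) \<le> (\<Sum>k<n. l k * ?q k)"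
    using l by (intro sum_mono mult_left_mono l2_norm_vec_diff[OF X uc]) (auto simp: unitary_col_cscalar_prod[OF U])
  also have "(\<Sum>k<n. l k * (2 * ?t * Re ((X *\<^sub>v col U k) \<bullet>c col U k) - ?t\<^sup>2)) = 2 * ?t * ?t - ?t\<^sup>2"
  proof -
    have "(\<Sum>k<n. l k * (2 * ?t * Re ((X *\<^sub>v col U k) \<bullet>c col U k) - ?t\<^sup>2)) =
        2 * ?t * (\<Sum>k<n. l k * Re ((X *\<^sub>v col U k) \<bullet>c col U k)) - ?t\<^sup>2 * (\<Sum>k<n. l k)"
      by (simp add: sum_distrib_left sum_distrib_right algebra_simps sum_subtractf)
    then show ?thesis unfolding m[symmetric] suml by simp
  qed
  finally show "?t\<^sup>2 \<le> Re (mat_trace (X * X * \<rho>))"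
    unfolding \<rho>l q by (simp add: power2_eq_square)
  have l1: "l k \<le> 1" if "k < n" for k
    using member_le_sum[of k "{..<n}" l] that l suml by auto
  have "Re (mat_trace (X * X)) = Re (mat_trace (X * X * spectral_fun n U (\<lambda>i. 1)))"
    unfolding spectral_fun_one[OF U] using Xc(1) by (simp add: right_mult_one_mat[of _ n n])
  then show "Re (mat_trace (X * X * \<rho>)) \<le> Re (mat_trace (X * X))"
    unfolding \<rho>l q using l1 by (auto intro!: sum_mono mult_left_le_one_le l[rule_format])
  show "Re (mat_trace (X * X * \<rho>)) \<le> 1" if "spectral_norm X \<le> 1"
  proof -
    have "?q k \<le> 1" if "k < n" for k
    proof -
      have "l2_norm_vec (col U k) \<le> 1"
        using unitary_col_cscalar_prod[OF U that] by (simp add: l2_norm_vec_def)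
      then have "l2_norm_vec (X *\<^sub>v col U k) \<le> 1"
        using l2_norm_vec_le_spectral_norm[OF Xc(1) uc] \<open>spectral_norm X \<le> 1\<close> by (meson order_trans)
      then show ?thesis by (simp add: l2_norm_vec_sum sum_nonneg power_le_one)
    qed
    then have "(\<Sum>k<n. l k * ?q k) \<le> (\<Sum>k<n. l k * 1)"
      using l by (intro sum_mono mult_left_mono) auto
    then show ?thesis unfolding \<rho>l q using suml by simp
  qed
qed

section \<open>Tensor powers\<close>

lemma kronecker_dim [simp]:
  "dim_row (kronecker A B) = dim_row A * dim_row B" "dim_col (kronecker A B) = dim_col A * dim_col B"
  by (simp_all add: kronecker_def)

lemma kronecker_carrier:
  "A \<in> carrier_mat n m \<Longrightarrow> B \<in> carrier_mat n' m' \<Longrightarrow> kronecker A B \<in> carrier_mat (n * n') (m * m')"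
  by (rule carrier_matI) (simp_all add: carrier_matD)

lemma kronecker_index:
  assumes "A \<in> carrier_mat n m" "B \<in> carrier_mat n' m'" "i < n * n'" "j < m * m'"
  shows "kronecker A B $$ (i, j) = A $$ (i div n', j div m') * B $$ (i mod n', j mod m')"
  using assms by (simp add: kronecker_def carrier_matD)

lemma sum_lessThan_times:
  "(\<Sum>l < b * b'. f (l div b') (l mod b')) = (\<Sum>x < b. \<Sum>y < (b' :: nat). f x y)"
proof (cases "b' = 0")
  case False
  have "(\<Sum>x < b. \<Sum>y < b'. f x y) = (\<Sum>(x, y) \<in> {..<b} \<times> {..<b'}. f x y)"
    by (simp add: sum.cartesian_product)
  also have "\<dots> = (\<Sum>l < b * b'. f (l div b') (l mod b'))"
  proof (rule sum.reindex_bij_witness[of _ "\<lambda>l. (l div b', l mod b')" "\<lambda>(x, y). x * b' + y"])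
    fix p assume "p \<in> {..<b} \<times> {..<b'}"
    then obtain x y where p: "p = (x, y)" "x < b" "y < b'" by auto
    have "x * b' + y < Suc x * b'" using p by simp
    also have "\<dots> \<le> b * b'" using p by (intro mult_right_mono) auto
    finally show "(case p of (x, y) \<Rightarrow> x * b' + y) \<in> {..<b * b'}" using p by simp
  qed (use False in \<open>auto simp: less_mult_imp_div_less\<close>)
  finally show ?thesis ..
qed simp

lemma div_mod_less_times:
  assumes "(i :: nat) < n * n'"
  shows "i div n' < n" "i mod n' < n'"
  using assms by (auto simp: less_mult_imp_div_less intro!: mod_less_divisor) (cases n', auto)

lemma kronecker_mult:
  assumes A: "A \<in> carrier_mat n m" and B: "B \<in> carrier_mat n' m'"
    and C: "C \<in> carrier_mat m k" and D: "D \<in> carrier_mat m' k'"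
  shows "kronecker A B * kronecker C D = kronecker (A * C) (B * D)"
proof (rule eq_matI)
  fix i j assume "i < dim_row (kronecker (A * C) (B * D))" "j < dim_col (kronecker (A * C) (B * D))"
  then have ij: "i < n * n'" "j < k * k'" using assms by (simp_all add: carrier_matD)
  note d = div_mod_less_times[OF ij(1)] div_mod_less_times[OF ij(2)]
  have "(kronecker A B * kronecker C D) $$ (i, j) =
      (\<Sum>l < m * m'. (A $$ (i div n', l div m') * C $$ (l div m', j div k')) *
        (B $$ (i mod n', l mod m') * D $$ (l mod m', j mod k')))"
    using ij
    by (subst index_mult_mat_sum[OF kronecker_carrier[OF A B] kronecker_carrier[OF C D]])
      (auto simp: kronecker_index[OF A B] kronecker_index[OF C D] mult_ac intro!: sum.cong)
  also have "\<dots> = (\<Sum>x < m. \<Sum>y < m'. (A $$ (i div n', x) * C $$ (x, j div k')) *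
        (B $$ (i mod n', y) * D $$ (y, j mod k')))"
    by (rule sum_lessThan_times)
  also have "\<dots> = (A * C) $$ (i div n', j div k') * (B * D) $$ (i mod n', j mod k')"
    unfolding index_mult_mat_sum[OF A C d(1,3)] index_mult_mat_sum[OF B D d(2,4)]
    by (simp add: sum_product)
  also have "\<dots> = kronecker (A * C) (B * D) $$ (i, j)"
    using kronecker_index[OF mult_carrier_mat[OF A C] mult_carrier_mat[OF B D] ij] by simp
  finally show "(kronecker A B * kronecker C D) $$ (i, j) = kronecker (A * C) (B * D) $$ (i, j)" .
qed simp_all

lemma kronecker_adjoint: "mat_adjoint (kronecker A B) = kronecker (mat_adjoint A) (mat_adjoint B)"
proof (rule eq_matI)
  fix i j assume "i < dim_row (kronecker (mat_adjoint A) (mat_adjoint B))"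
    "j < dim_col (kronecker (mat_adjoint A) (mat_adjoint B))"
  then have ij: "i < dim_col A * dim_col B" "j < dim_row A * dim_row B" by simp_all
  show "mat_adjoint (kronecker A B) $$ (i, j) = kronecker (mat_adjoint A) (mat_adjoint B) $$ (i, j)"
    using ij div_mod_less_times[OF ij(1)] div_mod_less_times[OF ij(2)] by (simp add: kronecker_def)
qed simp_all

lemma mat_trace_kronecker:
  assumes A: "A \<in> carrier_mat n n" and B: "B \<in> carrier_mat m m"
  shows "mat_trace (kronecker A B) = mat_trace A * mat_trace B"
proof -
  have "mat_trace (kronecker A B) = (\<Sum>i < n * m. A $$ (i div m, i div m) * B $$ (i mod m, i mod m))"
    using assms by (auto simp: mat_trace_def carrier_matD kronecker_index[OF A B] intro!: sum.cong)
  also have "\<dots> = (\<Sum>x < n. \<Sum>y < m. A $$ (x, x) * B $$ (y, y))"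
    by (rule sum_lessThan_times)
  finally show ?thesis using assms by (simp add: mat_trace_def carrier_matD sum_product)
qed

lemma kronecker_assoc: "kronecker (kronecker A B) C = kronecker A (kronecker B C)"
proof (rule eq_matI)
  let ?r = "dim_row A * (dim_row B * dim_row C)" and ?c = "dim_col A * (dim_col B * dim_col C)"
  fix i j assume "i < dim_row (kronecker A (kronecker B C))" "j < dim_col (kronecker A (kronecker B C))"
  then have ij: "i < ?r" "j < ?c" by simp_all
  then have ij': "i < (dim_row A * dim_row B) * dim_row C" "j < (dim_col A * dim_col B) * dim_col C"
    by (simp_all add: mult.assoc)
  have e: "k div (b * c) = k div c div b" "k mod (b * c) div c = k div c mod b" "k mod (b * c) mod c = k mod c"
    for k b c :: nat
    using div_mult2_eq[of k c b] mod_mult2_eq[of k c b]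
    by (cases "c = 0"; simp add: mult.commute)+
  note d = div_mod_less_times[OF ij(1)] div_mod_less_times[OF ij(2)]
    div_mod_less_times[OF ij'(1)] div_mod_less_times[OF ij'(2)]
  show "kronecker (kronecker A B) C $$ (i, j) = kronecker A (kronecker B C) $$ (i, j)"
    using ij ij' d by (simp add: kronecker_def e)
qed (simp_all add: mult.assoc)

lemma kronecker_one_left [simp]: "kronecker (1\<^sub>m (Suc 0)) A = A"
  by (intro eq_matI) (auto simp: kronecker_def)

text \<open>New factors are put on the left, so factor \<open>l\<close> acts on the digit of weight
  \<open>d ^ l\<close>. Factors may differ, as they must for the effects of a product
  measurement.\<close>

fun tens :: "(nat \<Rightarrow> complex mat) \<Rightarrow> nat \<Rightarrow> complex mat" where
  "tens f 0 = 1\<^sub>m 1"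
| "tens f (Suc n) = kronecker (f n) (tens f n)"

lemma tensor_power_eq_tens: "tensor_power A n = tens (\<lambda>_. A) n"
  by (induction n) auto

lemma tens_carrier:
  "(\<And>l. l < n \<Longrightarrow> f l \<in> carrier_mat a b) \<Longrightarrow> tens f n \<in> carrier_mat (a ^ n) (b ^ n)"
  by (induction n) (auto intro!: kronecker_carrier)

lemma tens_mult:
  assumes "\<And>l. l < n \<Longrightarrow> f l \<in> carrier_mat a b" "\<And>l. l < n \<Longrightarrow> g l \<in> carrier_mat b c"
  shows "tens f n * tens g n = tens (\<lambda>l. f l * g l) n"
  using assms
proof (induction n)
  case (Suc n)
  then show ?case using tens_carrier[of n f a b] tens_carrier[of n g b c]
    by (simp add: kronecker_mult[of _ a b _ "a ^ n" "b ^ n" _ c _ "c ^ n"])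
qed simp

lemma tens_adjoint: "mat_adjoint (tens f n) = tens (\<lambda>l. mat_adjoint (f l)) n"
  by (induction n) (auto simp: kronecker_adjoint)

lemma mat_trace_tens:
  assumes "\<And>l. l < n \<Longrightarrow> f l \<in> carrier_mat a a"
  shows "mat_trace (tens f n) = (\<Prod>l<n. mat_trace (f l))"
  using assms
proof (induction n)
  case 0
  then show ?case by (simp add: mat_trace_def)
next
  case (Suc n)
  then show ?case using tens_carrier[of n f a a]
    by (simp add: mat_trace_kronecker[of _ a _ "a ^ n"])
qed

lemma tensor_power_carrier:
  "A \<in> carrier_mat a b \<Longrightarrow> tensor_power A n \<in> carrier_mat (a ^ n) (b ^ n)"
  unfolding tensor_power_eq_tens by (rule tens_carrier)

lemma tensor_power_mult:
  "A \<in> carrier_mat a b \<Longrightarrow> B \<in> carrier_mat b c \<Longrightarrow> tensor_power A n * tensor_power B n = tensor_power (A * B) n"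
  unfolding tensor_power_eq_tens by (rule tens_mult)

lemma tensor_power_adjoint: "mat_adjoint (tensor_power A n) = tensor_power (mat_adjoint A) n"
  unfolding tensor_power_eq_tens by (rule tens_adjoint)

lemma tensor_power_add: "tensor_power A (m + k) = kronecker (tensor_power A m) (tensor_power A k)"
  by (induction m) (auto simp: kronecker_assoc)

text \<open>Regrouping of copies into batches, needed to apply a product measurement to a long
  tensor power.\<close>

lemma tensor_power_times: "tensor_power A (k * N) = tensor_power (tensor_power A k) N"
  by (induction N) (auto simp: tensor_power_add)

section \<open>Entries of tensor powers as functions of index tuples\<close>

definition digit :: "nat \<Rightarrow> nat \<Rightarrow> nat \<Rightarrow> nat" where
  "digit d i l = (i div d ^ l) mod d"

text \<open>Restriction makes the digit sequence extensional, so that it lies in a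
  \<open>PiE\<close> and sums over basis numbers become sums over tuples.\<close>

definition digits :: "nat \<Rightarrow> nat \<Rightarrow> nat \<Rightarrow> nat \<Rightarrow> nat" where
  "digits d n i = restrict (digit d i) {..<n}"

lemma digit_mod_power:
  assumes "l < n"
  shows "digit d (i mod d ^ n) l = digit d i l"
proof -
  obtain m where n: "n = l + Suc m" using assms less_iff_Suc_add by auto
  have "(i mod (d ^ l * d ^ Suc m)) div d ^ l = (i div d ^ l) mod d ^ Suc m"
    by (cases "d = 0") (auto simp: mod_mult2_eq)
  then show ?thesis unfolding digit_def n power_add
    by (simp add: mod_mod_cancel)
qed

lemma digit_top: "i < d ^ Suc n \<Longrightarrow> digit d i n = i div d ^ n"
  by (simp add: digit_def less_mult_imp_div_less)

lemma tens_index: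
  assumes "\<And>l. l < n \<Longrightarrow> f l \<in> carrier_mat a b" "i < a ^ n" "j < b ^ n"
  shows "tens f n $$ (i, j) = (\<Prod>l<n. f l $$ (digits a n i l, digits b n j l))"
proof -
  have "tens f n $$ (i, j) = (\<Prod>l<n. f l $$ (digit a i l, digit b j l))"
    using assms
  proof (induction n arbitrary: i j)
    case (Suc n)
    have c: "f n \<in> carrier_mat a b" "tens f n \<in> carrier_mat (a ^ n) (b ^ n)"
      using Suc.prems(1) by (auto intro!: tens_carrier)
    have lt: "i < a * a ^ n" "j < b * b ^ n" using Suc.prems by auto
    have "tens f (Suc n) $$ (i, j) = f n $$ (i div a ^ n, j div b ^ n) * tens f n $$ (i mod a ^ n, j mod b ^ n)"
      using kronecker_index[OF c lt] by simp
    also have "tens f n $$ (i mod a ^ n, j mod b ^ n) =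
        (\<Prod>l<n. f l $$ (digit a (i mod a ^ n) l, digit b (j mod b ^ n) l))"
      using Suc.prems div_mod_less_times[OF lt(1)] div_mod_less_times[OF lt(2)] by (intro Suc.IH) auto
    also have "\<dots> = (\<Prod>l<n. f l $$ (digit a i l, digit b j l))"
      by (intro prod.cong) (auto simp: digit_mod_power)
    finally show ?case using Suc.prems by (simp add: digit_top mult.commute)
  qed simp
  then show ?thesis by (simp add: digits_def)
qed

lemma digits_inj:
  assumes "i < d ^ n" "j < d ^ n" "\<And>l. l < n \<Longrightarrow> digit d i l = digit d j l"
  shows "i = j"
  using assms
proof (induction n arbitrary: i j)
  case (Suc n)
  have lt: "i < d * d ^ n" "j < d * d ^ n" using Suc.prems(1,2) by simp_all
  have q: "i div d ^ n = j div d ^ n"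
    unfolding digit_top[OF Suc.prems(1), symmetric] digit_top[OF Suc.prems(2), symmetric]
    by (rule Suc.prems(3)) simp
  have r: "i mod d ^ n = j mod d ^ n"
  proof (rule Suc.IH)
    show "i mod d ^ n < d ^ n" "j mod d ^ n < d ^ n"
      by (rule div_mod_less_times(2)[OF lt(1)], rule div_mod_less_times(2)[OF lt(2)])
    show "digit d (i mod d ^ n) l = digit d (j mod d ^ n) l" if "l < n" for l
      unfolding digit_mod_power[OF that] by (rule Suc.prems(3)) (use that in simp)
  qed
  have "i = i div d ^ n * d ^ n + i mod d ^ n" by (rule div_mult_mod_eq[symmetric])
  also have "\<dots> = j" unfolding q r by (rule div_mult_mod_eq)
  finally show ?case .
qed simp

text \<open>Injectivity and equal cardinalities give surjectivity without an explicit
  inverse.\<close>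

lemma bij_betw_digits: "bij_betw (digits d n) {..<d ^ n} (PiE {..<n} (\<lambda>_. {..<d}))"
proof (cases "d = 0")
  case True
  then show ?thesis by (cases n) (auto simp: bij_betw_def digits_def inj_on_def fun_eq_iff)
next
  case False
  have inj: "inj_on (digits d n) {..<d ^ n}"
  proof (rule inj_onI)
    fix i j assume ij: "i \<in> {..<d ^ n}" "j \<in> {..<d ^ n}" "digits d n i = digits d n j"
    have "digit d i l = digit d j l" if "l < n" for l
      using fun_cong[OF ij(3), of l] that by (simp add: digits_def)
    then show "i = j" using digits_inj[of i d n j] ij by auto
  qed
  moreover have "digits d n ` {..<d ^ n} \<subseteq> PiE {..<n} (\<lambda>_. {..<d})"
    using False by (simp add: digits_def digit_def image_subset_iff restrict_PiE_iff)
  moreover have "card (digits d n ` {..<d ^ n}) = card (PiE {..<n} (\<lambda>_. {..<d}))"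
    using card_image[OF inj] by (simp add: card_PiE)
  ultimately show ?thesis unfolding bij_betw_def
    by (metis card_subset_eq finite_PiE finite_lessThan)
qed

lemma sum_digits: "(\<Sum>i < d ^ n. F (digits d n i)) = (\<Sum>I \<in> PiE {..<n} (\<lambda>_. {..<d}). F I)"
  by (rule sum.reindex_bij_betw[OF bij_betw_digits])

text \<open>Gram factors of the single matrices tensor to a Gram factor of the product.\<close>

lemma psd_mat_tens:
  assumes "\<And>l. l < n \<Longrightarrow> psd_mat a (f l)"
  shows "psd_mat (a ^ n) (tens f n)"
proof -
  have "\<forall>l. \<exists>B. l < n \<longrightarrow> B \<in> carrier_mat a a \<and> f l = B * mat_adjoint B"
    using psd_gram_exists assms by blast
  then obtain B where B: "\<And>l. l < n \<Longrightarrow> B l \<in> carrier_mat a a"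
    "\<And>l. l < n \<Longrightarrow> f l = B l * mat_adjoint (B l)" by metis
  have cong: "tens f m = tens g m" if "\<And>l. l < m \<Longrightarrow> f l = g l" for m and f g :: "nat \<Rightarrow> complex mat"
    using that by (induction m) auto
  have "tens f n = tens B n * mat_adjoint (tens B n)"
    unfolding tens_adjoint using B
    by (subst tens_mult[of _ _ a a _ a]) (auto intro: cong)
  then show ?thesis using psd_mat_gram[OF tens_carrier[of n B a a]] B(1) by simp
qed

section \<open>Gaussian moments with finite support\<close>

lemma spectral_fun_index:
  assumes U: "unitary_mat n U" and ij: "i < n" "j < n"
  shows "spectral_fun n U f $$ (i, j) = (\<Sum>k<n. U $$ (i, k) * f k * cnj (U $$ (j, k)))"
  unfolding spectral_fun_def using unitary_matD[OF U] ij
  by (subst index_mult_mat_sum[of _ n n _ n]) (auto simp: mult_diag_real_index)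

text \<open>The left-hand side applies row \<open>i\<close> of the Jacobi matrix, with entries
  \<open>i\<close>, \<open>2 i + 1\<close>, \<open>i + 1\<close>, to the coefficients for
  \<open>a\<close>; the right-hand side is the coefficient for \<open>a + 1\<close>. The truncated
  \<open>i - 1\<close> at \<open>i = 0\<close> is harmless because its factor is zero.\<close>

lemma laguerre_coeff_rec:
  "real i * (fact a * real (a choose (i - 1))) + (2 * real i + 1) * (fact a * real (a choose i))
    + (real i + 1) * (fact a * real (a choose Suc i)) = fact (Suc a) * real (Suc a choose i)"
proof -
  have 1: "(real i + 1) * real (a choose Suc i) + real i * real (a choose i) = real a * real (a choose i)"
  proof (cases "i \<le> a")
    case True
    have "Suc i * (a choose Suc i) = (a - i) * (a choose i)"
      by (simp only: binomial_absorption binomial_absorb_comp)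
    then have "real (Suc i) * real (a choose Suc i) = real (a - i) * real (a choose i)"
      by (metis of_nat_mult)
    then show ?thesis using True by (simp add: of_nat_diff algebra_simps)
  next
    case False
    then show ?thesis by (simp add: binomial_eq_0)
  qed
  have 2: "real i * real (a choose (i - 1)) + real i * real (a choose i) = real i * real (Suc a choose i)"
    by (cases i) (simp_all add: algebra_simps)
  have 3: "(real a + 1 - real i) * real (Suc a choose i) = (real a + 1) * real (a choose i)"
  proof (cases "i \<le> Suc a")
    case True
    have "(Suc a - i) * (Suc a choose i) = Suc a * (a choose i)"
      using binomial_absorb_comp[of "Suc a" i] by simp
    then have "real (Suc a - i) * real (Suc a choose i) = real (Suc a) * real (a choose i)"
      by (metis of_nat_mult)
    then show ?thesis using True by (simp add: of_nat_diff algebra_simps)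
  next
    case False
    then show ?thesis by (simp add: binomial_eq_0)
  qed
  have "fact (Suc a) * real (Suc a choose i) = fact a * ((real a + 1) * real (Suc a choose i))"
    by simp
  also have "\<dots> = fact a * (real i * real (a choose (i - 1)) + (2 * real i + 1) * real (a choose i)
    + (real i + 1) * real (a choose Suc i))"
  proof (rule arg_cong[where f = "\<lambda>x. fact a * x"])
    show "(real a + 1) * real (Suc a choose i) = real i * real (a choose (i - 1)) +
      (2 * real i + 1) * real (a choose i) + (real i + 1) * real (a choose Suc i)"
      using 1 2 3 by (simp add: algebra_simps)
  qed
  finally show ?thesis by (simp add: algebra_simps)
qed

text \<open>
  Gauss--Laguerre quadrature: the nodes are the eigenvalues of the truncated Jacobi matrix of the
  Laguerre polynomials, whose \<open>a\<close>-th power maps \<open>e\<^sub>0\<close> to \<open>\<Sum>\<^sub>i a! (a choose i) e\<^sub>i\<close>.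
\<close>

lemma exponential_quadrature:
  "\<exists>(J :: nat) p t. (\<forall>j < J. 0 \<le> p j \<and> 0 \<le> t j) \<and> (\<forall>a \<le> K. (\<Sum>j<J. p j * t j ^ a) = (fact a :: real))"
proof -
  \<comment> \<open>Powers up to \<open>K\<close> move the first basis vector only within the
    indices \<open>0\<close> to \<open>K\<close>, so at this size the truncation is not
    felt.\<close>
  define N where "N = Suc K"
  define T :: "complex mat" where "T = mat N N (\<lambda>(i, j). if i = j then 2 * of_nat i + 1
    else if i = Suc j then of_nat i else if j = Suc i then of_nat j else 0)"
  \<comment> \<open>A bidiagonal Cholesky factor of \<open>T\<close>. It shows that \<open>T\<close>
    is positive semidefinite, so that the nodes are nonnegative and have square roots.\<close>
  define B :: "complex mat" where
    "B = mat N N (\<lambda>(a, i). of_real (sqrt (real (Suc i))) * (if a = i \<or> a = Suc i then 1 else 0))"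
  have Bc: "B \<in> carrier_mat N N" and Tc: "T \<in> carrier_mat N N" by (auto simp: B_def T_def)
  have "B * mat_adjoint B = T"
  proof (rule eq_matI)
    fix a b assume "a < dim_row T" "b < dim_col T"
    then have ab: "a < N" "b < N" using Tc by auto
    have "(B * mat_adjoint B) $$ (a, b) = (\<Sum>i<N. B $$ (a, i) * cnj (B $$ (b, i)))"
      using ab Bc by (simp add: index_mult_mat_sum[of _ N N _ N])
    also have "\<dots> = (\<Sum>i<N. (if a = i then (if b = a \<or> b = Suc a then of_nat (Suc a) else 0) else 0)
        + (if a = Suc i then (if Suc b = a \<or> b = a then of_nat a else 0) else 0))"
    proof (rule sum.cong)
      fix i assume i: "i \<in> {..<N}"
      have s: "complex_of_real (sqrt (real (Suc i))) * complex_of_real (sqrt (real (Suc i))) = of_nat (Suc i)"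
        by (metis of_real_mult of_real_of_nat_eq real_sqrt_mult_self abs_of_nat)
      show "B $$ (a, i) * cnj (B $$ (b, i)) =
        (if a = i then (if b = a \<or> b = Suc a then of_nat (Suc a) else 0) else 0)
        + (if a = Suc i then (if Suc b = a \<or> b = a then of_nat a else 0) else 0)"
        using ab i s by (auto simp: B_def)
    qed simp
    also have "\<dots> = T $$ (a, b)"
    proof -
      have "(\<Sum>i<N. if a = Suc i then c else (0 :: complex)) = (if a = 0 then 0 else c)" for c
        using ab(1) by (cases a) auto
      then show ?thesis using ab by (auto simp: sum.distrib T_def)
    qed
    finally show "(B * mat_adjoint B) $$ (a, b) = T $$ (a, b)" .
  qed (use Bc Tc in auto)
  then have "psd_mat N T" using psd_mat_gram[OF Bc] by simp
  then obtain U l where U: "unitary_mat N U" and Tl: "T = spectral_fun N U l" and l: "\<forall>i < N. 0 \<le> l i"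
    using psd_spectral by blast
  have pow: "spectral_fun N U (\<lambda>k. l k ^ a) $$ (i, 0) = of_real (fact a * real (a choose i))"
    if "a \<le> K" "i < N" for a i
    using that
  proof (induction a arbitrary: i)
    case 0
    then show ?case by (cases i) (simp_all add: spectral_fun_one[OF U])
  next
    case (Suc a)
    let ?c = "\<lambda>i. complex_of_real (fact a * real (a choose i))"
    have "spectral_fun N U (\<lambda>k. l k ^ Suc a) = T * spectral_fun N U (\<lambda>k. l k ^ a)"
      unfolding Tl spectral_fun_mult[OF U] by simp
    moreover have "0 < N" by (simp add: N_def)
    ultimately have "spectral_fun N U (\<lambda>k. l k ^ Suc a) $$ (i, 0) = (\<Sum>j<N. T $$ (i, j) * ?c j)"
      using Suc.prems index_mult_mat_sum[OF Tc spectral_fun_carrier[OF U], of i 0 "\<lambda>k. l k ^ a"]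
      by (simp add: Suc.IH)
    also have "\<dots> = (\<Sum>j<N. (if j = i then (2 * of_nat i + 1) * ?c i else 0)
      + (if i = Suc j then of_nat i * ?c (i - 1) else 0) + (if j = Suc i then of_nat (Suc i) * ?c (Suc i) else 0))"
      using Suc.prems by (intro sum.cong) (auto simp: T_def)
    also have "\<dots> = of_nat i * ?c (i - 1) + (2 * of_nat i + 1) * ?c i + of_nat (Suc i) * ?c (Suc i)"
    proof -
      have "(\<Sum>j<N. if i = Suc j then of_nat i * ?c (i - 1) else 0) = of_nat i * ?c (i - 1)"
        using Suc.prems by (cases i) auto
      \<comment> \<open>At \<open>Suc i = N\<close> the neighbour lies outside the matrix, but its
        coefficient \<open>a choose N\<close> is zero because \<open>a < N\<close>.\<close>
      moreover have "(\<Sum>j<N. if j = Suc i then of_nat (Suc i) * ?c (Suc i) else 0) = of_nat (Suc i) * ?c (Suc i)"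
        using Suc.prems by (cases "Suc i < N") (auto simp: N_def)
      ultimately show ?thesis using Suc.prems by (simp add: sum.distrib)
    qed
    also have "\<dots> = of_real (fact (Suc a) * real (Suc a choose i))"
      unfolding laguerre_coeff_rec[symmetric] by simp
    finally show ?case .
  qed
  \<comment> \<open>The weights are the squared moduli of the first row of \<open>U\<close>: with
    them the quadrature sum is entry \<open>(0, 0)\<close> of the \<open>a\<close>-th power of
    \<open>T\<close>, whose value is \<open>a!\<close>.\<close>
  have "(\<Sum>j<N. (cmod (U $$ (0, j)))\<^sup>2 * l j ^ a) = fact a" if "a \<le> K" for a
  proof -
    have "complex_of_real (fact a) = (\<Sum>k<N. U $$ (0, k) * complex_of_real (l k ^ a) * cnj (U $$ (0, k)))"
      using pow[OF that, of 0] spectral_fun_index[OF U, of 0 0] by (simp add: N_def)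
    also have "\<dots> = (\<Sum>k<N. complex_of_real ((cmod (U $$ (0, k)))\<^sup>2) * complex_of_real (l k ^ a))"
      by (simp only: complex_norm_square mult_ac)
    finally have "complex_of_real (fact a) = complex_of_real (\<Sum>k<N. (cmod (U $$ (0, k)))\<^sup>2 * l k ^ a)"
      by simp
    then show ?thesis by (metis of_real_eq_iff)
  qed
  then show ?thesis using l by (intro exI[of _ N] exI[of _ "\<lambda>j. (cmod (U $$ (0, j)))\<^sup>2"] exI[of _ l]) auto
qed

text \<open>A geometric sum over the powers of a root of unity \<open>\<zeta>\<close>. The bounds on
  \<open>a\<close> and \<open>b\<close> give \<open>|a - b| < L\<close>, so
  \<open>\<zeta> = 1\<close> only if \<open>a = b\<close>.\<close>

lemma sum_roots_of_unity:
  assumes "a < L" "b < L"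
  shows "(\<Sum>m<L. cis (2 * pi * real m / real L) ^ a * cnj (cis (2 * pi * real m / real L)) ^ b)
    = (if a = b then of_nat L else 0)"
proof -
  have L: "0 < L" using assms by auto
  define \<zeta> where "\<zeta> = cis (2 * pi * (real a - real b) / real L)"
  have "cis (2 * pi * real m / real L) ^ a * cnj (cis (2 * pi * real m / real L)) ^ b = \<zeta> ^ m" for m
    by (simp add: \<zeta>_def cis_cnj Complex.DeMoivre cis_mult) (simp add: field_simps diff_divide_distrib)
  then have e: "(\<Sum>m<L. cis (2 * pi * real m / real L) ^ a * cnj (cis (2 * pi * real m / real L)) ^ b)
      = (\<Sum>m<L. \<zeta> ^ m)" by simp
  show ?thesis
  proof (cases "a = b")
    case True
    then show ?thesis unfolding e by (simp add: \<zeta>_def)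
  next
    case False
    have "\<zeta> ^ L = cis (2 * pi * of_int (int a - int b))"
      unfolding \<zeta>_def Complex.DeMoivre using L by simp
    then have z1: "\<zeta> ^ L = 1" by (simp add: cis_multiple_2pi)
    have "\<zeta> \<noteq> 1"
    proof
      assume "\<zeta> = 1"
      then have "cos (2 * pi * (real a - real b) / real L) = 1" by (simp add: \<zeta>_def complex_eq_iff)
      then obtain n :: int where "2 * pi * (real a - real b) / real L = of_int n * 2 * pi"
        by (auto simp: cos_one_2pi_int)
      then have "2 * pi * ((real a - real b) / real L) = 2 * pi * of_int n" by (simp add: mult_ac)
      then have "(real a - real b) / real L = of_int n" by (subst (asm) mult_left_cancel) simp_all
      then have "real a - real b = of_int n * real L" using L by (simp add: field_simps)
      then have "of_int (int a - int b) = (of_int (n * int L) :: real)" by simp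
      then have "int a - int b = n * int L" by linarith
      then have "int L dvd int a - int b" by simp
      moreover have "\<bar>int a - int b\<bar> < int L" using assms by auto
      moreover have "int a - int b \<noteq> 0" using False by simp
      ultimately show False using dvd_imp_le_int[of "int a - int b" "int L"] by simp
    qed
    then show ?thesis unfolding e using False z1 by (simp add: geometric_sum)
  qed
qed

text \<open>A standard complex Gaussian has a uniform phase and an independent, exponentially
  distributed squared modulus, whose moments are \<open>a!\<close>. The phase is replaced by the
  \<open>(K + 1)\<close>-th roots of unity and the squared modulus by the quadrature nodes.\<close>

lemma gaussian_design_exists:
  "\<exists>(Z :: (nat \<times> nat) set) w z. finite Z \<and> (\<forall>c \<in> Z. 0 \<le> w c) \<and>
    (\<forall>a \<le> K. \<forall>b \<le> K. (\<Sum>c\<in>Z. complex_of_real (w c) * z c ^ a * cnj (z c) ^ b) = (if a = b then fact a else 0))"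
proof -
  obtain J :: nat and p t where pt: "\<forall>j < J. 0 \<le> p j \<and> 0 \<le> t j"
    and m: "\<forall>a \<le> K. (\<Sum>j<J. p j * t j ^ a) = (fact a :: real)"
    using exponential_quadrature by blast
  define L where "L = Suc K"
  define z where "z = (\<lambda>(j, m). complex_of_real (sqrt (t j)) * cis (2 * pi * real m / real L))"
  define w where "w = (\<lambda>(j :: nat, m :: nat). p j / real L)"
  have "(\<Sum>c\<in>{..<J} \<times> {..<L}. complex_of_real (w c) * z c ^ a * cnj (z c) ^ b) = (if a = b then fact a else 0)"
    if ab: "a \<le> K" "b \<le> K" for a b
  proof -
    let ?u = "\<lambda>m. cis (2 * pi * real m / real L)"
    have "(\<Sum>c\<in>{..<J} \<times> {..<L}. complex_of_real (w c) * z c ^ a * cnj (z c) ^ b) =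
       (\<Sum>j<J. \<Sum>m<L. complex_of_real (w (j, m)) * z (j, m) ^ a * cnj (z (j, m)) ^ b)"
      by (simp add: sum.cartesian_product case_prod_unfold)
    also have "\<dots> = (\<Sum>j<J. complex_of_real (p j / real L * sqrt (t j) ^ a * sqrt (t j) ^ b) * (\<Sum>m<L. ?u m ^ a * cnj (?u m) ^ b))"
      by (auto simp: w_def z_def sum_distrib_left power_mult_distrib mult_ac intro!: sum.cong)
    also have "\<dots> = (\<Sum>j<J. complex_of_real (p j / real L * sqrt (t j) ^ a * sqrt (t j) ^ b) * (if a = b then of_nat L else 0))"
      by (subst sum_roots_of_unity) (use ab in \<open>auto simp: L_def\<close>)
    also have "\<dots> = (if a = b then complex_of_real (\<Sum>j<J. p j * t j ^ a) else 0)"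
    proof (cases "a = b")
      case True
      have "complex_of_real (p j / real L * sqrt (t j) ^ a * sqrt (t j) ^ a) * of_nat L = complex_of_real (p j * t j ^ a)"
        if "j < J" for j
      proof -
        have "sqrt (t j) ^ a * sqrt (t j) ^ a = t j ^ a"
          using pt that by (simp flip: power_mult_distrib)
        then have "p j / real L * sqrt (t j) ^ a * sqrt (t j) ^ a * real L = p j * t j ^ a"
          by (simp add: L_def field_simps)
        then show ?thesis by (metis of_real_mult of_real_of_nat_eq)
      qed
      then show ?thesis using True by (simp del: of_real_mult of_real_divide of_real_power)
    qed simp
    finally show ?thesis using m ab by (auto simp del: of_real_sum)
  qed
  moreover have "\<forall>c \<in> {..<J} \<times> {..<L}. 0 \<le> w c" using pt by (auto simp: w_def)
  ultimately show ?thesis by (intro exI[of _ "{..<J} \<times> {..<L}"] exI[of _ w] exI[of _ z]) auto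
qed

text \<open>
  A finitely supported imitation of independent standard complex Gaussian variables \<open>V x e\<close>:
  all joint moments of order at most \<open>K\<close> agree.
\<close>

locale gaussian_family =
  fixes E :: "'e set" and K :: nat and X :: "'x set" and p :: "'x \<Rightarrow> real" and V :: "'x \<Rightarrow> 'e \<Rightarrow> complex"
  assumes finite_E: "finite E" and finite_X: "finite X" and p_nonneg: "x \<in> X \<Longrightarrow> 0 \<le> p x"
    and moments: "(\<And>e. e \<in> E \<Longrightarrow> m e \<le> K) \<Longrightarrow> (\<And>e. e \<in> E \<Longrightarrow> n e \<le> K) \<Longrightarrow>
      (\<Sum>x\<in>X. p x * (\<Prod>e\<in>E. V x e ^ m e * cnj (V x e) ^ n e)) =
      (\<Prod>e\<in>E. if m e = n e then fact (m e) else 0)"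

text \<open>Independence is imitated by the product of one design per element of \<open>E\<close>:
  the sum over \<open>PiE\<close> of a product splits into a product of sums.\<close>

lemma gaussian_family_exists:
  fixes E :: "'e set"
  assumes "finite E"
  shows "\<exists>(X :: ('e \<Rightarrow> nat \<times> nat) set) p V. gaussian_family E K X p V"
proof -
  obtain Z :: "(nat \<times> nat) set" and w z where Z: "finite Z" "\<forall>c \<in> Z. 0 \<le> w c"
    and m: "\<And>a b. a \<le> K \<Longrightarrow> b \<le> K \<Longrightarrow>
      (\<Sum>c\<in>Z. complex_of_real (w c) * z c ^ a * cnj (z c) ^ b) = (if a = b then fact a else 0)"
    using gaussian_design_exists[of K] by blast
  have "gaussian_family E K (PiE E (\<lambda>_. Z)) (\<lambda>x. \<Prod>e\<in>E. w (x e)) (\<lambda>x e. z (x e))"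
  proof
    fix f g :: "'e \<Rightarrow> nat" assume f: "\<And>e. e \<in> E \<Longrightarrow> f e \<le> K" and g: "\<And>e. e \<in> E \<Longrightarrow> g e \<le> K"
    have "(\<Sum>x\<in>PiE E (\<lambda>_. Z). complex_of_real (\<Prod>e\<in>E. w (x e)) * (\<Prod>e\<in>E. z (x e) ^ f e * cnj (z (x e)) ^ g e))
      = (\<Sum>x\<in>PiE E (\<lambda>_. Z). \<Prod>e\<in>E. complex_of_real (w (x e)) * z (x e) ^ f e * cnj (z (x e)) ^ g e)"
      by (simp add: prod.distrib mult.assoc)
    also have "\<dots> = (\<Prod>e\<in>E. \<Sum>c\<in>Z. complex_of_real (w c) * z c ^ f e * cnj (z c) ^ g e)"
      using assms Z by (intro prod_sum_PiE[symmetric]) auto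
    finally show "(\<Sum>x\<in>PiE E (\<lambda>_. Z). complex_of_real (\<Prod>e\<in>E. w (x e)) * (\<Prod>e\<in>E. z (x e) ^ f e * cnj (z (x e)) ^ g e))
      = (\<Prod>e\<in>E. if f e = g e then fact (f e) else 0)"
      using f g by (simp add: m)
  qed (use assms Z in \<open>auto intro!: finite_PiE prod_nonneg\<close>)
  then show ?thesis by blast
qed

section \<open>Wick calculus for the discrete Gaussians\<close>

definition occ :: "nat \<Rightarrow> (nat \<Rightarrow> 'e) \<Rightarrow> 'e \<Rightarrow> nat" where
  "occ k \<alpha> e = (\<Sum>l<k. if \<alpha> l = e then 1 else 0)"

lemma occ_le: "occ k \<alpha> e \<le> k"
  using sum_mono[of "{..<k}" "\<lambda>l. if \<alpha> l = e then 1 else 0" "\<lambda>_. 1 :: nat"] by (simp add: occ_def)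

lemma occ_Suc_upd: "occ (Suc k) (\<alpha>(k := a)) = (occ k \<alpha>)(a := Suc (occ k \<alpha> a))"
  by (auto simp: occ_def fun_eq_iff)

lemma occ_upd:
  assumes "l < k" "\<alpha> l = a"
  shows "occ k (\<alpha>(l := b)) = (let f = (occ k \<alpha>)(a := occ k \<alpha> a - 1) in f(b := Suc (f b)))"
    "0 < occ k \<alpha> a"
proof -
  have 1: "occ k (\<alpha>(l := c)) e = (if c = e then 1 else 0) + (\<Sum>j\<in>{..<k} - {l}. if \<alpha> j = e then 1 else 0)" for c e
    using assms(1) unfolding occ_def by (subst sum.remove[of _ l]) auto
  have 2: "occ k \<alpha> e = (if a = e then 1 else 0) + (\<Sum>j\<in>{..<k} - {l}. if \<alpha> j = e then 1 else 0)" for e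
    using 1[of a e] assms(2) by (simp add: fun_upd_idem)
  show "occ k (\<alpha>(l := b)) = (let f = (occ k \<alpha>)(a := occ k \<alpha> a - 1) in f(b := Suc (f b)))"
    by (auto simp: fun_eq_iff 1 2 Let_def)
  show "0 < occ k \<alpha> a" using 2[of a] by simp
qed

lemma prod_tuple_eq:
  assumes "finite E" "\<And>l. l < k \<Longrightarrow> \<alpha> l \<in> E"
  shows "(\<Prod>l<k. (f :: 'e \<Rightarrow> 'b :: comm_monoid_mult) (\<alpha> l)) = (\<Prod>e\<in>E. f e ^ occ k \<alpha> e)"
  using assms(2)
proof (induction k)
  case (Suc k)
  have "(\<Prod>e\<in>E. f e ^ occ (Suc k) \<alpha> e) = (\<Prod>e\<in>E. f e ^ occ k \<alpha> e * (if \<alpha> k = e then f e else 1))"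
    by (intro prod.cong) (auto simp: occ_def mult.commute)
  also have "\<dots> = (\<Prod>e\<in>E. f e ^ occ k \<alpha> e) * f (\<alpha> k)"
    using assms(1) Suc.prems[of k] by (simp add: prod.distrib)
  finally show ?case using Suc by simp
qed (simp add: occ_def)

text \<open>The moment of independent standard complex Gaussians with exponents \<open>m\<close> for
  the variables and \<open>n\<close> for their conjugates.\<close>

definition wick :: "'e set \<Rightarrow> ('e \<Rightarrow> nat) \<Rightarrow> ('e \<Rightarrow> nat) \<Rightarrow> complex" where
  "wick E m n = (\<Prod>e\<in>E. if m e = n e then fact (m e) else 0)"

text \<open>An extra \<open>V a\<close> pairs either with the new conjugate of \<open>V b\<close>,
  if \<open>a = b\<close>, or with one of the \<open>n a\<close> conjugates of \<open>V a\<close>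
  already present; in the second case the conjugate of \<open>V b\<close> takes the place that
  becomes free. Removing \<open>a\<close> before adding \<open>b\<close> also covers
  \<open>a = b\<close>, and at \<open>n a = 0\<close> the truncated subtraction is multiplied by
  zero.\<close>

lemma wick_rec:
  assumes E: "finite E" "a \<in> E" "b \<in> E"
  shows "wick E (m(a := Suc (m a))) (n(b := Suc (n b))) = (if a = b then wick E m n else 0) +
    of_nat (n a) * wick E m (let f = n(a := n a - 1) in f(b := Suc (f b)))"
proof -
  have split: "wick E m n = (if m a = n a then fact (m a) else 0) * wick (E - {a}) m n" for m n
    unfolding wick_def using E by (simp add: prod.remove)
  have cong: "wick (E - {a}) m n = wick (E - {a}) m' n'"
    if "\<And>e. e \<noteq> a \<Longrightarrow> m e = m' e" "\<And>e. e \<noteq> a \<Longrightarrow> n e = n' e" for m n m' n'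
    unfolding wick_def using that by (intro prod.cong) auto
  show ?thesis
  proof (cases "a = b")
    case True
    have c: "wick (E - {a}) (m(a := Suc (m a))) (n(b := Suc (n b))) = wick (E - {a}) m n"
      using True by (intro cong) auto
    show ?thesis
    proof (cases "n a = 0")
      case True
      then show ?thesis using \<open>a = b\<close> split[of "m(a := Suc (m a))"] split[of m n] c by auto
    next
      case False
      then have "(let f = n(a := n a - 1) in f(b := Suc (f b))) = n" using \<open>a = b\<close> by (auto simp: Let_def)
      then show ?thesis using \<open>a = b\<close> split[of "m(a := Suc (m a))"] split[of m n] c
        by (auto simp: algebra_simps)
    qed
  next
    case False
    let ?n' = "let f = n(a := n a - 1) in f(b := Suc (f b))"
    have c: "wick (E - {a}) (m(a := Suc (m a))) (n(b := Suc (n b))) = wick (E - {a}) m ?n'"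
      using False by (intro cong) (auto simp: Let_def)
    have n': "?n' a = n a - 1" using False by (simp add: Let_def)
    show ?thesis
      using False unfolding split[of "m(a := Suc (m a))"] split[of m ?n'] c n'
      by (cases "n a") auto
  qed
qed

context gaussian_family
begin

definition V_moment :: "nat \<Rightarrow> (nat \<Rightarrow> 'e) \<Rightarrow> (nat \<Rightarrow> 'e) \<Rightarrow> complex" where
  "V_moment k \<alpha> \<beta> = (\<Sum>x\<in>X. p x * (\<Prod>l<k. V x (\<alpha> l) * cnj (V x (\<beta> l))))"

lemma V_moment_cong:
  "(\<And>l. l < k \<Longrightarrow> \<alpha> l = \<alpha>' l) \<Longrightarrow> (\<And>l. l < k \<Longrightarrow> \<beta> l = \<beta>' l) \<Longrightarrow> V_moment k \<alpha> \<beta> = V_moment k \<alpha>' \<beta>'"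
  unfolding V_moment_def by (intro sum.cong refl arg_cong2[where f = "(*)"] prod.cong) auto

lemma V_moment_eq_wick:
  assumes "k \<le> K" "\<And>l. l < k \<Longrightarrow> \<alpha> l \<in> E" "\<And>l. l < k \<Longrightarrow> \<beta> l \<in> E"
  shows "V_moment k \<alpha> \<beta> = wick E (occ k \<alpha>) (occ k \<beta>)"
proof -
  have "V_moment k \<alpha> \<beta> = (\<Sum>x\<in>X. p x * (\<Prod>e\<in>E. V x e ^ occ k \<alpha> e * cnj (V x e) ^ occ k \<beta> e))"
  proof -
    have "(\<Prod>l<k. V x (\<alpha> l)) = (\<Prod>e\<in>E. V x e ^ occ k \<alpha> e)"
      "(\<Prod>l<k. cnj (V x (\<beta> l))) = (\<Prod>e\<in>E. cnj (V x e) ^ occ k \<beta> e)" for x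
      by (rule prod_tuple_eq[OF finite_E assms(2)], simp, rule prod_tuple_eq[OF finite_E assms(3)])
    then show ?thesis unfolding V_moment_def prod.distrib by simp
  qed
  also have "\<dots> = wick E (occ k \<alpha>) (occ k \<beta>)"
    unfolding wick_def using order_trans[OF occ_le assms(1)] by (intro moments)
  finally show ?thesis .
qed

text \<open>The combinatorial form of Gaussian integration by parts.\<close>

lemma V_moment_rec:
  assumes "Suc k \<le> K" "\<And>l. l < k \<Longrightarrow> \<alpha> l \<in> E" "\<And>l. l < k \<Longrightarrow> \<beta> l \<in> E" "a \<in> E" "b \<in> E"
  shows "V_moment (Suc k) (\<alpha>(k := a)) (\<beta>(k := b)) = (if a = b then V_moment k \<alpha> \<beta> else 0) +
    (\<Sum>l<k. if a = \<beta> l then V_moment k \<alpha> (\<beta>(l := b)) else 0)"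
proof -
  let ?n' = "let f = (occ k \<beta>)(a := occ k \<beta> a - 1) in f(b := Suc (f b))"
  have "V_moment (Suc k) (\<alpha>(k := a)) (\<beta>(k := b)) = wick E (occ (Suc k) (\<alpha>(k := a))) (occ (Suc k) (\<beta>(k := b)))"
    using assms by (intro V_moment_eq_wick) (auto simp: less_Suc_eq)
  also have "\<dots> = (if a = b then wick E (occ k \<alpha>) (occ k \<beta>) else 0) + of_nat (occ k \<beta> a) * wick E (occ k \<alpha>) ?n'"
    unfolding occ_Suc_upd by (rule wick_rec[OF finite_E assms(4,5)])
  also have "wick E (occ k \<alpha>) (occ k \<beta>) = V_moment k \<alpha> \<beta>"
    using assms by (intro V_moment_eq_wick[symmetric]) auto
  \<comment> \<open>Exponents forget positions, so all positions with \<open>\<beta> l = a\<close>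
    contribute the same value, and the multiplicity unfolds into a sum over them.\<close>
  also have "of_nat (occ k \<beta> a) * wick E (occ k \<alpha>) ?n' = (\<Sum>l<k. if a = \<beta> l then wick E (occ k \<alpha>) ?n' else 0)"
    unfolding occ_def of_nat_sum sum_distrib_right by (intro sum.cong) auto
  also have "\<dots> = (\<Sum>l<k. if a = \<beta> l then V_moment k \<alpha> (\<beta>(l := b)) else 0)"
  proof (intro sum.cong if_cong refl)
    fix l assume l: "l \<in> {..<k}" "a = \<beta> l"
    have "V_moment k \<alpha> (\<beta>(l := b)) = wick E (occ k \<alpha>) (occ k (\<beta>(l := b)))"
      using assms by (intro V_moment_eq_wick) auto
    then show "wick E (occ k \<alpha>) ?n' = V_moment k \<alpha> (\<beta>(l := b))"
      using occ_upd(1)[of l k \<beta> a b] l by simp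
  qed
  finally show ?thesis .
qed

text \<open>
  Monomials with the same occurrence numbers coincide and the others are orthogonal, so the second
  moment of a homogeneous polynomial is a positive combination of its squared coefficients.
\<close>

lemma vanishing_polynomial:
  assumes "k \<le> K" "finite I" and \<alpha>: "\<And>i l. i \<in> I \<Longrightarrow> l < k \<Longrightarrow> \<alpha> i l \<in> E"
    and zero: "(\<Sum>x\<in>X. p x * (cmod (\<Sum>i\<in>I. u i * (\<Prod>l<k. V x (\<alpha> i l))))\<^sup>2) = 0"
  shows "(\<Sum>i\<in>I. u i * (\<Prod>l<k. Y (\<alpha> i l))) = 0"
proof -
  \<comment> \<open>\<open>c i\<close> is the exponent vector of monomial \<open>i\<close>, and
    \<open>C \<mu>\<close> collects the coefficients of all tuples that give the same
    monomial.\<close>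
  define c where "c = (\<lambda>i. occ k (\<alpha> i))"
  define C where "C = (\<lambda>\<mu>. \<Sum>i\<in>{i \<in> I. c i = \<mu>}. u i)"
  have out: "c i e = 0" if "i \<in> I" "e \<notin> E" for i e
    using \<alpha>[OF that(1)] that(2) by (auto simp: c_def occ_def)
  have M: "V_moment k (\<alpha> i) (\<alpha> j) = (if c i = c j then of_real (\<Prod>e\<in>E. fact (c i e)) else 0)" if "i \<in> I" "j \<in> I" for i j
  proof (cases "c i = c j")
    case True
    then show ?thesis using that assms by (subst V_moment_eq_wick) (auto simp: wick_def c_def)
  next
    case False
    then obtain e where "c i e \<noteq> c j e" by auto
    then have "\<exists>e\<in>E. c i e \<noteq> c j e" using out[OF that(1)] out[OF that(2)] by metis
    then show ?thesis using False that assms finite_E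
      by (subst V_moment_eq_wick) (auto simp: wick_def c_def prod_zero_iff)
  qed
  have sq: "complex_of_real ((cmod z)\<^sup>2) = z * cnj z" for z by (rule complex_norm_square)
  have "0 = complex_of_real (\<Sum>x\<in>X. p x * (cmod (\<Sum>i\<in>I. u i * (\<Prod>l<k. V x (\<alpha> i l))))\<^sup>2)"
    using zero by simp
  also have "\<dots> = (\<Sum>x\<in>X. p x * ((\<Sum>i\<in>I. u i * (\<Prod>l<k. V x (\<alpha> i l))) * cnj (\<Sum>i\<in>I. u i * (\<Prod>l<k. V x (\<alpha> i l)))))"
    by (simp only: of_real_sum of_real_mult sq)
  also have "\<dots> = (\<Sum>x\<in>X. \<Sum>i\<in>I. \<Sum>j\<in>I. u i * cnj (u j) * (p x * (\<Prod>l<k. V x (\<alpha> i l) * cnj (V x (\<alpha> j l)))))"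
  proof (intro sum.cong refl)
    fix x
    have e: "(\<Sum>i\<in>I. u i * (\<Prod>l<k. V x (\<alpha> i l))) * cnj (\<Sum>i\<in>I. u i * (\<Prod>l<k. V x (\<alpha> i l))) =
        (\<Sum>i\<in>I. \<Sum>j\<in>I. u i * cnj (u j) * (\<Prod>l<k. V x (\<alpha> i l) * cnj (V x (\<alpha> j l))))"
      unfolding cnj_sum sum_product by (intro sum.cong refl) (simp add: prod.distrib mult_ac)
    show "p x * ((\<Sum>i\<in>I. u i * (\<Prod>l<k. V x (\<alpha> i l))) * cnj (\<Sum>i\<in>I. u i * (\<Prod>l<k. V x (\<alpha> i l)))) =
        (\<Sum>i\<in>I. \<Sum>j\<in>I. u i * cnj (u j) * (p x * (\<Prod>l<k. V x (\<alpha> i l) * cnj (V x (\<alpha> j l)))))"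
      unfolding e sum_distrib_left by (intro sum.cong refl) (simp only: mult_ac)
  qed
  also have "\<dots> = (\<Sum>i\<in>I. \<Sum>j\<in>I. u i * cnj (u j) * V_moment k (\<alpha> i) (\<alpha> j))"
    unfolding V_moment_def sum_distrib_left
    by (subst sum.swap, intro sum.cong refl, subst sum.swap) simp
  also have "\<dots> = (\<Sum>i\<in>I. \<Sum>j\<in>I. if c j = c i then of_real (\<Prod>e\<in>E. fact (c i e)) * u i * cnj (u j) else 0)"
    by (intro sum.cong refl) (auto simp: M)
  also have "\<dots> = (\<Sum>i\<in>I. of_real (\<Prod>e\<in>E. fact (c i e)) * u i * cnj (C (c i)))"
    unfolding C_def cnj_sum sum_distrib_left by (simp only: sum.inter_filter[OF assms(2)])
  also have "\<dots> = (\<Sum>\<mu>\<in>c ` I. \<Sum>i\<in>{i \<in> I. c i = \<mu>}. of_real (\<Prod>e\<in>E. fact (c i e)) * u i * cnj (C (c i)))"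
    using assms(2) by (rule sum.image_gen)
  also have "\<dots> = (\<Sum>\<mu>\<in>c ` I. of_real (\<Prod>e\<in>E. fact (\<mu> e)) * C \<mu> * cnj (C \<mu>))"
  proof (intro sum.cong refl)
    fix \<mu>
    have "(\<Sum>i\<in>{i \<in> I. c i = \<mu>}. of_real (\<Prod>e\<in>E. fact (c i e)) * u i * cnj (C (c i))) =
        (\<Sum>i\<in>{i \<in> I. c i = \<mu>}. of_real (\<Prod>e\<in>E. fact (\<mu> e)) * cnj (C \<mu>) * u i)"
      by (intro sum.cong refl) auto
    also have "\<dots> = of_real (\<Prod>e\<in>E. fact (\<mu> e)) * cnj (C \<mu>) * C \<mu>"
      by (simp only: C_def sum_distrib_left)
    finally show "(\<Sum>i\<in>{i \<in> I. c i = \<mu>}. of_real (\<Prod>e\<in>E. fact (c i e)) * u i * cnj (C (c i))) =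
        of_real (\<Prod>e\<in>E. fact (\<mu> e)) * C \<mu> * cnj (C \<mu>)" by (simp only: mult_ac)
  qed
  also have "\<dots> = complex_of_real (\<Sum>\<mu>\<in>c ` I. (\<Prod>e\<in>E. fact (\<mu> e)) * (cmod (C \<mu>))\<^sup>2)"
    by (simp only: of_real_sum of_real_mult sq mult.assoc)
  finally have "0 = complex_of_real (\<Sum>\<mu>\<in>c ` I. (\<Prod>e\<in>E. fact (\<mu> e)) * (cmod (C \<mu>))\<^sup>2)" .
  from this[symmetric] have "(\<Sum>\<mu>\<in>c ` I. (\<Prod>e\<in>E. fact (\<mu> e)) * (cmod (C \<mu>))\<^sup>2) = (0 :: real)"
    unfolding of_real_eq_0_iff .
  then have "(\<Prod>e\<in>E. fact (\<mu> e)) * (cmod (C \<mu>))\<^sup>2 = (0 :: real)" if "\<mu> \<in> c ` I" for \<mu>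
    using that assms(2) by (subst (asm) sum_nonneg_eq_0_iff) (auto intro!: mult_nonneg_nonneg prod_nonneg)
  then have C0: "C \<mu> = 0" if "\<mu> \<in> c ` I" for \<mu> using that finite_E by (fastforce simp: prod_zero_iff)
  \<comment> \<open>All collected coefficients vanish, so the polynomial is zero at every point
    \<open>Y\<close>, not only at the sample points.\<close>
  have "(\<Sum>i\<in>I. u i * (\<Prod>l<k. Y (\<alpha> i l))) = (\<Sum>i\<in>I. u i * (\<Prod>e\<in>E. Y e ^ c i e))"
    unfolding c_def using \<alpha> by (intro sum.cong refl) (simp add: prod_tuple_eq[OF finite_E])
  also have "\<dots> = (\<Sum>\<mu>\<in>c ` I. \<Sum>i\<in>{i \<in> I. c i = \<mu>}. u i * (\<Prod>e\<in>E. Y e ^ c i e))"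
    using assms(2) by (rule sum.image_gen)
  also have "\<dots> = (\<Sum>\<mu>\<in>c ` I. C \<mu> * (\<Prod>e\<in>E. Y e ^ \<mu> e))"
    by (intro sum.cong refl) (simp add: C_def sum_distrib_right)
  also have "\<dots> = 0" using C0 by simp
  finally show ?thesis .
qed

end

section \<open>Moments of Wishart matrices\<close>

abbreviation tuples :: "nat \<Rightarrow> nat \<Rightarrow> (nat \<Rightarrow> nat) set" where
  "tuples k d \<equiv> PiE {..<k} (\<lambda>_. {..<d})"

lemma tuples_upd: "J \<in> tuples k d \<Longrightarrow> l < k \<Longrightarrow> b < d \<Longrightarrow> J(l := b) \<in> tuples k d"
  by (auto simp: PiE_iff extensional_def)

lemma finite_tuples [simp]: "finite (tuples k d)"
  by (intro finite_PiE) auto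

lemma tuples_nth: "J \<in> tuples k d \<Longrightarrow> l < k \<Longrightarrow> J l < d"
  by (auto simp: PiE_iff)

locale gaussian_matrix =
  gaussian_family "{..<d} \<times> {..<s}" K X p V for d s :: nat and K and X :: "'x set" and p V
begin

definition G :: "'x \<Rightarrow> nat \<Rightarrow> nat \<Rightarrow> complex" where
  "G x a b = (\<Sum>c<s. V x (a, c) * cnj (V x (b, c)))"

definition G_moment :: "nat \<Rightarrow> (nat \<Rightarrow> nat) \<Rightarrow> (nat \<Rightarrow> nat) \<Rightarrow> complex" where
  "G_moment k i j = (\<Sum>x\<in>X. p x * (\<Prod>l<k. G x (i l) (j l)))"

lemma G_moment_eq: "G_moment k i j = (\<Sum>c\<in>tuples k s. V_moment k (\<lambda>l. (i l, c l)) (\<lambda>l. (j l, c l)))"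
proof -
  have "(\<Prod>l<k. G x (i l) (j l)) = (\<Sum>c\<in>tuples k s. \<Prod>l<k. V x (i l, c l) * cnj (V x (j l, c l)))" for x
    unfolding G_def by (rule prod_sum_PiE) auto
  then show ?thesis unfolding G_moment_def V_moment_def
    by (simp add: sum_distrib_left) (rule sum.swap)
qed

lemma G_moment_Suc: "G_moment (Suc k) i j = (\<Sum>c\<in>tuples k s. \<Sum>e<s.
    V_moment (Suc k) ((\<lambda>l. (i l, c l))(k := (i k, e))) ((\<lambda>l. (j l, c l))(k := (j k, e))))"
proof -
  have "(\<Prod>l<Suc k. G x (i l) (j l)) = (\<Sum>c\<in>tuples k s. \<Sum>e<s.
      \<Prod>l<Suc k. V x (((\<lambda>l. (i l, c l))(k := (i k, e))) l) * cnj (V x (((\<lambda>l. (j l, c l))(k := (j k, e))) l)))" for x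
  proof -
    have "(\<Prod>l<k. G x (i l) (j l)) = (\<Sum>c\<in>tuples k s. \<Prod>l<k. V x (i l, c l) * cnj (V x (j l, c l)))"
      unfolding G_def by (rule prod_sum_PiE) auto
    then have "(\<Prod>l<Suc k. G x (i l) (j l)) =
      (\<Sum>c\<in>tuples k s. \<Sum>e<s. (\<Prod>l<k. V x (i l, c l) * cnj (V x (j l, c l))) * (V x (i k, e) * cnj (V x (j k, e))))"
      by (simp add: G_def[of x "i k"] sum_product)
    then show ?thesis by simp
  qed
  then have "G_moment (Suc k) i j = (\<Sum>x\<in>X. \<Sum>c\<in>tuples k s. \<Sum>e<s. p x *
      (\<Prod>l<Suc k. V x (((\<lambda>l. (i l, c l))(k := (i k, e))) l) * cnj (V x (((\<lambda>l. (j l, c l))(k := (j k, e))) l))))"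
    unfolding G_moment_def by (simp only: sum_distrib_left)
  also have "\<dots> = (\<Sum>c\<in>tuples k s. \<Sum>e<s. \<Sum>x\<in>X. p x *
      (\<Prod>l<Suc k. V x (((\<lambda>l. (i l, c l))(k := (i k, e))) l) * cnj (V x (((\<lambda>l. (j l, c l))(k := (j k, e))) l))))"
    by (subst sum.swap, intro sum.cong refl, rule sum.swap)
  finally show ?thesis unfolding V_moment_def .
qed

text \<open>Entrywise form of the recursion for the moment operators. The new factor
  \<open>V (a, e)\<close> pairs with the conjugate of \<open>V (b, e)\<close>, and summation over
  the column \<open>e\<close> gives \<open>s\<close>; or it pairs with the conjugate of
  \<open>V (j l, c l)\<close>, which forces \<open>a = j l\<close> and \<open>e = c l\<close> and
  leaves \<open>b\<close> at place \<open>l\<close>, the effect of swapping two tensor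
  factors.\<close>

lemma G_moment_rec:
  assumes k: "Suc k \<le> K" and i: "\<And>l. l < k \<Longrightarrow> i l < d" and j: "\<And>l. l < k \<Longrightarrow> j l < d"
    and ab: "a < d" "b < d"
  shows "G_moment (Suc k) (i(k := a)) (j(k := b)) = (if a = b then of_nat s * G_moment k i j else 0) +
    (\<Sum>l<k. if a = j l then G_moment k i (j(l := b)) else 0)"
proof -
  let ?\<alpha> = "\<lambda>c l. (i l, c l)" and ?\<beta> = "\<lambda>c l. (j l, c l)"
  have "G_moment (Suc k) (i(k := a)) (j(k := b)) = (\<Sum>c\<in>tuples k s. \<Sum>e<s.
      V_moment (Suc k) ((?\<alpha> c)(k := (a, e))) ((?\<beta> c)(k := (b, e))))"
    unfolding G_moment_Suc by (intro sum.cong refl V_moment_cong) auto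
  also have "\<dots> = (\<Sum>c\<in>tuples k s. \<Sum>e<s. (if a = b then V_moment k (?\<alpha> c) (?\<beta> c) else 0) +
      (\<Sum>l<k. if a = j l \<and> e = c l then V_moment k (?\<alpha> c) ((?\<beta> c)(l := (b, e))) else 0))"
    using assms by (intro sum.cong refl, subst V_moment_rec) (auto dest: tuples_nth)
  also have "\<dots> = (\<Sum>c\<in>tuples k s. (if a = b then of_nat s * V_moment k (?\<alpha> c) (?\<beta> c) else 0) +
      (\<Sum>l<k. if a = j l then V_moment k (?\<alpha> c) ((?\<beta> c)(l := (b, c l))) else 0))"
  proof (intro sum.cong refl)
    fix c assume c: "c \<in> tuples k s"
    have "(\<Sum>e<s. \<Sum>l<k. if a = j l \<and> e = c l then V_moment k (?\<alpha> c) ((?\<beta> c)(l := (b, e))) else 0) =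
        (\<Sum>l<k. \<Sum>e<s. if e = c l then (if a = j l then V_moment k (?\<alpha> c) ((?\<beta> c)(l := (b, c l))) else 0) else 0)"
      by (subst sum.swap, intro sum.cong refl) auto
    also have "\<dots> = (\<Sum>l<k. if a = j l then V_moment k (?\<alpha> c) ((?\<beta> c)(l := (b, c l))) else 0)"
      using tuples_nth[OF c] by (intro sum.cong refl) simp
    finally show "(\<Sum>e<s. (if a = b then V_moment k (?\<alpha> c) (?\<beta> c) else 0) +
      (\<Sum>l<k. if a = j l \<and> e = c l then V_moment k (?\<alpha> c) ((?\<beta> c)(l := (b, e))) else 0)) =
      (if a = b then of_nat s * V_moment k (?\<alpha> c) (?\<beta> c) else 0) +
      (\<Sum>l<k. if a = j l then V_moment k (?\<alpha> c) ((?\<beta> c)(l := (b, c l))) else 0)"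
      by (simp add: sum.distrib)
  qed
  also have "\<dots> = (if a = b then of_nat s * G_moment k i j else 0) +
      (\<Sum>l<k. if a = j l then G_moment k i (j(l := b)) else 0)"
  proof -
    have "(\<Sum>c\<in>tuples k s. \<Sum>l<k. if a = j l then V_moment k (?\<alpha> c) ((?\<beta> c)(l := (b, c l))) else 0) =
        (\<Sum>l<k. \<Sum>c\<in>tuples k s. if a = j l then V_moment k (?\<alpha> c) (\<lambda>m. ((j(l := b)) m, c m)) else 0)"
      by (subst sum.swap, intro sum.cong refl if_cong V_moment_cong) auto
    also have "\<dots> = (\<Sum>l<k. if a = j l then G_moment k i (j(l := b)) else 0)"
      by (intro sum.cong refl) (simp add: G_moment_eq)
    finally show ?thesis by (simp add: sum.distrib G_moment_eq[of k i j] sum_distrib_left)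
  qed
  finally show ?thesis .
qed

end

section \<open>Collective observables on product states\<close>

lemma prod_if_single:
  assumes "l < (k :: nat)"
  shows "(\<Prod>l'<k. if l' = l then x else h l') = (x :: 'a :: comm_monoid_mult) * (\<Prod>l'\<in>{..<k} - {l}. h l')"
  using assms by (subst prod.remove[of _ l]) (auto intro!: arg_cong2[where f = "(*)"] prod.cong)

lemma sum_prod_if_single:
  assumes "l < (k :: nat)"
  shows "(\<Sum>b\<in>B. f b * (\<Prod>l'<k. if l' = l then g b else h l')) =
    (\<Prod>l'<k. if l' = l then (\<Sum>b\<in>B. f b * g b) else (h l' :: 'a :: comm_semiring_1))"
  unfolding prod_if_single[OF assms] by (simp add: sum_distrib_right mult.assoc)

text \<open>Right multiplication of the row vector \<open>F\<close> on the tensor power by the sum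
  of all copies of \<open>Ob\<close>, each acting on one tensor factor.\<close>

definition collective :: "nat \<Rightarrow> nat \<Rightarrow> (nat \<Rightarrow> nat \<Rightarrow> complex) \<Rightarrow> ((nat \<Rightarrow> nat) \<Rightarrow> complex) \<Rightarrow> (nat \<Rightarrow> nat) \<Rightarrow> complex" where
  "collective k d Ob F J = (\<Sum>l<k. \<Sum>b<d. Ob b (J l) * F (J(l := b)))"

lemma collective_add: "collective k d Ob (\<lambda>J. F J + H J) J = collective k d Ob F J + collective k d Ob H J"
  by (simp add: collective_def sum.distrib distrib_left)

lemma collective_scale: "collective k d Ob (\<lambda>J. c * F J) J = c * collective k d Ob F J"
  by (simp add: collective_def sum_distrib_left mult_ac)

definition kernel_trace :: "nat \<Rightarrow> (nat \<Rightarrow> nat \<Rightarrow> complex) \<Rightarrow> complex" where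
  "kernel_trace d A = (\<Sum>a<d. A a a)"

definition kernel_mult :: "nat \<Rightarrow> (nat \<Rightarrow> nat \<Rightarrow> complex) \<Rightarrow> (nat \<Rightarrow> nat \<Rightarrow> complex) \<Rightarrow> nat \<Rightarrow> nat \<Rightarrow> complex" where
  "kernel_mult d A B a b = (\<Sum>c<d. A a c * B c b)"

context
  fixes d k :: nat and \<rho> Ob :: "nat \<Rightarrow> nat \<Rightarrow> complex"
  assumes tr: "kernel_trace d \<rho> = 1"
begin

lemma kernel_trace_mult_swap: "(\<Sum>a<d. \<Sum>b<d. A b a * \<rho> a b) = kernel_trace d (kernel_mult d A \<rho>)"
  unfolding kernel_trace_def kernel_mult_def by (rule sum.swap)

lemma sum_tuples_prod: "(\<Sum>J\<in>tuples k d. \<Prod>l<k. f l (J l)) = (\<Prod>l<k. \<Sum>a<d. (f l a :: complex))"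
  by (rule prod_sum_PiE[symmetric]) auto

lemma collective_trace0: "(\<Sum>J\<in>tuples k d. \<Prod>l<k. \<rho> (J l) (J l)) = 1"
  unfolding sum_tuples_prod[of "\<lambda>_ a. \<rho> a a"] using tr by (simp add: kernel_trace_def)

text \<open>In the term for place \<open>l\<close> all other factors contribute the trace of
  \<open>\<rho>\<close>, which is 1.\<close>

lemma collective_trace1:
  "(\<Sum>J\<in>tuples k d. collective k d Ob (\<lambda>J'. \<Prod>l<k. \<rho> (J l) (J' l)) J) = of_nat k * kernel_trace d (kernel_mult d Ob \<rho>)"
proof -
  have "(\<Sum>J\<in>tuples k d. \<Sum>b<d. Ob b (J l) * (\<Prod>m<k. \<rho> (J m) ((J(l := b)) m))) = kernel_trace d (kernel_mult d Ob \<rho>)"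
    if l: "l < k" for l
  proof -
    have "(\<Sum>b<d. Ob b (J l) * (\<Prod>m<k. \<rho> (J m) ((J(l := b)) m))) =
        (\<Prod>m<k. if m = l then (\<Sum>b<d. Ob b (J m) * \<rho> (J m) b) else \<rho> (J m) (J m))" for J
    proof -
      have "(\<Sum>b<d. Ob b (J l) * (\<Prod>m<k. \<rho> (J m) ((J(l := b)) m))) =
          (\<Sum>b<d. Ob b (J l) * (\<Prod>m<k. if m = l then \<rho> (J l) b else \<rho> (J m) (J m)))"
        by (intro sum.cong refl arg_cong2[where f = "(*)"] prod.cong) auto
      also have "\<dots> = (\<Prod>m<k. if m = l then (\<Sum>b<d. Ob b (J l) * \<rho> (J l) b) else \<rho> (J m) (J m))"
        by (rule sum_prod_if_single[OF l])
      finally show ?thesis by (simp cong: if_cong)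
    qed
    then have "(\<Sum>J\<in>tuples k d. \<Sum>b<d. Ob b (J l) * (\<Prod>m<k. \<rho> (J m) ((J(l := b)) m))) =
        (\<Prod>m<k. \<Sum>a<d. if m = l then (\<Sum>b<d. Ob b a * \<rho> a b) else \<rho> a a)"
      using sum_tuples_prod[of "\<lambda>m a. if m = l then (\<Sum>b<d. Ob b a * \<rho> a b) else \<rho> a a"] by simp
    also have "\<dots> = (\<Prod>m<k. if m = l then kernel_trace d (kernel_mult d Ob \<rho>) else 1)"
      using tr by (intro prod.cong refl) (auto simp: kernel_trace_mult_swap kernel_trace_def[of _ \<rho>])
    finally show ?thesis using l by simp
  qed
  then show ?thesis unfolding collective_def by (subst sum.swap) simp
qed

text \<open>The square of the collective observable has \<open>k (k - 1)\<close> terms on two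
  different factors, each with expectation \<open>Tr (O \<rho>)^2\<close>, and \<open>k\<close>
  terms on a single factor, each with expectation \<open>Tr (O^2 \<rho>)\<close>.\<close>

lemma collective_trace2:
  "(\<Sum>J\<in>tuples k d. collective k d Ob (collective k d Ob (\<lambda>J'. \<Prod>l<k. \<rho> (J l) (J' l))) J) =
    of_nat k * (of_nat k - 1) * (kernel_trace d (kernel_mult d Ob \<rho>))\<^sup>2 + of_nat k * kernel_trace d (kernel_mult d (kernel_mult d Ob Ob) \<rho>)"
proof -
  let ?t = "kernel_trace d (kernel_mult d Ob \<rho>)" and ?u = "kernel_trace d (kernel_mult d (kernel_mult d Ob Ob) \<rho>)"
  \<comment> \<open>The term in which the outer sum acts at place \<open>l\<close> and the inner one
    at place \<open>m\<close>.\<close>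
  define Q where "Q = (\<lambda>l m J. \<Sum>b<d. Ob b (J l) * (\<Sum>c<d. Ob c ((J(l := b)) m) *
    (\<Prod>n<k. \<rho> (J n) ((J(l := b, m := c)) n))))"
  have diag: "(\<Sum>J\<in>tuples k d. Q l l J) = ?u" if l: "l < k" for l
  proof -
    have "Q l l J = (\<Prod>n<k. if n = l then (\<Sum>c<d. kernel_mult d Ob Ob c (J n) * \<rho> (J n) c) else \<rho> (J n) (J n))" for J
    proof -
      have "Q l l J = (\<Sum>b<d. \<Sum>c<d. Ob c b * Ob b (J l) * (\<Prod>n<k. if n = l then \<rho> (J l) c else \<rho> (J n) (J n)))"
        unfolding Q_def sum_distrib_left
        by (intro sum.cong refl) (auto simp: mult_ac intro!: arg_cong2[where f = "(*)"] prod.cong)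
      also have "\<dots> = (\<Sum>c<d. kernel_mult d Ob Ob c (J l) * (\<Prod>n<k. if n = l then \<rho> (J l) c else \<rho> (J n) (J n)))"
        unfolding kernel_mult_def sum_distrib_right by (rule sum.swap)
      also have "\<dots> = (\<Prod>n<k. if n = l then (\<Sum>c<d. kernel_mult d Ob Ob c (J l) * \<rho> (J l) c) else \<rho> (J n) (J n))"
        by (rule sum_prod_if_single[OF l])
      finally show ?thesis by (simp cong: if_cong)
    qed
    then have "(\<Sum>J\<in>tuples k d. Q l l J) =
        (\<Prod>n<k. \<Sum>a<d. if n = l then (\<Sum>c<d. kernel_mult d Ob Ob c a * \<rho> a c) else \<rho> a a)"
      using sum_tuples_prod[of "\<lambda>n a. if n = l then (\<Sum>c<d. kernel_mult d Ob Ob c a * \<rho> a c) else \<rho> a a"] by simp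
    also have "\<dots> = (\<Prod>n<k. if n = l then ?u else 1)"
      using tr by (intro prod.cong refl) (auto simp: kernel_trace_mult_swap kernel_trace_def[of _ \<rho>])
    finally show ?thesis using l by simp
  qed
  have off: "(\<Sum>J\<in>tuples k d. Q l m J) = ?t\<^sup>2" if l: "l < k" and m: "m < k" and lm: "m \<noteq> l" for l m
  proof -
    have "Q l m J = (\<Prod>n<k. if n = l then (\<Sum>b<d. Ob b (J n) * \<rho> (J n) b) else
        if n = m then (\<Sum>c<d. Ob c (J n) * \<rho> (J n) c) else \<rho> (J n) (J n))" for J
    proof -
      let ?C = "\<Sum>c<d. Ob c (J m) * \<rho> (J m) c"
      have "(\<Sum>c<d. Ob c ((J(l := b)) m) * (\<Prod>n<k. \<rho> (J n) ((J(l := b, m := c)) n))) =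
          (\<Prod>n<k. if n = l then \<rho> (J l) b else if n = m then ?C else \<rho> (J n) (J n))" for b
      proof -
        have "(\<Sum>c<d. Ob c ((J(l := b)) m) * (\<Prod>n<k. \<rho> (J n) ((J(l := b, m := c)) n))) =
          (\<Sum>c<d. Ob c (J m) * (\<Prod>n<k. if n = m then \<rho> (J m) c else if n = l then \<rho> (J l) b else \<rho> (J n) (J n)))"
          using lm by (intro sum.cong refl arg_cong2[where f = "(*)"] prod.cong) auto
        also have "\<dots> = (\<Prod>n<k. if n = m then ?C else if n = l then \<rho> (J l) b else \<rho> (J n) (J n))"
          by (rule sum_prod_if_single[OF m])
        also have "\<dots> = (\<Prod>n<k. if n = l then \<rho> (J l) b else if n = m then ?C else \<rho> (J n) (J n))"
          using lm by (intro prod.cong) auto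
        finally show ?thesis .
      qed
      then have "Q l m J = (\<Sum>b<d. Ob b (J l) * (\<Prod>n<k. if n = l then \<rho> (J l) b else if n = m then ?C else \<rho> (J n) (J n)))"
        by (simp add: Q_def)
      also have "\<dots> = (\<Prod>n<k. if n = l then (\<Sum>b<d. Ob b (J l) * \<rho> (J l) b) else if n = m then ?C else \<rho> (J n) (J n))"
        by (rule sum_prod_if_single[OF l])
      finally show ?thesis by (simp cong: if_cong)
    qed
    then have "(\<Sum>J\<in>tuples k d. Q l m J) = (\<Prod>n<k. \<Sum>a<d. if n = l then (\<Sum>b<d. Ob b a * \<rho> a b) else
        if n = m then (\<Sum>c<d. Ob c a * \<rho> a c) else \<rho> a a)"
      using sum_tuples_prod[of "\<lambda>n a. if n = l then (\<Sum>b<d. Ob b a * \<rho> a b) else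
        if n = m then (\<Sum>c<d. Ob c a * \<rho> a c) else \<rho> a a"] by simp
    also have "\<dots> = (\<Prod>n<k. if n = l then ?t else if n = m then ?t else 1)"
      using tr by (intro prod.cong refl) (auto simp: kernel_trace_mult_swap kernel_trace_def[of _ \<rho>])
    also have "\<dots> = ?t * (\<Prod>n\<in>{..<k} - {l}. if n = m then ?t else 1)"
      by (rule prod_if_single[OF l])
    also have "\<dots> = ?t * ?t" using m lm by simp
    finally show ?thesis by (simp add: power2_eq_square)
  qed
  have "(\<Sum>J\<in>tuples k d. collective k d Ob (collective k d Ob (\<lambda>J'. \<Prod>l<k. \<rho> (J l) (J' l))) J) =
      (\<Sum>J\<in>tuples k d. \<Sum>l<k. \<Sum>m<k. Q l m J)"
  proof (intro sum.cong refl)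
    fix J
    show "collective k d Ob (collective k d Ob (\<lambda>J'. \<Prod>l<k. \<rho> (J l) (J' l))) J = (\<Sum>l<k. \<Sum>m<k. Q l m J)"
      unfolding collective_def Q_def by (subst (3) sum.swap) (simp add: sum_distrib_left)
  qed
  also have "\<dots> = (\<Sum>l<k. \<Sum>m<k. \<Sum>J\<in>tuples k d. Q l m J)"
    by (subst sum.swap, intro sum.cong refl, rule sum.swap)
  also have "\<dots> = (\<Sum>l<k. \<Sum>m<k. if m = l then ?u else ?t\<^sup>2)"
    by (intro sum.cong refl) (auto simp: diag off)
  also have "\<dots> = (\<Sum>l<k. ?u + (of_nat k - 1) * ?t\<^sup>2)"
  proof (intro sum.cong refl)
    fix l assume l: "l \<in> {..<k}"
    have "(\<Sum>m<k. if m = l then ?u else ?t\<^sup>2) = ?u + (\<Sum>m\<in>{..<k} - {l}. ?t\<^sup>2)"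
      using l by (subst sum.remove[of _ l]) auto
    then show "(\<Sum>m<k. if m = l then ?u else ?t\<^sup>2) = ?u + (of_nat k - 1) * ?t\<^sup>2"
      using l by (simp add: of_nat_diff)
  qed
  finally show ?thesis by (simp add: algebra_simps)
qed

end

section \<open>Mean and second moment of the outcome of one batch\<close>

context gaussian_matrix
begin

definition obs :: "(nat \<Rightarrow> nat \<Rightarrow> complex) \<Rightarrow> 'x \<Rightarrow> complex" where
  "obs Ob x = (\<Sum>a<d. \<Sum>b<d. Ob b a * G x a b)"

text \<open>The number \<open>p x Tr (R G^\<otimes>k)\<close>. For
  \<open>R = S \<rho>^\<otimes>k S\<close>, with \<open>S\<close> the inverse square root of the
  moment matrix on its range, it is the Born probability of the outcome \<open>x\<close>.\<close>

definition weight :: "nat \<Rightarrow> ((nat \<Rightarrow> nat) \<Rightarrow> (nat \<Rightarrow> nat) \<Rightarrow> complex) \<Rightarrow> 'x \<Rightarrow> complex" where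
  "weight k R x = p x * (\<Sum>J\<in>tuples k d. \<Sum>I\<in>tuples k d. R J I * (\<Prod>l<k. G x (I l) (J l)))"

context
  fixes k :: nat and R :: "(nat \<Rightarrow> nat) \<Rightarrow> (nat \<Rightarrow> nat) \<Rightarrow> complex" and \<rho> :: "nat \<Rightarrow> nat \<Rightarrow> complex"
  assumes k: "Suc (Suc k) \<le> K" and tr: "kernel_trace d \<rho> = 1"
    and R: "\<And>J J'. J \<in> tuples k d \<Longrightarrow> J' \<in> tuples k d \<Longrightarrow>
      (\<Sum>I\<in>tuples k d. R J I * G_moment k I J') = (\<Prod>l<k. \<rho> (J l) (J' l))"
begin

abbreviation "rho_power J J' \<equiv> \<Prod>l<k. \<rho> (J l) (J' l)"

text \<open>An entry of \<open>(R \<otimes> 1) A_(k+1)\<close> with the last tensor factor singled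
  out as \<open>(a, b)\<close>. The assumption that \<open>R A_k\<close> equals
  \<open>\<rho>^\<otimes>k\<close> is all that the moment computation knows about the
  measurement.\<close>

definition contraction1 :: "(nat \<Rightarrow> nat) \<Rightarrow> (nat \<Rightarrow> nat) \<Rightarrow> nat \<Rightarrow> nat \<Rightarrow> complex" where
  "contraction1 J J' a b = (\<Sum>I\<in>tuples k d. R J I * G_moment (Suc k) (I(k := a)) (J'(k := b)))"

definition contraction2 :: "(nat \<Rightarrow> nat) \<Rightarrow> (nat \<Rightarrow> nat) \<Rightarrow> nat \<Rightarrow> nat \<Rightarrow> nat \<Rightarrow> nat \<Rightarrow> complex" where
  "contraction2 J J' a b a' b' = (\<Sum>I\<in>tuples k d. R J I * G_moment (Suc (Suc k)) (I(k := a, Suc k := a')) (J'(k := b, Suc k := b')))"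

text \<open>The recursion ends in entries of \<open>A_k\<close>, possibly with one column index
  replaced, and \<open>R\<close> times \<open>A_k\<close> is
  \<open>\<rho>^\<otimes>k\<close>.\<close>

lemma contraction1_eq:
  assumes "J \<in> tuples k d" "J' \<in> tuples k d" "a < d" "b < d"
  shows "contraction1 J J' a b = (if a = b then of_nat s * rho_power J J' else 0) +
    (\<Sum>l<k. if a = J' l then rho_power J (J'(l := b)) else 0)"
proof -
  have "contraction1 J J' a b = (\<Sum>I\<in>tuples k d. (if a = b then of_nat s * (R J I * G_moment k I J') else 0) +
      (\<Sum>l<k. if a = J' l then R J I * G_moment k I (J'(l := b)) else 0))"
    unfolding contraction1_def
  proof (intro sum.cong refl)
    fix I assume I: "I \<in> tuples k d"
    have "G_moment (Suc k) (I(k := a)) (J'(k := b)) = (if a = b then of_nat s * G_moment k I J' else 0) +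
        (\<Sum>l<k. if a = J' l then G_moment k I (J'(l := b)) else 0)"
      using k assms I by (intro G_moment_rec) (auto dest: tuples_nth)
    then show "R J I * G_moment (Suc k) (I(k := a)) (J'(k := b)) = (if a = b then of_nat s * (R J I * G_moment k I J') else 0) +
        (\<Sum>l<k. if a = J' l then R J I * G_moment k I (J'(l := b)) else 0)"
      by (auto simp: distrib_left sum_distrib_left if_distrib[of "\<lambda>x. _ * x"] cong: if_cong)
  qed
  also have "\<dots> = (if a = b then of_nat s * (\<Sum>I\<in>tuples k d. R J I * G_moment k I J') else 0) +
      (\<Sum>l<k. if a = J' l then (\<Sum>I\<in>tuples k d. R J I * G_moment k I (J'(l := b))) else 0)"
  proof -
    have "(\<Sum>I\<in>tuples k d. \<Sum>l<k. if a = J' l then R J I * G_moment k I (J'(l := b)) else 0) =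
        (\<Sum>l<k. if a = J' l then (\<Sum>I\<in>tuples k d. R J I * G_moment k I (J'(l := b))) else 0)"
      by (subst sum.swap, intro sum.cong refl) auto
    then show ?thesis by (simp add: sum.distrib sum_distrib_left)
  qed
  also have "\<dots> = (if a = b then of_nat s * rho_power J J' else 0) +
      (\<Sum>l<k. if a = J' l then rho_power J (J'(l := b)) else 0)"
  proof -
    have "(\<Sum>I\<in>tuples k d. R J I * G_moment k I (J'(l := b))) = rho_power J (J'(l := b))" if "l < k" for l
      by (rule R[OF assms(1) tuples_upd[OF assms(2) that assms(4)]])
    then show ?thesis unfolding R[OF assms(1,2)]
      by (intro arg_cong2[where f = "(+)"] refl sum.cong if_cong) simp
  qed
  finally show ?thesis .
qed

text \<open>The recursion for order \<open>k + 2\<close> swaps the newest factor with one of the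
  \<open>k\<close> state factors or with the other added factor; the last summand is that additional
  swap.\<close>

lemma contraction2_eq:
  assumes "J \<in> tuples k d" "J' \<in> tuples k d" "a < d" "b < d" "a' < d" "b' < d"
  shows "contraction2 J J' a b a' b' = (if a' = b' then of_nat s * contraction1 J J' a b else 0) +
    (\<Sum>l<k. if a' = J' l then contraction1 J (J'(l := b')) a b else 0) + (if a' = b then contraction1 J J' a b' else 0)"
proof -
  have "contraction2 J J' a b a' b' = (\<Sum>I\<in>tuples k d. (if a' = b' then of_nat s * (R J I * G_moment (Suc k) (I(k := a)) (J'(k := b))) else 0) +
      (\<Sum>l<k. if a' = J' l then R J I * G_moment (Suc k) (I(k := a)) (J'(l := b', k := b)) else 0) +
      (if a' = b then R J I * G_moment (Suc k) (I(k := a)) (J'(k := b')) else 0))"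
    unfolding contraction2_def
  proof (intro sum.cong refl)
    fix I assume I: "I \<in> tuples k d"
    let ?i = "I(k := a)" and ?j = "J'(k := b)"
    have "G_moment (Suc (Suc k)) (?i(Suc k := a')) (?j(Suc k := b')) = (if a' = b' then of_nat s * G_moment (Suc k) ?i ?j else 0) +
        (\<Sum>l<Suc k. if a' = ?j l then G_moment (Suc k) ?i (?j(l := b')) else 0)"
      using k assms I by (intro G_moment_rec) (auto dest: tuples_nth simp: less_Suc_eq)
    also have "(\<Sum>l<Suc k. if a' = ?j l then G_moment (Suc k) ?i (?j(l := b')) else 0) =
        (\<Sum>l<k. if a' = J' l then G_moment (Suc k) ?i (J'(l := b', k := b)) else 0) +
        (if a' = b then G_moment (Suc k) ?i (J'(k := b')) else 0)"
    proof -
      have "(\<Sum>l<k. if a' = ?j l then G_moment (Suc k) ?i (?j(l := b')) else 0) =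
        (\<Sum>l<k. if a' = J' l then G_moment (Suc k) ?i (J'(l := b', k := b)) else 0)"
        by (intro sum.cong refl) (auto simp: fun_upd_twist)
      then show ?thesis by simp
    qed
    finally have e: "G_moment (Suc (Suc k)) (?i(Suc k := a')) (?j(Suc k := b')) = (if a' = b' then of_nat s * G_moment (Suc k) ?i ?j else 0) +
        ((\<Sum>l<k. if a' = J' l then G_moment (Suc k) ?i (J'(l := b', k := b)) else 0) +
        (if a' = b then G_moment (Suc k) ?i (J'(k := b')) else 0))" .
    have dist: "r * ((if P then c * u else 0) + ((\<Sum>l<k. if a' = J' l then f l else 0) + (if T then v else 0))) =
        (if P then c * (r * u) else 0) + (\<Sum>l<k. if a' = J' l then r * f l else 0) + (if T then r * v else 0)"
      for r c u v :: complex and P T f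
      by (auto simp: distrib_left sum_distrib_left if_distrib[of "\<lambda>x. _ * x"] cong: if_cong)
    show "R J I * G_moment (Suc (Suc k)) (?i(Suc k := a')) (?j(Suc k := b')) =
      (if a' = b' then of_nat s * (R J I * G_moment (Suc k) ?i ?j) else 0) +
      (\<Sum>l<k. if a' = J' l then R J I * G_moment (Suc k) ?i (J'(l := b', k := b)) else 0) +
      (if a' = b then R J I * G_moment (Suc k) ?i (J'(k := b')) else 0)"
      unfolding e by (rule dist)
  qed
  also have "\<dots> = (if a' = b' then of_nat s * contraction1 J J' a b else 0) +
    (\<Sum>l<k. if a' = J' l then contraction1 J (J'(l := b')) a b else 0) + (if a' = b then contraction1 J J' a b' else 0)"
  proof -
    have "(\<Sum>I\<in>tuples k d. \<Sum>l<k. if a' = J' l then R J I * G_moment (Suc k) (I(k := a)) (J'(l := b', k := b)) else 0) =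
        (\<Sum>l<k. if a' = J' l then contraction1 J (J'(l := b')) a b else 0)"
      unfolding contraction1_def by (subst sum.swap, intro sum.cong refl) auto
    then show ?thesis by (simp add: sum.distrib sum_distrib_left contraction1_def)
  qed
  finally show ?thesis .
qed

text \<open>The scalar term traces out the observable; the swaps insert it at each of the
  \<open>k\<close> places, which is the collective observable.\<close>

lemma contraction1_contract:
  assumes "J \<in> tuples k d" "J' \<in> tuples k d"
  shows "(\<Sum>a<d. \<Sum>b<d. Ob b a * contraction1 J J' a b) = of_nat s * kernel_trace d Ob * rho_power J J' + collective k d Ob (rho_power J) J'"
proof -
  have "(\<Sum>a<d. \<Sum>b<d. Ob b a * contraction1 J J' a b) =
      (\<Sum>a<d. \<Sum>b<d. (if a = b then Ob b a * of_nat s * rho_power J J' else 0) +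
        (\<Sum>l<k. if a = J' l then Ob b (J' l) * rho_power J (J'(l := b)) else 0))"
    using assms by (intro sum.cong refl)
      (auto simp: contraction1_eq distrib_left sum_distrib_left if_distrib[of "\<lambda>x. _ * x"] mult_ac cong: if_cong)
  also have "\<dots> = (\<Sum>a<d. \<Sum>b<d. if a = b then Ob b a * of_nat s * rho_power J J' else 0) +
      (\<Sum>l<k. \<Sum>b<d. \<Sum>a<d. if a = J' l then Ob b (J' l) * rho_power J (J'(l := b)) else 0)"
  proof -
    have "(\<Sum>a<d. \<Sum>b<d. \<Sum>l<k. if a = J' l then Ob b (J' l) * rho_power J (J'(l := b)) else 0) =
        (\<Sum>l<k. \<Sum>b<d. \<Sum>a<d. if a = J' l then Ob b (J' l) * rho_power J (J'(l := b)) else 0)"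
      by (subst sum.swap, subst sum.swap[of _ "{..<k}" "{..<d}"], rule sum.cong[OF refl], rule sum.swap)
    then show ?thesis by (simp add: sum.distrib)
  qed
  also have "(\<Sum>a<d. \<Sum>b<d. if a = b then Ob b a * of_nat s * rho_power J J' else 0) = of_nat s * kernel_trace d Ob * rho_power J J'"
    by (simp add: kernel_trace_def sum_distrib_left sum_distrib_right mult_ac)
  also have "(\<Sum>l<k. \<Sum>b<d. \<Sum>a<d. if a = J' l then Ob b (J' l) * rho_power J (J'(l := b)) else 0) = collective k d Ob (rho_power J) J'"
    unfolding collective_def using tuples_nth[OF assms(2)] by (intro sum.cong refl) simp
  finally show ?thesis .
qed

text \<open>Compared with applying the first-order formula twice, the only new contribution comes
  from the swap of the two added factors. It multiplies the observables into \<open>O^2\<close> and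
  is the source of the term \<open>s Tr (O^2)\<close> in the variance.\<close>

lemma contraction2_contract:
  assumes J: "J \<in> tuples k d"
  shows "(\<Sum>a<d. \<Sum>b<d. \<Sum>a'<d. \<Sum>b'<d. Ob b a * Ob b' a' * contraction2 J J a b a' b') =
    (of_nat s * kernel_trace d Ob)\<^sup>2 * rho_power J J + 2 * of_nat s * kernel_trace d Ob * collective k d Ob (rho_power J) J +
    collective k d Ob (collective k d Ob (rho_power J)) J +
    of_nat s * kernel_trace d (kernel_mult d Ob Ob) * rho_power J J + collective k d (kernel_mult d Ob Ob) (rho_power J) J"
proof -
  let ?c = "\<lambda>Ob J'. \<Sum>a<d. \<Sum>b<d. Ob b a * contraction1 J J' a b"
  have c: "(\<Sum>a'<d. \<Sum>b'<d. Ob b' a' * contraction2 J J a b a' b') = of_nat s * kernel_trace d Ob * contraction1 J J a b +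
      (\<Sum>l<k. \<Sum>b'<d. Ob b' (J l) * contraction1 J (J(l := b')) a b) + (\<Sum>b'<d. Ob b' b * contraction1 J J a b')"
    if ab: "a < d" "b < d" for a b
  proof -
    have "(\<Sum>a'<d. \<Sum>b'<d. Ob b' a' * contraction2 J J a b a' b') =
      (\<Sum>a'<d. \<Sum>b'<d. (if a' = b' then Ob b' a' * of_nat s * contraction1 J J a b else 0) +
        (\<Sum>l<k. if a' = J l then Ob b' (J l) * contraction1 J (J(l := b')) a b else 0) +
        (if a' = b then Ob b' b * contraction1 J J a b' else 0))"
      using J ab by (intro sum.cong refl)
        (auto simp: contraction2_eq distrib_left sum_distrib_left if_distrib[of "\<lambda>x. _ * x"] mult_ac cong: if_cong)
    also have "\<dots> = (\<Sum>a'<d. \<Sum>b'<d. if a' = b' then Ob b' a' * of_nat s * contraction1 J J a b else 0) +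
        (\<Sum>l<k. \<Sum>b'<d. \<Sum>a'<d. if a' = J l then Ob b' (J l) * contraction1 J (J(l := b')) a b else 0) +
        (\<Sum>b'<d. \<Sum>a'<d. if a' = b then Ob b' b * contraction1 J J a b' else 0)"
    proof -
      have "(\<Sum>a'<d. \<Sum>b'<d. \<Sum>l<k. if a' = J l then Ob b' (J l) * contraction1 J (J(l := b')) a b else 0) =
        (\<Sum>l<k. \<Sum>b'<d. \<Sum>a'<d. if a' = J l then Ob b' (J l) * contraction1 J (J(l := b')) a b else 0)"
        by (subst sum.swap, subst sum.swap[of _ "{..<k}" "{..<d}"], rule sum.cong[OF refl], rule sum.swap)
      moreover have "(\<Sum>a'<d. \<Sum>b'<d. if a' = b then Ob b' b * contraction1 J J a b' else 0) =
        (\<Sum>b'<d. \<Sum>a'<d. if a' = b then Ob b' b * contraction1 J J a b' else 0)" by (rule sum.swap)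
      ultimately show ?thesis by (simp only: sum.distrib)
    qed
    also have "(\<Sum>a'<d. \<Sum>b'<d. if a' = b' then Ob b' a' * of_nat s * contraction1 J J a b else 0) = of_nat s * kernel_trace d Ob * contraction1 J J a b"
      by (simp add: kernel_trace_def sum_distrib_left sum_distrib_right mult_ac)
    also have "(\<Sum>l<k. \<Sum>b'<d. \<Sum>a'<d. if a' = J l then Ob b' (J l) * contraction1 J (J(l := b')) a b else 0) =
        (\<Sum>l<k. \<Sum>b'<d. Ob b' (J l) * contraction1 J (J(l := b')) a b)"
      using tuples_nth[OF J] by (intro sum.cong refl) simp
    also have "(\<Sum>b'<d. \<Sum>a'<d. if a' = b then Ob b' b * contraction1 J J a b' else 0) = (\<Sum>b'<d. Ob b' b * contraction1 J J a b')"
      using ab by simp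
    finally show ?thesis .
  qed
  have "(\<Sum>a<d. \<Sum>b<d. \<Sum>a'<d. \<Sum>b'<d. Ob b a * Ob b' a' * contraction2 J J a b a' b') =
      (\<Sum>a<d. \<Sum>b<d. Ob b a * (of_nat s * kernel_trace d Ob * contraction1 J J a b +
      (\<Sum>l<k. \<Sum>b'<d. Ob b' (J l) * contraction1 J (J(l := b')) a b) + (\<Sum>b'<d. Ob b' b * contraction1 J J a b')))"
  proof (intro sum.cong refl)
    fix a b assume "a \<in> {..<d}" "b \<in> {..<d}"
    then have ab: "a < d" "b < d" by simp_all
    show "(\<Sum>a'<d. \<Sum>b'<d. Ob b a * Ob b' a' * contraction2 J J a b a' b') =
      Ob b a * (of_nat s * kernel_trace d Ob * contraction1 J J a b +
      (\<Sum>l<k. \<Sum>b'<d. Ob b' (J l) * contraction1 J (J(l := b')) a b) + (\<Sum>b'<d. Ob b' b * contraction1 J J a b'))"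
      unfolding c[OF ab, symmetric] by (simp only: sum_distrib_left mult.assoc)
  qed
  \<comment> \<open>Summing over \<open>a\<close> and \<open>b\<close> leaves first-order
    contractions only: with a scalar factor, with one entry of \<open>J\<close> replaced, and with
    the observable \<open>O^2\<close>.\<close>
  also have "\<dots> = of_nat s * kernel_trace d Ob * ?c Ob J + (\<Sum>l<k. \<Sum>b'<d. Ob b' (J l) * ?c Ob (J(l := b'))) +
      ?c (kernel_mult d Ob Ob) J"
  proof -
    have 1: "(\<Sum>a<d. \<Sum>b<d. Ob b a * (of_nat s * kernel_trace d Ob * contraction1 J J a b)) = of_nat s * kernel_trace d Ob * ?c Ob J"
      by (simp add: sum_distrib_left mult_ac)
    have 2: "(\<Sum>a<d. \<Sum>b<d. Ob b a * (\<Sum>l<k. \<Sum>b'<d. Ob b' (J l) * contraction1 J (J(l := b')) a b)) =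
        (\<Sum>l<k. \<Sum>b'<d. Ob b' (J l) * ?c Ob (J(l := b')))"
    proof -
      have "(\<Sum>a<d. \<Sum>b<d. Ob b a * (\<Sum>l<k. \<Sum>b'<d. Ob b' (J l) * contraction1 J (J(l := b')) a b)) =
        (\<Sum>(a, b)\<in>{..<d} \<times> {..<d}. \<Sum>(l, b')\<in>{..<k} \<times> {..<d}. Ob b' (J l) * (Ob b a * contraction1 J (J(l := b')) a b))"
        by (simp add: sum.cartesian_product[symmetric] sum_distrib_left mult_ac)
      also have "\<dots> = (\<Sum>(l, b')\<in>{..<k} \<times> {..<d}. \<Sum>(a, b)\<in>{..<d} \<times> {..<d}. Ob b' (J l) * (Ob b a * contraction1 J (J(l := b')) a b))"
        unfolding case_prod_unfold by (rule sum.swap)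
      also have "\<dots> = (\<Sum>l<k. \<Sum>b'<d. Ob b' (J l) * ?c Ob (J(l := b')))"
        by (simp add: sum.cartesian_product[symmetric] sum_distrib_left)
      finally show ?thesis .
    qed
    have 3: "(\<Sum>a<d. \<Sum>b<d. Ob b a * (\<Sum>b'<d. Ob b' b * contraction1 J J a b')) = ?c (kernel_mult d Ob Ob) J"
    proof (rule sum.cong[OF refl])
      fix a
      have "(\<Sum>b<d. Ob b a * (\<Sum>b'<d. Ob b' b * contraction1 J J a b')) = (\<Sum>b<d. \<Sum>b'<d. Ob b' b * Ob b a * contraction1 J J a b')"
        by (simp add: sum_distrib_left mult_ac)
      also have "\<dots> = (\<Sum>b'<d. \<Sum>b<d. Ob b' b * Ob b a * contraction1 J J a b')" by (rule sum.swap)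
      finally show "(\<Sum>b<d. Ob b a * (\<Sum>b'<d. Ob b' b * contraction1 J J a b')) = (\<Sum>b'<d. kernel_mult d Ob Ob b' a * contraction1 J J a b')"
        by (simp add: kernel_mult_def sum_distrib_right)
    qed
    show ?thesis using 1 2 3 by (simp only: distrib_left sum.distrib)
  qed
  also have "?c Ob J = of_nat s * kernel_trace d Ob * rho_power J J + collective k d Ob (rho_power J) J"
    by (rule contraction1_contract[OF J J])
  also have "?c (kernel_mult d Ob Ob) J = of_nat s * kernel_trace d (kernel_mult d Ob Ob) * rho_power J J + collective k d (kernel_mult d Ob Ob) (rho_power J) J"
    by (rule contraction1_contract[OF J J])
  also have "(\<Sum>l<k. \<Sum>b'<d. Ob b' (J l) * ?c Ob (J(l := b'))) =
      collective k d Ob (\<lambda>J'. of_nat s * kernel_trace d Ob * rho_power J J' + collective k d Ob (rho_power J) J') J"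
    unfolding collective_def[of k d Ob "\<lambda>J'. of_nat s * kernel_trace d Ob * rho_power J J' + collective k d Ob (rho_power J) J'"]
    using J by (intro sum.cong refl) (simp add: contraction1_contract tuples_upd)
  also have "\<dots> = of_nat s * kernel_trace d Ob * collective k d Ob (rho_power J) J + collective k d Ob (collective k d Ob (rho_power J)) J"
    unfolding collective_add collective_scale ..
  finally show ?thesis by (simp add: power2_eq_square algebra_simps)
qed

lemma weight_obs: "(\<Sum>x\<in>X. weight k R x * obs Ob x) = (\<Sum>J\<in>tuples k d. \<Sum>a<d. \<Sum>b<d. Ob b a * contraction1 J J a b)"
proof -
  have "(\<Sum>x\<in>X. weight k R x * obs Ob x) = (\<Sum>x\<in>X. \<Sum>(J, I)\<in>tuples k d \<times> tuples k d. \<Sum>(a, b)\<in>{..<d} \<times> {..<d}.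
      Ob b a * (R J I * (p x * (\<Prod>l<Suc k. G x ((I(k := a)) l) ((J(k := b)) l)))))"
    by (simp add: weight_def obs_def sum.cartesian_product[symmetric] sum_distrib_left sum_distrib_right mult_ac)
  also have "\<dots> = (\<Sum>(J, I)\<in>tuples k d \<times> tuples k d. \<Sum>(a, b)\<in>{..<d} \<times> {..<d}. \<Sum>x\<in>X.
      Ob b a * (R J I * (p x * (\<Prod>l<Suc k. G x ((I(k := a)) l) ((J(k := b)) l)))))"
    unfolding case_prod_unfold by (subst sum.swap, intro sum.cong refl, rule sum.swap)
  also have "\<dots> = (\<Sum>J\<in>tuples k d. \<Sum>I\<in>tuples k d. \<Sum>(a, b)\<in>{..<d} \<times> {..<d}.
      Ob b a * (R J I * G_moment (Suc k) (I(k := a)) (J(k := b))))"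
    by (simp add: sum.cartesian_product[symmetric] G_moment_def sum_distrib_left del: prod.lessThan_Suc)
  also have "\<dots> = (\<Sum>J\<in>tuples k d. \<Sum>(a, b)\<in>{..<d} \<times> {..<d}. Ob b a * contraction1 J J a b)"
    unfolding contraction1_def case_prod_unfold sum_distrib_left by (intro sum.cong refl, rule sum.swap)
  finally show ?thesis by (simp add: sum.cartesian_product)
qed

text \<open>Each of the two observables contributes a factor \<open>G\<close>, so the sum over
  \<open>x\<close> produces moments of order \<open>k + 2\<close>, the highest order that
  occurs.\<close>

lemma weight_obs2: "(\<Sum>x\<in>X. weight k R x * (obs Ob x)\<^sup>2) =
  (\<Sum>J\<in>tuples k d. \<Sum>a<d. \<Sum>b<d. \<Sum>a'<d. \<Sum>b'<d. Ob b a * Ob b' a' * contraction2 J J a b a' b')"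
proof -
  let ?B = "({..<d} \<times> {..<d}) \<times> ({..<d} \<times> {..<d})"
  let ?H = "\<lambda>x J I a b a' b'. Ob b a * Ob b' a' * (R J I * (p x * (\<Prod>l<Suc (Suc k). G x ((I(k := a, Suc k := a')) l) ((J(k := b, Suc k := b')) l))))"
  have "(\<Sum>x\<in>X. weight k R x * (obs Ob x)\<^sup>2) = (\<Sum>x\<in>X. \<Sum>(J, I)\<in>tuples k d \<times> tuples k d. \<Sum>((a, b), (a', b'))\<in>?B.
      ?H x J I a b a' b')"
  proof (intro sum.cong refl)
    fix x
    have "(obs Ob x)\<^sup>2 = (\<Sum>((a, b), (a', b'))\<in>?B. Ob b a * G x a b * (Ob b' a' * G x a' b'))"
      unfolding obs_def power2_eq_square sum.cartesian_product sum_product case_prod_unfold by simp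
    moreover have "weight k R x = (\<Sum>(J, I)\<in>tuples k d \<times> tuples k d. p x * (R J I * (\<Prod>l<k. G x (I l) (J l))))"
      by (simp add: weight_def sum.cartesian_product[symmetric] sum_distrib_left)
    ultimately have "weight k R x * (obs Ob x)\<^sup>2 = (\<Sum>(J, I)\<in>tuples k d \<times> tuples k d. \<Sum>((a, b), (a', b'))\<in>?B.
      p x * (R J I * (\<Prod>l<k. G x (I l) (J l))) * (Ob b a * G x a b * (Ob b' a' * G x a' b')))"
      by (simp only: sum_product case_prod_unfold)
    also have "\<dots> = (\<Sum>(J, I)\<in>tuples k d \<times> tuples k d. \<Sum>((a, b), (a', b'))\<in>?B.
      ?H x J I a b a' b')"
      by (intro sum.cong refl) (auto simp: mult_ac)
    finally show "weight k R x * (obs Ob x)\<^sup>2 = (\<Sum>(J, I)\<in>tuples k d \<times> tuples k d. \<Sum>((a, b), (a', b'))\<in>?B.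
      ?H x J I a b a' b')" .
  qed
  also have "\<dots> = (\<Sum>(J, I)\<in>tuples k d \<times> tuples k d. \<Sum>((a, b), (a', b'))\<in>?B. \<Sum>x\<in>X.
      ?H x J I a b a' b')"
    unfolding case_prod_unfold by (subst sum.swap, intro sum.cong refl, rule sum.swap)
  also have "\<dots> = (\<Sum>J\<in>tuples k d. \<Sum>I\<in>tuples k d. \<Sum>((a, b), (a', b'))\<in>?B. \<Sum>x\<in>X.
      ?H x J I a b a' b')"
    by (rule sum.cartesian_product[symmetric])
  also have "\<dots> = (\<Sum>J\<in>tuples k d. \<Sum>I\<in>tuples k d. \<Sum>((a, b), (a', b'))\<in>?B.
      Ob b a * Ob b' a' * (R J I * G_moment (Suc (Suc k)) (I(k := a, Suc k := a')) (J(k := b, Suc k := b'))))"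
    by (simp only: G_moment_def sum_distrib_left case_prod_unfold)
  also have "\<dots> = (\<Sum>J\<in>tuples k d. \<Sum>((a, b), (a', b'))\<in>?B. Ob b a * Ob b' a' * contraction2 J J a b a' b')"
    unfolding contraction2_def case_prod_unfold sum_distrib_left by (intro sum.cong refl, rule sum.swap)
  also have "\<dots> = (\<Sum>J\<in>tuples k d. \<Sum>(a, b)\<in>{..<d} \<times> {..<d}. \<Sum>(a', b')\<in>{..<d} \<times> {..<d}. Ob b a * Ob b' a' * contraction2 J J a b a' b')"
    by (simp only: case_prod_unfold sum.cartesian_product fst_conv snd_conv)
  finally show ?thesis by (simp only: sum.cartesian_product[symmetric])
qed

lemma first_moment:
  "(\<Sum>x\<in>X. weight k R x * obs Ob x) = of_nat s * kernel_trace d Ob + of_nat k * kernel_trace d (kernel_mult d Ob \<rho>)"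
  unfolding weight_obs
  by (simp add: contraction1_contract sum.distrib sum_distrib_left[symmetric] collective_trace0[OF tr] collective_trace1[OF tr])

text \<open>Subtracting the square of the mean in \<open>first_moment\<close> leaves the variance
  \<open>s Tr (O^2) + 2 k Tr (O^2 \<rho>) - k Tr (O \<rho>)^2\<close>. One of the two terms
  \<open>k Tr (O^2 \<rho>)\<close> comes from \<open>collective_trace2\<close>, the other from the
  swap of the two added factors.\<close>

lemma second_moment:
  "(\<Sum>x\<in>X. weight k R x * (obs Ob x)\<^sup>2) = (of_nat s * kernel_trace d Ob)\<^sup>2 +
    2 * of_nat s * of_nat k * kernel_trace d Ob * kernel_trace d (kernel_mult d Ob \<rho>) +
    of_nat k * (of_nat k - 1) * (kernel_trace d (kernel_mult d Ob \<rho>))\<^sup>2 +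
    of_nat s * kernel_trace d (kernel_mult d Ob Ob) + 2 * of_nat k * kernel_trace d (kernel_mult d (kernel_mult d Ob Ob) \<rho>)"
proof -
  have "(\<Sum>x\<in>X. weight k R x * (obs Ob x)\<^sup>2) = (\<Sum>J\<in>tuples k d.
      (of_nat s * kernel_trace d Ob)\<^sup>2 * rho_power J J + 2 * of_nat s * kernel_trace d Ob * collective k d Ob (rho_power J) J +
      collective k d Ob (collective k d Ob (rho_power J)) J +
      of_nat s * kernel_trace d (kernel_mult d Ob Ob) * rho_power J J + collective k d (kernel_mult d Ob Ob) (rho_power J) J)"
    unfolding weight_obs2 by (intro sum.cong refl) (rule contraction2_contract)
  then show ?thesis
    unfolding sum.distrib sum_distrib_left[symmetric] collective_trace0[OF tr]
      collective_trace1[OF tr] collective_trace2[OF tr] by (simp add: algebra_simps)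
qed

end

end

section \<open>The measurement of one batch of copies\<close>

text \<open>A maximal independent set of columns spans all columns and has at most \<open>r\<close>
  elements. Padding by zeros brings the inner dimension to exactly \<open>r\<close>, so that
  \<open>W\<close> has the shape of the Gaussian matrix.\<close>

lemma rank_factorization:
  assumes A: "(A :: complex mat) \<in> carrier_mat n m" and rank: "vec_space.rank n A \<le> r"
  shows "\<exists>W C. W \<in> carrier_mat n r \<and> C \<in> carrier_mat r m \<and> A = W * C"
proof -
  interpret vec_space "TYPE(complex)" n .
  let ?P = "\<lambda>T. T \<subseteq> set (cols A) \<and> lin_indpt T"
  have cols: "set (cols A) \<subseteq> carrier_vec n" using A cols_dim by blast
  have "?P {}" by (simp add: lin_dep_def)
  from maximal_exists_superset[of "set (cols A)" ?P, OF _ _ this]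
  obtain S where S: "finite S" "maximal S ?P" by blast
  have li: "lin_indpt S" and sub: "S \<subseteq> set (cols A)" using S(2) by (auto simp: maximal_def)
  have card: "card S \<le> r" using rank_card_indpt[OF A S(2)] rank by simp
  have Sc: "S \<subseteq> carrier_vec n" using sub cols by blast
  have "v \<in> span S" if v: "v \<in> set (cols A)" for v
  proof (cases "v \<in> S")
    case True
    then show ?thesis using span_mem[of S v] Sc by simp
  next
    case False
    then have "\<not> ?P (insert v S)" using S(2) unfolding maximal_def by blast
    then have "lin_dep (S \<union> {v})" using v sub by auto
    then show ?thesis using lin_dep_iff_in_span[of S v] Sc li False v cols by auto
  qed
  then have "\<forall>j. \<exists>a. j < m \<longrightarrow> lincomb a S = col A j"
    using finite_in_span[OF S(1)] Sc A by (metis carrier_matD(2) cols_length cols_nth module_vec_simps(3) nth_mem)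
  then obtain a where a: "\<And>j. j < m \<Longrightarrow> lincomb (a j) S = col A j" by metis
  obtain h where h: "bij_betw h {..<card S} S"
    using S(1) by (metis atLeast0LessThan ex_bij_betw_nat_finite)
  define W where "W = mat n r (\<lambda>(i, c). if c < card S then h c $ i else 0)"
  define C where "C = mat r m (\<lambda>(c, j). if c < card S then a j (h c) else 0)"
  have "A = W * C"
  proof (rule eq_matI)
    fix i j assume "i < dim_row (W * C)" "j < dim_col (W * C)"
    then have ij: "i < n" "j < m" by (auto simp: W_def C_def)
    have "A $$ (i, j) = lincomb (a j) S $ i" using a[OF ij(2)] A ij by simp
    also have "\<dots> = (\<Sum>v\<in>S. a j v * v $ i)" by (rule lincomb_index[OF ij(1) Sc])
    also have "\<dots> = (\<Sum>c<card S. a j (h c) * h c $ i)"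
      by (rule sum.reindex_bij_betw[OF h, symmetric])
    also have "\<dots> = (\<Sum>c<r. if c < card S then a j (h c) * h c $ i else 0)"
      using card by (intro sum.mono_neutral_cong_left) auto
    also have "\<dots> = (W * C) $$ (i, j)"
      using ij by (subst index_mult_mat_sum[of _ n r _ m]) (auto simp: W_def C_def intro!: sum.cong)
    finally show "A $$ (i, j) = (W * C) $$ (i, j)" .
  qed (use A in \<open>auto simp: W_def C_def\<close>)
  then show ?thesis by (intro exI[of _ W] exI[of _ C]) (auto simp: W_def C_def)
qed

lemma psd_mat_sum:
  assumes "finite X" "\<And>x. x \<in> X \<Longrightarrow> psd_mat n (f x)"
  shows "psd_mat n (mat n n (\<lambda>ij. \<Sum>x\<in>X. f x $$ ij))"
  using assms
proof (induction X)
  case empty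
  have "mat n n (\<lambda>ij. \<Sum>x\<in>{}. f x $$ ij) = (0\<^sub>m n n) * mat_adjoint (0\<^sub>m n n :: complex mat)"
    by (intro eq_matI) (auto simp: index_mult_mat_sum[of _ n n _ n])
  then show ?case by (metis psd_mat_gram zero_carrier_mat)
next
  case (insert x X)
  have "f x \<in> carrier_mat n n" using insert.prems by (auto simp: psd_mat_def hermitian_mat_def)
  then have "mat n n (\<lambda>ij. \<Sum>x\<in>insert x X. f x $$ ij) = f x + mat n n (\<lambda>ij. \<Sum>x\<in>X. f x $$ ij)"
    using insert.hyps by (intro eq_matI) auto
  then show ?case using insert by (auto intro!: psd_mat_add)
qed

lemma mat_trace_sum:
  assumes "\<And>x. x \<in> X \<Longrightarrow> f x \<in> carrier_mat n n" "B \<in> carrier_mat n n" "F \<in> carrier_mat n n"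
    "\<And>i j. i < n \<Longrightarrow> j < n \<Longrightarrow> F $$ (i, j) = (\<Sum>x\<in>X. f x $$ (i, j))"
  shows "(\<Sum>x\<in>X. mat_trace (f x * B)) = mat_trace (F * B)"
proof -
  have "(\<Sum>x\<in>X. mat_trace (f x * B)) = (\<Sum>x\<in>X. \<Sum>i<n. \<Sum>j<n. f x $$ (i, j) * B $$ (j, i))"
    using assms by (simp add: mat_trace_mult[of _ n n])
  also have "\<dots> = (\<Sum>i<n. \<Sum>j<n. \<Sum>x\<in>X. f x $$ (i, j) * B $$ (j, i))"
    by (subst sum.swap, intro sum.cong refl, rule sum.swap)
  also have "\<dots> = mat_trace (F * B)"
    using assms by (simp add: mat_trace_mult[of _ n n] sum_distrib_right)
  finally show ?thesis .
qed

lemma tuples_Suc: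
  assumes "I \<in> tuples k d" "a < d"
  shows "I(k := a) \<in> tuples (Suc k) d" "restrict (I(k := a)) {..<k} = I"
proof -
  have I: "\<And>l. l < k \<Longrightarrow> I l < d" "\<And>l. \<not> l < k \<Longrightarrow> I l = undefined"
    using assms(1) by (auto simp: PiE_iff extensional_def)
  show "I(k := a) \<in> tuples (Suc k) d"
    by (rule PiE_I) (use I assms(2) in \<open>auto simp: less_Suc_eq\<close>)
  show "restrict (I(k := a)) {..<k} = I"
    by (rule ext) (use I in auto)
qed

lemma tuples_Suc_split:
  assumes "I \<in> tuples (Suc k) d"
  shows "restrict I {..<k} \<in> tuples k d" "I k < d" "(restrict I {..<k})(k := I k) = I"
proof -
  have I: "\<And>l. l < Suc k \<Longrightarrow> I l < d" "\<And>l. \<not> l < Suc k \<Longrightarrow> I l = undefined"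
    using assms by (auto simp: PiE_iff extensional_def)
  show "restrict I {..<k} \<in> tuples k d" using I(1) by auto
  show "I k < d" using I(1) by simp
  show "(restrict I {..<k})(k := I k) = I"
    by (rule ext) (use I(2) in \<open>auto simp: less_Suc_eq\<close>)
qed

section \<open>Symmetry and kernel of the moment matrix\<close>

context gaussian_matrix
begin

lemma X_nonempty: "X \<noteq> {}"
  using moments[of "\<lambda>_. 0" "\<lambda>_. 0"] by auto

lemma sum_tuples_Suc:
  "(\<Sum>I\<in>tuples (Suc k) d. f I) = (\<Sum>I\<in>tuples k d. \<Sum>a<d. (f (I(k := a)) :: complex))"
proof -
  have "(\<Sum>I\<in>tuples k d. \<Sum>a<d. f (I(k := a))) = (\<Sum>(I, a)\<in>tuples k d \<times> {..<d}. f (I(k := a)))"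
    by (rule sum.cartesian_product)
  also have "\<dots> = (\<Sum>I\<in>tuples (Suc k) d. f I)"
  proof (rule sum.reindex_bij_witness[of _ "\<lambda>I. (restrict I {..<k}, I k)" "\<lambda>(I, a). I(k := a)"])
    fix p assume "p \<in> tuples k d \<times> {..<d}"
    then obtain I a where p: "p = (I, a)" "I \<in> tuples k d" "a < d" by blast
    show "(restrict (case p of (I, a) \<Rightarrow> I(k := a)) {..<k}, (case p of (I, a) \<Rightarrow> I(k := a)) k) = p"
      using tuples_Suc(2)[OF p(2,3)] by (simp add: p(1))
    show "(case p of (I, a) \<Rightarrow> I(k := a)) \<in> tuples (Suc k) d"
      using tuples_Suc(1)[OF p(2,3)] by (simp add: p(1))
    show "f (case p of (I, a) \<Rightarrow> I(k := a)) = (case p of (I, a) \<Rightarrow> f (I(k := a)))"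
      by (simp add: p(1))
  next
    fix I assume I: "I \<in> tuples (Suc k) d"
    show "(case (restrict I {..<k}, I k) of (I, a) \<Rightarrow> I(k := a)) = I"
      using tuples_Suc_split(3)[OF I] by simp
    show "(restrict I {..<k}, I k) \<in> tuples k d \<times> {..<d}"
      using tuples_Suc_split(1,2)[OF I] by simp
  qed
  finally show ?thesis ..
qed

text \<open>By the recursion, \<open>A_(k+1)\<close> is built from \<open>A_k\<close>, scalars and
  swaps of tensor factors. The first commutes with tensor powers by induction, and a swap commutes
  with a tensor product of equal factors, whatever the matrix \<open>\<beta>\<close> is.\<close>

lemma G_moment_commute:
  assumes "k \<le> K" "I \<in> tuples k d" "J \<in> tuples k d"
  shows "(\<Sum>I'\<in>tuples k d. (\<Prod>l<k. \<beta> (I l) (I' l)) * G_moment k I' J) =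
    (\<Sum>J'\<in>tuples k d. G_moment k I J' * (\<Prod>l<k. \<beta> (J' l) (J l)))"
  using assms
proof (induction k arbitrary: I J)
  case 0
  then show ?case by (simp add: G_moment_def)
next
  case (Suc k)
  define i j a b where "i = restrict I {..<k}" and "j = restrict J {..<k}" and "a = I k" and "b = J k"
  have ij: "i \<in> tuples k d" "j \<in> tuples k d" and ab: "a < d" "b < d"
    using Suc.prems by (auto simp: i_def j_def a_def b_def PiE_iff)
  have I: "I = i(k := a)" and J: "J = j(k := b)"
    using Suc.prems by (auto simp: i_def j_def a_def b_def PiE_iff extensional_def fun_eq_iff less_Suc_eq)
  let ?B = "\<lambda>I J. \<Prod>l<k. \<beta> (I l) (J l)"
  let ?L = "\<lambda>j. \<Sum>i'\<in>tuples k d. ?B i i' * G_moment k i' j" and ?R = "\<lambda>j. \<Sum>j'\<in>tuples k d. G_moment k i j' * ?B j' j"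
  have IH: "?L j = ?R j" if "j \<in> tuples k d" for j
    using Suc.IH[OF _ ij(1) that] Suc.prems(1) by simp
  have K: "Suc k \<le> K" using Suc.prems by simp
  have rec: "G_moment (Suc k) (i'(k := a')) (j'(k := b')) = (if a' = b' then of_nat s * G_moment k i' j' else 0) +
    (\<Sum>l<k. if a' = j' l then G_moment k i' (j'(l := b')) else 0)"
    if "i' \<in> tuples k d" "j' \<in> tuples k d" "a' < d" "b' < d" for i' j' a' b'
    using that by (intro G_moment_rec[OF K]) (auto dest: tuples_nth)
  have "(\<Sum>I'\<in>tuples (Suc k) d. (\<Prod>l<Suc k. \<beta> (I l) (I' l)) * G_moment (Suc k) I' J) =
      (\<Sum>i'\<in>tuples k d. \<Sum>a'<d. ?B i i' * \<beta> a a' * G_moment (Suc k) (i'(k := a')) (j(k := b)))"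
    unfolding sum_tuples_Suc I J by simp
  also have "\<dots> = (\<Sum>i'\<in>tuples k d. \<Sum>a'<d. (if a' = b then of_nat s * \<beta> a b * (?B i i' * G_moment k i' j) else 0) +
      (\<Sum>l<k. if a' = j l then \<beta> a (j l) * (?B i i' * G_moment k i' (j(l := b))) else 0))"
    using ij ab by (intro sum.cong refl)
      (auto simp: rec distrib_left sum_distrib_left if_distrib[of "\<lambda>x. _ * x"] mult_ac cong: if_cong)
  also have "\<dots> = (\<Sum>i'\<in>tuples k d. of_nat s * \<beta> a b * (?B i i' * G_moment k i' j) +
      (\<Sum>l<k. \<beta> a (j l) * (?B i i' * G_moment k i' (j(l := b)))))"
  proof (rule sum.cong[OF refl])
    fix i'
    have "(\<Sum>a'<d. \<Sum>l<k. if a' = j l then \<beta> a (j l) * (?B i i' * G_moment k i' (j(l := b))) else 0) =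
        (\<Sum>l<k. \<beta> a (j l) * (?B i i' * G_moment k i' (j(l := b))))"
      using tuples_nth[OF ij(2)] by (subst sum.swap, intro sum.cong refl) simp
    then show "(\<Sum>a'<d. (if a' = b then of_nat s * \<beta> a b * (?B i i' * G_moment k i' j) else 0) +
        (\<Sum>l<k. if a' = j l then \<beta> a (j l) * (?B i i' * G_moment k i' (j(l := b))) else 0)) =
      of_nat s * \<beta> a b * (?B i i' * G_moment k i' j) + (\<Sum>l<k. \<beta> a (j l) * (?B i i' * G_moment k i' (j(l := b))))"
      using ab by (simp add: sum.distrib)
  qed
  also have "\<dots> = of_nat s * \<beta> a b * ?L j + (\<Sum>l<k. \<beta> a (j l) * ?L (j(l := b)))"
    unfolding sum.distrib sum_distrib_left by (rule arg_cong2[where f = "(+)"], rule refl, rule sum.swap)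
  also have "\<dots> = of_nat s * \<beta> a b * ?R j + (\<Sum>l<k. \<beta> a (j l) * ?R (j(l := b)))"
    using IH ij ab by (simp add: tuples_upd)
  also have "\<dots> = (\<Sum>j'\<in>tuples k d. \<Sum>b'<d. G_moment (Suc k) (i(k := a)) (j'(k := b')) * (?B j' j * \<beta> b' b))"
  proof -
    \<comment> \<open>The commutation of one swap: the substitution of \<open>j'(l := b')\<close>
      for \<open>j'\<close> exchanges the roles of place \<open>l\<close> and the new place
      \<open>k\<close>, with \<open>b'\<close> recovered as entry \<open>l\<close>.\<close>
    have shift: "(\<Sum>j'\<in>tuples k d. \<Sum>b'<d. if a = j' l then G_moment k i (j'(l := b')) * (?B j' j * \<beta> b' b) else 0) =
        \<beta> a (j l) * ?R (j(l := b))" if l: "l < k" for l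
    proof -
      have split: "(\<Prod>m<k. f m) = f l * (\<Prod>m\<in>{..<k} - {l}. f m)" for f :: "nat \<Rightarrow> complex"
        using l by (simp add: prod.remove)
      let ?g = "\<lambda>p. G_moment k i ((fst p)(l := snd p)) * (?B (fst p) j * \<beta> (snd p) b)"
      have "(\<Sum>j'\<in>tuples k d. \<Sum>b'<d. if a = j' l then G_moment k i (j'(l := b')) * (?B j' j * \<beta> b' b) else 0) =
          (\<Sum>p\<in>tuples k d \<times> {..<d}. if a = fst p l then ?g p else 0)"
        unfolding sum.cartesian_product case_prod_unfold ..
      also have "\<dots> = (\<Sum>p\<in>{p \<in> tuples k d \<times> {..<d}. a = fst p l}. ?g p)"
        by (rule sum.inter_filter[symmetric]) simp
      also have "\<dots> = (\<Sum>j''\<in>tuples k d. G_moment k i j'' * (?B (j''(l := a)) j * \<beta> (j'' l) b))"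
      proof (rule sum.reindex_bij_witness[of _ "\<lambda>j''. (j''(l := a), j'' l)" "\<lambda>p. (fst p)(l := snd p)"])
        fix p assume "p \<in> {p \<in> tuples k d \<times> {..<d}. a = fst p l}"
        then obtain j' b' where p: "p = (j', b')" "j' \<in> tuples k d" "b' < d" "j' l = a" by auto
        have e: "(j'(l := b'))(l := a) = j'" using p(4) by (simp add: fun_upd_idem)
        show "(((fst p)(l := snd p))(l := a), ((fst p)(l := snd p)) l) = p" using e by (simp add: p(1))
        show "(fst p)(l := snd p) \<in> tuples k d" using tuples_upd[OF p(2) l p(3)] by (simp add: p(1))
        show "G_moment k i ((fst p)(l := snd p)) * (?B (((fst p)(l := snd p))(l := a)) j * \<beta> (((fst p)(l := snd p)) l) b) = ?g p"
          by (simp only: p(1) fst_conv snd_conv e fun_upd_same)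
      next
        fix j'' assume j: "j'' \<in> tuples k d"
        show "(fst (j''(l := a), j'' l))(l := snd (j''(l := a), j'' l)) = j''" by simp
        show "(j''(l := a), j'' l) \<in> {p \<in> tuples k d \<times> {..<d}. a = fst p l}"
          using tuples_upd[OF j l ab(1)] tuples_nth[OF j l] by simp
      qed
      also have "\<dots> = (\<Sum>j''\<in>tuples k d. \<beta> a (j l) * (G_moment k i j'' * ?B j'' (j(l := b))))"
      proof (rule sum.cong[OF refl])
        fix j''
        have "(\<Prod>m\<in>{..<k} - {l}. \<beta> ((j''(l := a)) m) (j m)) = (\<Prod>m\<in>{..<k} - {l}. \<beta> (j'' m) ((j(l := b)) m))"
          by (intro prod.cong) auto
        then show "G_moment k i j'' * (?B (j''(l := a)) j * \<beta> (j'' l) b) = \<beta> a (j l) * (G_moment k i j'' * ?B j'' (j(l := b)))"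
          by (simp add: split)
      qed
      finally show ?thesis by (simp only: sum_distrib_left)
    qed
    have "(\<Sum>j'\<in>tuples k d. \<Sum>b'<d. G_moment (Suc k) (i(k := a)) (j'(k := b')) * (?B j' j * \<beta> b' b)) =
      (\<Sum>j'\<in>tuples k d. \<Sum>b'<d. (if a = b' then of_nat s * \<beta> a b * (G_moment k i j' * ?B j' j) else 0) +
        (\<Sum>l<k. if a = j' l then G_moment k i (j'(l := b')) * (?B j' j * \<beta> b' b) else 0))"
    proof (intro sum.cong refl)
      fix j' b' assume "j' \<in> tuples k d" "b' \<in> {..<d}"
      then have r: "G_moment (Suc k) (i(k := a)) (j'(k := b')) = (if a = b' then of_nat s * G_moment k i j' else 0) +
          (\<Sum>l<k. if a = j' l then G_moment k i (j'(l := b')) else 0)"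
        using ij ab by (intro rec) auto
      have "(if a = b' then of_nat s * G_moment k i j' else 0) * (?B j' j * \<beta> b' b) =
          (if a = b' then of_nat s * \<beta> a b * (G_moment k i j' * ?B j' j) else 0)"
        by (cases "a = b'") (simp_all only: if_True if_False refl mult_ac mult_zero_left)
      moreover have "(\<Sum>l<k. if a = j' l then G_moment k i (j'(l := b')) else 0) * (?B j' j * \<beta> b' b) =
          (\<Sum>l<k. if a = j' l then G_moment k i (j'(l := b')) * (?B j' j * \<beta> b' b) else 0)"
        unfolding sum_distrib_right by (intro sum.cong refl) simp
      ultimately show "G_moment (Suc k) (i(k := a)) (j'(k := b')) * (?B j' j * \<beta> b' b) =
        (if a = b' then of_nat s * \<beta> a b * (G_moment k i j' * ?B j' j) else 0) +
        (\<Sum>l<k. if a = j' l then G_moment k i (j'(l := b')) * (?B j' j * \<beta> b' b) else 0)"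
        unfolding r distrib_right by simp
    qed
    also have "\<dots> = of_nat s * \<beta> a b * ?R j + (\<Sum>j'\<in>tuples k d. \<Sum>b'<d. \<Sum>l<k.
        if a = j' l then G_moment k i (j'(l := b')) * (?B j' j * \<beta> b' b) else 0)"
      using ab by (simp add: sum.distrib sum_distrib_left)
    also have "(\<Sum>j'\<in>tuples k d. \<Sum>b'<d. \<Sum>l<k. if a = j' l then G_moment k i (j'(l := b')) * (?B j' j * \<beta> b' b) else 0) =
        (\<Sum>l<k. \<Sum>j'\<in>tuples k d. \<Sum>b'<d. if a = j' l then G_moment k i (j'(l := b')) * (?B j' j * \<beta> b' b) else 0)"
    proof -
      have "(\<Sum>j'\<in>tuples k d. \<Sum>b'<d. \<Sum>l<k. if a = j' l then G_moment k i (j'(l := b')) * (?B j' j * \<beta> b' b) else 0) =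
        (\<Sum>j'\<in>tuples k d. \<Sum>l<k. \<Sum>b'<d. if a = j' l then G_moment k i (j'(l := b')) * (?B j' j * \<beta> b' b) else 0)"
        by (rule sum.cong[OF refl], rule sum.swap)
      then show ?thesis by (simp only: sum.swap[of _ "{..<k}" "tuples k d"])
    qed
    also have "\<dots> = (\<Sum>l<k. \<beta> a (j l) * ?R (j(l := b)))"
      using shift by (intro sum.cong refl) simp
    finally show ?thesis ..
  qed
  also have "\<dots> = (\<Sum>J'\<in>tuples (Suc k) d. G_moment (Suc k) I J' * (\<Prod>l<Suc k. \<beta> (J' l) (J l)))"
    unfolding sum_tuples_Suc I J by simp
  finally show ?case .
qed

end

lemma digits_tuples: "i < d ^ k \<Longrightarrow> digits d k i \<in> tuples k d"
  using bij_betw_digits[of d k] by (auto simp: bij_betw_def)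

lemma digits_less: "i < d ^ k \<Longrightarrow> l < k \<Longrightarrow> digits d k i l < d"
  by (rule tuples_nth[OF digits_tuples])

lemma tensor_power_index:
  assumes "A \<in> carrier_mat a b" "i < a ^ k" "j < b ^ k"
  shows "tensor_power A k $$ (i, j) = (\<Prod>l<k. A $$ (digits a k i l, digits b k j l))"
  unfolding tensor_power_eq_tens by (rule tens_index) (use assms in auto)

context gaussian_matrix
begin

definition V_mat :: "'x \<Rightarrow> complex mat" where
  "V_mat x = mat d s (\<lambda>ac. V x ac)"

definition G_mat :: "'x \<Rightarrow> complex mat" where
  "G_mat x = mat d d (\<lambda>(a, b). G x a b)"

lemma V_mat_carrier [simp]: "V_mat x \<in> carrier_mat d s" by (simp add: V_mat_def)
lemma G_mat_carrier [simp]: "G_mat x \<in> carrier_mat d d" by (simp add: G_mat_def)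

lemma G_mat_gram: "G_mat x = V_mat x * mat_adjoint (V_mat x)"
  by (rule eq_matI)
    (auto simp: index_mult_mat_sum[of _ d s _ d] G_mat_def G_def V_mat_def)

lemma tensor_power_G_mat: "tensor_power (G_mat x) k = tensor_power (V_mat x) k * mat_adjoint (tensor_power (V_mat x) k)"
  unfolding tensor_power_adjoint G_mat_gram
  by (rule tensor_power_mult[symmetric, of _ d s _ d]) simp_all

lemma tensor_power_G_mat_index:
  assumes "i < d ^ k" "j < d ^ k"
  shows "tensor_power (G_mat x) k $$ (i, j) = (\<Prod>l<k. G x (digits d k i l) (digits d k j l))"
  using assms by (simp add: tensor_power_index[of _ d d] G_mat_def digits_less)

definition moment_mat :: "nat \<Rightarrow> complex mat" where
  "moment_mat k = mat (d ^ k) (d ^ k) (\<lambda>(i, j). G_moment k (digits d k i) (digits d k j))"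

lemma moment_mat_carrier [simp]: "moment_mat k \<in> carrier_mat (d ^ k) (d ^ k)" by (simp add: moment_mat_def)

lemma moment_mat_index_sum:
  assumes "i < d ^ k" "j < d ^ k"
  shows "moment_mat k $$ (i, j) = (\<Sum>x\<in>X. p x * tensor_power (G_mat x) k $$ (i, j))"
  using assms by (simp add: moment_mat_def G_moment_def tensor_power_G_mat_index)

lemma psd_moment_mat: "psd_mat (d ^ k) (moment_mat k)"
proof -
  have c: "tensor_power (G_mat x) k \<in> carrier_mat (d ^ k) (d ^ k)" for x
    by (rule tensor_power_carrier) simp
  have e: "moment_mat k = mat (d ^ k) (d ^ k) (\<lambda>ij. \<Sum>x\<in>X. (complex_of_real (p x) \<cdot>\<^sub>m tensor_power (G_mat x) k) $$ ij)"
    by (intro eq_matI) (auto simp: moment_mat_index_sum carrier_matD[OF c] carrier_matD[OF moment_mat_carrier])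
  have "psd_mat (d ^ k) (complex_of_real (p x) \<cdot>\<^sub>m tensor_power (G_mat x) k)" if "x \<in> X" for x
    unfolding tensor_power_G_mat
    by (intro psd_mat_smult psd_mat_gram[of _ _ "s ^ k"] tensor_power_carrier p_nonneg that V_mat_carrier)
  then show ?thesis unfolding e by (rule psd_mat_sum[OF finite_X])
qed

lemma moment_mat_commute:
  assumes "k \<le> K" "\<beta> \<in> carrier_mat d d"
  shows "tensor_power \<beta> k * moment_mat k = moment_mat k * tensor_power \<beta> k"
proof (rule eq_matI)
  note c = tensor_power_carrier[OF assms(2), of k]
  fix i j assume "i < dim_row (moment_mat k * tensor_power \<beta> k)" "j < dim_col (moment_mat k * tensor_power \<beta> k)"
  then have ij: "i < d ^ k" "j < d ^ k" using c by (auto simp: moment_mat_def)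
  let ?I = "digits d k i" and ?J = "digits d k j"
  have "(tensor_power \<beta> k * moment_mat k) $$ (i, j) =
      (\<Sum>m<d ^ k. (\<Prod>l<k. \<beta> $$ (?I l, digits d k m l)) * G_moment k (digits d k m) ?J)"
    using ij by (subst index_mult_mat_sum[OF c moment_mat_carrier])
      (auto simp: tensor_power_index[OF assms(2)] moment_mat_def intro!: sum.cong)
  also have "\<dots> = (\<Sum>I'\<in>tuples k d. (\<Prod>l<k. \<beta> $$ (?I l, I' l)) * G_moment k I' ?J)"
    by (rule sum_digits)
  also have "\<dots> = (\<Sum>J'\<in>tuples k d. G_moment k ?I J' * (\<Prod>l<k. \<beta> $$ (J' l, ?J l)))"
    using G_moment_commute[OF assms(1) digits_tuples[OF ij(1)] digits_tuples[OF ij(2)], of "\<lambda>a b. \<beta> $$ (a, b)"] .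
  also have "\<dots> = (\<Sum>m<d ^ k. G_moment k ?I (digits d k m) * (\<Prod>l<k. \<beta> $$ (digits d k m l, ?J l)))"
    by (rule sum_digits[symmetric])
  also have "\<dots> = (moment_mat k * tensor_power \<beta> k) $$ (i, j)"
    using ij by (subst index_mult_mat_sum[OF moment_mat_carrier c])
      (auto simp: tensor_power_index[OF assms(2)] moment_mat_def intro!: sum.cong)
  finally show "(tensor_power \<beta> k * moment_mat k) $$ (i, j) = (moment_mat k * tensor_power \<beta> k) $$ (i, j)" .
qed (use tensor_power_carrier[OF assms(2), of k] in \<open>auto simp: moment_mat_def\<close>)

text \<open>The form is the mean squared norm of the adjoint tensor power of \<open>V_mat x\<close>
  applied to \<open>v\<close>. Its component at the column tuple \<open>c\<close> is, up to
  conjugation, a homogeneous polynomial of degree \<open>k\<close> in the Gaussian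
  variables.\<close>

lemma moment_mat_quadratic_form:
  assumes v: "v \<in> carrier_vec (d ^ k)"
  shows "(moment_mat k *\<^sub>v v) \<bullet>c v = complex_of_real (\<Sum>c\<in>tuples k s. \<Sum>x\<in>X. p x *
    (cmod (\<Sum>i<d ^ k. cnj (v $ i) * (\<Prod>l<k. V x (digits d k i l, c l))))\<^sup>2)"
proof -
  let ?w = "\<lambda>x c i. cnj (v $ i) * (\<Prod>l<k. V x (digits d k i l, c l))"
  let ?h = "\<lambda>c x. \<Sum>i<d ^ k. cnj (v $ i) * (\<Prod>l<k. V x (digits d k i l, c l))"
  have "(moment_mat k *\<^sub>v v) \<bullet>c v = (\<Sum>(i, j)\<in>{..<d ^ k} \<times> {..<d ^ k}. moment_mat k $$ (i, j) * v $ j * cnj (v $ i))"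
    unfolding quadratic_form_sum[OF moment_mat_carrier v] by (rule sum.cartesian_product)
  also have "\<dots> = (\<Sum>(i, j)\<in>{..<d ^ k} \<times> {..<d ^ k}. \<Sum>x\<in>X. \<Sum>c\<in>tuples k s. p x *
      (?w x c i * cnj (?w x c j)))"
  proof (rule sum.cong[OF refl])
    fix q assume "q \<in> {..<d ^ k} \<times> {..<d ^ k}"
    then obtain i j where q: "q = (i, j)" and ij: "i < d ^ k" "j < d ^ k" by auto
    have "(\<Prod>l<k. G x (digits d k i l) (digits d k j l)) = (\<Sum>c\<in>tuples k s.
        \<Prod>l<k. V x (digits d k i l, c l) * cnj (V x (digits d k j l, c l)))" for x
      unfolding G_def by (rule prod_sum_PiE) auto
    note prod_G = this
    have "moment_mat k $$ (i, j) = (\<Sum>x\<in>X. complex_of_real (p x) * (\<Sum>c\<in>tuples k s.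
        (\<Prod>l<k. V x (digits d k i l, c l)) * cnj (\<Prod>l<k. V x (digits d k j l, c l))))"
      using ij by (simp add: moment_mat_def G_moment_def prod_G prod.distrib)
    then show "(case q of (i, j) \<Rightarrow> moment_mat k $$ (i, j) * v $ j * cnj (v $ i)) = (case q of (i, j) \<Rightarrow> \<Sum>x\<in>X. \<Sum>c\<in>tuples k s. p x *
      (?w x c i * cnj (?w x c j)))"
      unfolding q prod.case by (simp add: sum_distrib_left sum_distrib_right mult_ac)
  qed
  also have "\<dots> = (\<Sum>x\<in>X. \<Sum>c\<in>tuples k s. \<Sum>(i, j)\<in>{..<d ^ k} \<times> {..<d ^ k}. p x *
      (?w x c i * cnj (?w x c j)))"
    unfolding case_prod_unfold by (subst sum.swap, rule sum.cong[OF refl], rule sum.swap)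
  also have "\<dots> = (\<Sum>x\<in>X. \<Sum>c\<in>tuples k s. p x * (?h c x * cnj (?h c x)))"
  proof -
    have "?h c x * cnj (?h c x) = (\<Sum>(i, j)\<in>{..<d ^ k} \<times> {..<d ^ k}.
      ?w x c i * cnj (?w x c j))" for c x
      unfolding cnj_sum sum_product by (rule sum.cartesian_product)
    then show ?thesis by (simp only: sum_distrib_left case_prod_unfold)
  qed
  also have "\<dots> = (\<Sum>c\<in>tuples k s. \<Sum>x\<in>X. complex_of_real (p x) * complex_of_real ((cmod (?h c x))\<^sup>2))"
    by (subst sum.swap) (simp only: complex_norm_square)
  finally show ?thesis by (simp only: of_real_sum of_real_mult)
qed

text \<open>On a kernel vector all polynomials in \<open>moment_mat_quadratic_form\<close> have
  second moment zero, so by \<open>vanishing_polynomial\<close> they vanish identically and may be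
  evaluated at the entries of \<open>W\<close> in place of Gaussian ones.\<close>

lemma moment_mat_kernel:
  assumes k: "k \<le> K" and v: "v \<in> carrier_vec (d ^ k)" and zero: "moment_mat k *\<^sub>v v = 0\<^sub>v (d ^ k)"
    and W: "W \<in> carrier_mat d s"
  shows "tensor_power (mat_adjoint W) k *\<^sub>v v = 0\<^sub>v (s ^ k)"
proof (rule eq_vecI)
  let ?h = "\<lambda>c x. \<Sum>i<d ^ k. cnj (v $ i) * (\<Prod>l<k. V x (digits d k i l, c l))"
  have "complex_of_real (\<Sum>c\<in>tuples k s. \<Sum>x\<in>X. p x * (cmod (?h c x))\<^sup>2) = 0"
    using moment_mat_quadratic_form[OF v] v unfolding zero by simp
  then have "(\<Sum>c\<in>tuples k s. \<Sum>x\<in>X. p x * (cmod (?h c x))\<^sup>2) = 0" by (simp only: of_real_eq_0_iff)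
  then have zero': "(\<Sum>x\<in>X. p x * (cmod (?h c x))\<^sup>2) = 0" if "c \<in> tuples k s" for c
    using that
    by (rule sum_nonneg_0[OF finite_tuples, rotated]) (intro sum_nonneg mult_nonneg_nonneg p_nonneg zero_le_power2)
  have Wa: "mat_adjoint W \<in> carrier_mat s d" using W by simp
  fix c assume "c < dim_vec (0\<^sub>v (s ^ k) :: complex vec)"
  then have c: "c < s ^ k" by simp
  let ?c = "digits s k c"
  have "(\<Sum>i<d ^ k. cnj (v $ i) * (\<Prod>l<k. (\<lambda>e. W $$ e) (digits d k i l, ?c l))) = 0"
    using zero'[OF digits_tuples[OF c]] digits_less[OF c]
    by (intro vanishing_polynomial[OF k]) (auto simp: digits_less)
  then have "cnj (\<Sum>i<d ^ k. cnj (v $ i) * (\<Prod>l<k. W $$ (digits d k i l, ?c l))) = 0" by simp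
  then have "(\<Sum>i<d ^ k. (\<Prod>l<k. cnj (W $$ (digits d k i l, ?c l))) * v $ i) = 0"
    by (simp add: cnj_sum mult.commute)
  moreover have "(tensor_power (mat_adjoint W) k *\<^sub>v v) $ c = (\<Sum>i<d ^ k. tensor_power (mat_adjoint W) k $$ (c, i) * v $ i)"
    using v c tensor_power_carrier[OF Wa, of k] by (simp add: scalar_prod_def atLeast0LessThan)
  ultimately show "(tensor_power (mat_adjoint W) k *\<^sub>v v) $ c = 0\<^sub>v (s ^ k) $ c"
    using c W by (simp add: tensor_power_index[OF Wa] digits_less)
qed (use tensor_power_carrier[of "mat_adjoint W" s d k] W in auto)

end

section \<open>Measurements with finitely many outcomes\<close>

definition finite_povm :: "nat \<Rightarrow> 'x set \<Rightarrow> ('x \<Rightarrow> complex mat) \<Rightarrow> bool" where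
  "finite_povm D X M \<longleftrightarrow> finite X \<and> (\<forall>x\<in>X. psd_mat D (M x)) \<and>
    (\<forall>i<D. \<forall>j<D. (\<Sum>x\<in>X. M x $$ (i, j)) = 1\<^sub>m D $$ (i, j))"

lemma psd_mat_carrier: "psd_mat n A \<Longrightarrow> A \<in> carrier_mat n n"
  by (simp add: psd_mat_def hermitian_mat_def)

lemma quantum_stateD:
  assumes "quantum_state d \<rho>"
  shows "\<rho> \<in> carrier_mat d d" "mat_adjoint \<rho> = \<rho>" "mat_trace \<rho> = 1" "psd_mat d \<rho>"
  using assms by (auto simp: quantum_state_def psd_mat_def hermitian_mat_def)

lemma mat_trace_tensor_power_state:
  assumes "quantum_state d \<rho>"
  shows "mat_trace (tensor_power \<rho> k) = 1"
  unfolding tensor_power_eq_tens using quantum_stateD[OF assms] by (subst mat_trace_tens[of _ _ d]) auto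

lemma triple_mult_index:
  assumes "S \<in> carrier_mat n n" "T \<in> carrier_mat n n" "S' \<in> carrier_mat n n" "i < n" "j < n"
  shows "(S * T * S') $$ (i, j) = (\<Sum>a<n. \<Sum>b<n. S $$ (i, a) * T $$ (a, b) * S' $$ (b, j))"
proof -
  have "(S * T * S') $$ (i, j) = (\<Sum>b<n. (\<Sum>a<n. S $$ (i, a) * T $$ (a, b)) * S' $$ (b, j))"
    unfolding index_mult_mat_sum[OF mult_carrier_square[OF assms(1,2)] assms(3-5)]
    by (intro sum.cong refl) (simp add: index_mult_mat_sum[OF assms(1,2,4)])
  also have "\<dots> = (\<Sum>a<n. \<Sum>b<n. S $$ (i, a) * T $$ (a, b) * S' $$ (b, j))"
    unfolding sum_distrib_right by (rule sum.swap)
  finally show ?thesis .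
qed

text \<open>The constants stand for \<open>c = s Tr O\<close>, \<open>t = Tr (O \<rho>)\<close>,
  \<open>b = s Tr (O^2)\<close> and \<open>u = Tr (O^2 \<rho>)\<close>; after centring by
  \<open>c\<close> all terms that contain it cancel.\<close>

lemma sum_combine_moments:
  fixes q o' :: "'x \<Rightarrow> real"
  assumes q: "(\<Sum>x\<in>X. q x) = 1" and o1: "(\<Sum>x\<in>X. q x * o' x) = c + k * t"
    and o2: "(\<Sum>x\<in>X. q x * (o' x)\<^sup>2) = c\<^sup>2 + 2 * k * c * t + k * (k - 1) * t\<^sup>2 + b + 2 * k * u" and k: "k > 0"
  shows "(\<Sum>x\<in>X. q x * ((o' x - c) / k)) = t"
    "(\<Sum>x\<in>X. q x * ((o' x - c) / k)\<^sup>2) = (1 - 1 / k) * t\<^sup>2 + b / k\<^sup>2 + 2 * u / k"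
proof -
  have "(\<Sum>x\<in>X. q x * ((o' x - c) / k)) = ((\<Sum>x\<in>X. q x * o' x) - c * (\<Sum>x\<in>X. q x)) / k"
    by (simp add: sum_subtractf sum_divide_distrib sum_distrib_left right_diff_distrib diff_divide_distrib mult_ac)
  then show "(\<Sum>x\<in>X. q x * ((o' x - c) / k)) = t" using q o1 k by simp
  have "(\<Sum>x\<in>X. q x * ((o' x - c) / k)\<^sup>2) = (\<Sum>x\<in>X. (q x * (o' x)\<^sup>2 - 2 * c * (q x * o' x) + c\<^sup>2 * q x) / k\<^sup>2)"
    by (intro sum.cong refl) (simp add: power_divide power2_diff algebra_simps)
  also have "\<dots> = ((\<Sum>x\<in>X. q x * (o' x)\<^sup>2) - 2 * c * (\<Sum>x\<in>X. q x * o' x) + c\<^sup>2 * (\<Sum>x\<in>X. q x)) / k\<^sup>2"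
    by (simp only: sum_divide_distrib[symmetric] sum.distrib sum_subtractf sum_distrib_left)
  also have "\<dots> = (k * (k - 1) * t\<^sup>2 + b + 2 * k * u) / k\<^sup>2"
    unfolding q o1 o2 by (rule arg_cong[where f = "\<lambda>x. x / k\<^sup>2"]) (simp add: power2_eq_square algebra_simps)
  also have "\<dots> = (1 - 1 / k) * t\<^sup>2 + b / k\<^sup>2 + 2 * u / k"
    using k by (simp add: field_simps power2_eq_square)
  finally show "(\<Sum>x\<in>X. q x * ((o' x - c) / k)\<^sup>2) = (1 - 1 / k) * t\<^sup>2 + b / k\<^sup>2 + 2 * u / k" .
qed

context gaussian_matrix
begin

lemma G_mat_hermitian: "hermitian_mat d (G_mat x)"
proof -
  have "mat_adjoint (G_mat x) = G_mat x"
    unfolding G_mat_gram using mat_adjoint_mult[of "V_mat x" d s "mat_adjoint (V_mat x)" d] by simp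
  then show ?thesis by (simp add: hermitian_mat_def)
qed

lemma obs_eq_trace:
  assumes "Ob \<in> carrier_mat d d"
  shows "obs (\<lambda>a b. Ob $$ (a, b)) x = mat_trace (G_mat x * Ob)"
  unfolding obs_def mat_trace_mult[OF G_mat_carrier assms]
  by (intro sum.cong refl) (simp add: G_mat_def mult.commute)

text \<open>A factorisation with inner dimension \<open>s\<close> writes \<open>\<rho>\<close> as a
  product ending in the adjoint of a \<open>d\<close> by \<open>s\<close> matrix \<open>W\<close>.
  The tensor power of that adjoint annihilates the columns of \<open>N\<close> because they lie in
  the kernel of the moment matrix.\<close>

lemma support_vanish:
  assumes k: "k \<le> K" and \<rho>: "quantum_state d \<rho>" and rank: "mat_rank d \<rho> \<le> s"
    and N: "N \<in> carrier_mat (d ^ k) (d ^ k)" and AN: "moment_mat k * N = 0\<^sub>m (d ^ k) (d ^ k)"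
  shows "tensor_power \<rho> k * N = 0\<^sub>m (d ^ k) (d ^ k)"
proof -
  note r = quantum_stateD[OF \<rho>]
  obtain W C where W: "W \<in> carrier_mat d s" and C: "C \<in> carrier_mat s d" and WC: "\<rho> = W * C"
    using rank_factorization[OF r(1) rank] by blast
  note Wa = mat_adjoint_carrier[OF W] and Ca = mat_adjoint_carrier[OF C]
  have "\<rho> = mat_adjoint C * mat_adjoint W" using r(2) mat_adjoint_mult[OF W C] WC by simp
  then have t: "tensor_power \<rho> k = tensor_power (mat_adjoint C) k * tensor_power (mat_adjoint W) k"
    using tensor_power_mult[OF Ca Wa] by simp
  note tW = tensor_power_carrier[OF Wa, of k] and tC = tensor_power_carrier[OF Ca, of k]
  have WN: "tensor_power (mat_adjoint W) k * N = 0\<^sub>m (s ^ k) (d ^ k)"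
  proof (rule mat_col_eqI)
    fix j assume "j < dim_col (0\<^sub>m (s ^ k) (d ^ k) :: complex mat)"
    then have j: "j < d ^ k" by simp
    have "moment_mat k *\<^sub>v col N j = col (moment_mat k * N) j" by (rule col_mult2[OF moment_mat_carrier N j, symmetric])
    then have "moment_mat k *\<^sub>v col N j = 0\<^sub>v (d ^ k)" unfolding AN using j by simp
    then have "tensor_power (mat_adjoint W) k *\<^sub>v col N j = 0\<^sub>v (s ^ k)"
      using carrier_matD(1)[OF N] by (intro moment_mat_kernel[OF k _ _ W] carrier_vecI) simp_all
    then show "col (tensor_power (mat_adjoint W) k * N) j = col (0\<^sub>m (s ^ k) (d ^ k)) j"
      using j by (simp add: col_mult2[OF tW N j])
  qed (use carrier_matD[OF tW] carrier_matD[OF N] in auto)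
  show ?thesis unfolding t assoc_mult_mat[OF tC tW N] WN
    using tC by simp
qed

text \<open>The effects \<open>M\<close> are built from the moment matrix alone; the state enters
  only in the analysis, through \<open>R = S \<rho>^\<otimes>k S\<close>, which satisfies the
  cancellation law required by \<open>first_moment\<close> and \<open>second_moment\<close>.\<close>

lemma batch_measurement_exists:
  assumes k: "Suc (Suc k) \<le> K" and k0: "0 < k"
  shows "\<exists>M g. finite_povm (d ^ k) X M \<and>
    (\<forall>\<rho> Ob. quantum_state d \<rho> \<and> mat_rank d \<rho> \<le> s \<and> hermitian_mat d Ob \<longrightarrow>
      (\<Sum>x\<in>X. Re (mat_trace (M x * tensor_power \<rho> k)) * g x Ob) = Re (mat_trace (Ob * \<rho>)) \<and>
      (\<Sum>x\<in>X. Re (mat_trace (M x * tensor_power \<rho> k)) * (g x Ob)\<^sup>2) = (1 - 1 / real k) * (Re (mat_trace (Ob * \<rho>)))\<^sup>2 +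
        real s * Re (mat_trace (Ob * Ob)) / (real k)\<^sup>2 + 2 * Re (mat_trace (Ob * Ob * \<rho>)) / real k)"
proof -
  let ?D = "d ^ k" and ?A = "moment_mat k"
  have kK: "k \<le> K" using k by simp
  note Ac = moment_mat_carrier[of k]
  obtain S where S: "hermitian_mat ?D S" and comm: "\<And>B. B \<in> carrier_mat ?D ?D \<Longrightarrow> B * ?A = ?A * B \<Longrightarrow> B * S = S * B"
    and psdN: "psd_mat ?D (1\<^sub>m ?D - S * ?A * S)" and AN: "?A * (1\<^sub>m ?D - S * ?A * S) = 0\<^sub>m ?D ?D"
    using pinv_sqrt_exists[OF psd_moment_mat[of k]] by blast
  note Sc = hermitian_matD(1,2)[OF S]
  define N where "N = 1\<^sub>m ?D - S * ?A * S"
  have Nc: "N \<in> carrier_mat ?D ?D" using psdN by (auto simp: N_def dest: psd_mat_carrier)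
  txt \<open>
    \<open>S\<close> is the square root of the pseudoinverse of the moment matrix. To complete the measurement,
    the projection \<open>N\<close> to its kernel is given to one outcome; states of rank at most \<open>s\<close> do not see it.
  \<close>
  obtain x0 where x0: "x0 \<in> X" using X_nonempty by blast
  let ?G = "\<lambda>x. tensor_power (G_mat x) k"
  have Gc: "?G x \<in> carrier_mat ?D ?D" for x by (rule tensor_power_carrier) simp
  define M0 where "M0 = (\<lambda>x. complex_of_real (p x) \<cdot>\<^sub>m (S * ?G x * S))"
  define M where "M = (\<lambda>x. M0 x + (if x = x0 then N else 0\<^sub>m ?D ?D))"
  have SGS: "S * ?G x * S \<in> carrier_mat ?D ?D" for x using Sc Gc by simp
  have M0c: "M0 x \<in> carrier_mat ?D ?D" for x using SGS by (simp add: M0_def)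
  have zero_psd: "psd_mat ?D (0\<^sub>m ?D ?D)"
  proof -
    have "complex_of_real 0 \<cdot>\<^sub>m N = 0\<^sub>m ?D ?D" using Nc by (intro eq_matI) auto
    then show ?thesis using psd_mat_smult[OF psdN, of 0] unfolding N_def[symmetric] by simp
  qed
  have psdM: "psd_mat ?D (M x)" if "x \<in> X" for x
  proof -
    let ?Y = "tensor_power (V_mat x) k"
    have Y: "?Y \<in> carrier_mat ?D (s ^ k)" by (rule tensor_power_carrier) simp
    note Ya = mat_adjoint_carrier[OF Y]
    have SY: "S * ?Y \<in> carrier_mat ?D (s ^ k)" using Sc Y by simp
    \<comment> \<open>\<open>?G x\<close> is itself a Gram matrix and \<open>S\<close> is Hermitian,
      so the effect is a Gram matrix up to the factor \<open>p x\<close>.\<close>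
    have "S * ?G x * S = S * ?Y * mat_adjoint (S * ?Y)"
      unfolding tensor_power_G_mat mat_adjoint_mult[OF Sc(1) Y] Sc(2)
        assoc_mult_mat[OF Sc(1) Y Ya, symmetric] by (rule assoc_mult_mat[OF SY Ya Sc(1)])
    then have "psd_mat ?D (M0 x)"
      unfolding M0_def using psd_mat_gram[OF SY] p_nonneg[OF that] by (simp add: psd_mat_smult)
    then show ?thesis unfolding M_def using psdN zero_psd by (auto simp: N_def intro!: psd_mat_add)
  qed
  have sumM0: "(\<Sum>x\<in>X. M0 x $$ (i, j)) = (S * ?A * S) $$ (i, j)" if ij: "i < ?D" "j < ?D" for i j
  proof -
    have "(\<Sum>x\<in>X. M0 x $$ (i, j)) = (\<Sum>x\<in>X. complex_of_real (p x) * (\<Sum>a<?D. \<Sum>b<?D. S $$ (i, a) * ?G x $$ (a, b) * S $$ (b, j)))"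
      unfolding M0_def using ij carrier_matD[OF SGS] by (simp add: triple_mult_index[OF Sc(1) Gc Sc(1)])
    also have "\<dots> = (\<Sum>x\<in>X. \<Sum>(a, b)\<in>{..<?D} \<times> {..<?D}. S $$ (i, a) * (complex_of_real (p x) * ?G x $$ (a, b)) * S $$ (b, j))"
      by (simp add: sum.cartesian_product[symmetric] sum_distrib_left mult_ac)
    also have "\<dots> = (\<Sum>(a, b)\<in>{..<?D} \<times> {..<?D}. \<Sum>x\<in>X. S $$ (i, a) * (complex_of_real (p x) * ?G x $$ (a, b)) * S $$ (b, j))"
      unfolding case_prod_unfold by (rule sum.swap)
    also have "\<dots> = (\<Sum>a<?D. \<Sum>b<?D. S $$ (i, a) * ?A $$ (a, b) * S $$ (b, j))"
      by (simp add: sum.cartesian_product[symmetric] moment_mat_index_sum sum_distrib_left sum_distrib_right)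
    finally show ?thesis unfolding triple_mult_index[OF Sc(1) Ac Sc(1) ij] .
  qed
  have sumM: "(\<Sum>x\<in>X. M x $$ (i, j)) = 1\<^sub>m ?D $$ (i, j)" if ij: "i < ?D" "j < ?D" for i j
  proof -
    have SASc: "S * ?A * S \<in> carrier_mat ?D ?D" using Sc Ac by simp
    have "(\<Sum>x\<in>X. M x $$ (i, j)) = (\<Sum>x\<in>X. M0 x $$ (i, j) + (if x = x0 then N $$ (i, j) else 0))"
      unfolding M_def using ij carrier_matD[OF M0c] carrier_matD[OF Nc] by (intro sum.cong refl) simp
    also have "\<dots> = (S * ?A * S) $$ (i, j) + N $$ (i, j)"
      using finite_X x0 by (simp add: sum.distrib sumM0[OF ij])
    also have "\<dots> = 1\<^sub>m ?D $$ (i, j)"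
      unfolding N_def using ij carrier_matD[OF SASc] by simp
    finally show ?thesis .
  qed
  have povm: "finite_povm ?D X M"
    unfolding finite_povm_def using finite_X psdM sumM by blast
  define g where "g = (\<lambda>x Ob. (Re (mat_trace (G_mat x * Ob)) - real s * Re (mat_trace Ob)) / real k)"
  have main: "(\<Sum>x\<in>X. Re (mat_trace (M x * tensor_power \<rho> k)) * g x Ob) = Re (mat_trace (Ob * \<rho>)) \<and>
      (\<Sum>x\<in>X. Re (mat_trace (M x * tensor_power \<rho> k)) * (g x Ob)\<^sup>2) = (1 - 1 / real k) * (Re (mat_trace (Ob * \<rho>)))\<^sup>2 +
        real s * Re (mat_trace (Ob * Ob)) / (real k)\<^sup>2 + 2 * Re (mat_trace (Ob * Ob * \<rho>)) / real k"
    if \<rho>: "quantum_state d \<rho>" and rank: "mat_rank d \<rho> \<le> s" and Ob: "hermitian_mat d Ob" for \<rho> Ob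
  proof -
    note r = quantum_stateD[OF \<rho>] and Oc = hermitian_matD(1)[OF Ob]
    define \<tau> where "\<tau> = tensor_power \<rho> k"
    have tc: "\<tau> \<in> carrier_mat ?D ?D" unfolding \<tau>_def by (rule tensor_power_carrier[OF r(1)])
    have tN: "\<tau> * N = 0\<^sub>m ?D ?D"
      unfolding \<tau>_def using support_vanish[OF kK \<rho> rank Nc] AN by (simp add: N_def)
    have tS: "\<tau> * S = S * \<tau>"
      by (rule comm[OF tc]) (unfold \<tau>_def, rule moment_mat_commute[OF kK r(1)])
    have AS: "?A * S = S * ?A" by (rule comm[OF Ac refl])
    have SAS: "S * ?A * S \<in> carrier_mat ?D ?D" using Sc Ac by simp
    have "\<tau> * (S * ?A * S) = \<tau>"
    proof -
      have "S * ?A * S = 1\<^sub>m ?D - N"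
        unfolding N_def using SAS by (intro eq_matI) auto
      then have "\<tau> * (S * ?A * S) = \<tau> * 1\<^sub>m ?D - \<tau> * N"
        by (simp only: mult_minus_distrib_mat[OF tc one_carrier_mat Nc])
      then show ?thesis using tc tN by (intro eq_matI) auto
    qed
    \<comment> \<open>Since \<open>S\<close> commutes with both \<open>\<tau>\<close> and the moment
      matrix, \<open>R A = \<tau> S A S\<close>, and \<open>S A S\<close> acts as the identity on
      \<open>\<tau>\<close>.\<close>
    define R where "R = S * \<tau> * S"
    have Rc: "R \<in> carrier_mat ?D ?D" using Sc tc by (simp add: R_def)
    have RA: "R * ?A = \<tau>"
    proof -
      have "R * ?A = \<tau> * (S * (S * ?A))"
        unfolding R_def tS[symmetric] using Sc tc Ac by (simp add: assoc_mult_square[of _ ?D])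
      also have "S * (S * ?A) = S * ?A * S"
        unfolding assoc_mult_square[OF Sc(1) Ac Sc(1)] AS ..
      finally show ?thesis using \<open>\<tau> * (S * ?A * S) = \<tau>\<close> by simp
    qed
    \<comment> \<open>Decodes a tuple to its basis number, so that the matrix \<open>R\<close>
      becomes the kernel \<open>R'\<close> on tuples that the moment lemmas expect.\<close>
    define und where "und = inv_into {..<?D} (digits d k)"
    have und: "und (digits d k i) = i" if "i < ?D" for i
      unfolding und_def using bij_betw_digits[of d k] that by (intro inv_into_f_f) (auto simp: bij_betw_def)
    define R' where "R' = (\<lambda>J I. R $$ (und J, und I))"
    have R'A: "(\<Sum>I\<in>tuples k d. R' J I * G_moment k I J') = (\<Prod>l<k. \<rho> $$ (J l, J' l))"
      if J: "J \<in> tuples k d" "J' \<in> tuples k d" for J J'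
    proof -
      obtain j j' where j: "j < ?D" "J = digits d k j" "j' < ?D" "J' = digits d k j'"
      proof -
        have "tuples k d = digits d k ` {..<?D}" using bij_betw_digits[of d k] by (simp add: bij_betw_def)
        then have "J \<in> digits d k ` {..<?D}" "J' \<in> digits d k ` {..<?D}" using J by simp_all
        then show ?thesis using that by blast
      qed
      have "(\<Sum>I\<in>tuples k d. R' J I * G_moment k I J') = (\<Sum>i<?D. R' J (digits d k i) * G_moment k (digits d k i) J')"
        by (rule sum_digits[symmetric])
      also have "\<dots> = (\<Sum>i<?D. R $$ (j, i) * ?A $$ (i, j'))"
        using j by (intro sum.cong refl) (simp add: R'_def und moment_mat_def)
      also have "\<dots> = \<tau> $$ (j, j')"
        unfolding index_mult_mat_sum[OF Rc Ac j(1,3), symmetric] RA ..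
      also have "\<dots> = (\<Prod>l<k. \<rho> $$ (J l, J' l))"
        unfolding \<tau>_def j(2,4) by (rule tensor_power_index[OF r(1) j(1,3)])
      finally show ?thesis .
    qed
    have tr: "kernel_trace d (\<lambda>a b. \<rho> $$ (a, b)) = 1"
      using r(1,3) by (simp add: kernel_trace_def mat_trace_def)
    let ?O = "\<lambda>a b. Ob $$ (a, b)"
    have trO: "kernel_trace d ?O = mat_trace Ob" using Oc by (simp add: kernel_trace_def mat_trace_def)
    have trm: "kernel_trace d (kernel_mult d (\<lambda>a b. B $$ (a, b)) (\<lambda>a b. C $$ (a, b))) = mat_trace (B * C)"
      if "B \<in> carrier_mat d d" "C \<in> carrier_mat d d" for B C
      using that by (simp add: kernel_trace_def kernel_mult_def mat_trace_mult[of _ d d])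
    have trOO: "kernel_trace d (kernel_mult d (kernel_mult d ?O ?O) (\<lambda>a b. \<rho> $$ (a, b))) = mat_trace (Ob * Ob * \<rho>)"
    proof -
      have "kernel_trace d (kernel_mult d (kernel_mult d ?O ?O) (\<lambda>a b. \<rho> $$ (a, b))) =
          kernel_trace d (kernel_mult d (\<lambda>a b. (Ob * Ob) $$ (a, b)) (\<lambda>a b. \<rho> $$ (a, b)))"
        unfolding kernel_trace_def kernel_mult_def using Oc by (intro sum.cong refl) (simp add: index_mult_mat_sum[of _ d d _ d])
      then show ?thesis using Oc r(1) by (simp add: trm)
    qed
    define q where "q = (\<lambda>x. Re (mat_trace (M x * \<tau>)))"
    have wq: "weight k R' x = mat_trace (M x * \<tau>)" if "x \<in> X" for x
    proof -
      have "weight k R' x = p x * (\<Sum>j<?D. \<Sum>i<?D. R' (digits d k j) (digits d k i) * (\<Prod>l<k. G x (digits d k i l) (digits d k j l)))"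
        unfolding weight_def by (simp only: sum_digits[symmetric])
      also have "\<dots> = p x * (\<Sum>j<?D. \<Sum>i<?D. R $$ (j, i) * ?G x $$ (i, j))"
        by (intro arg_cong2[where f = "(*)"] sum.cong refl) (simp_all add: R'_def und tensor_power_G_mat_index)
      also have "\<dots> = p x * mat_trace (R * ?G x)"
        unfolding mat_trace_mult[OF Rc Gc] ..
      also have "mat_trace (R * ?G x) = mat_trace (S * ?G x * S * \<tau>)"
      proof -
        have "mat_trace (R * ?G x) = mat_trace ((S * \<tau>) * (S * ?G x))"
          unfolding R_def using Sc tc Gc by (simp add: assoc_mult_square[of _ ?D])
        also have "\<dots> = mat_trace ((S * ?G x) * (S * \<tau>))"
          using Sc tc Gc by (intro mat_trace_comm[of _ ?D ?D]) simp_all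
        finally show ?thesis using Sc tc Gc by (simp add: assoc_mult_square[of _ ?D])
      qed
      also have "p x * mat_trace (S * ?G x * S * \<tau>) = mat_trace (M0 x * \<tau>)"
        unfolding mat_trace_mult[OF SGS tc] mat_trace_mult[OF M0c tc] sum_distrib_left
        using carrier_matD[OF SGS] by (intro sum.cong refl) (simp add: M0_def)
      \<comment> \<open>The projection \<open>N\<close> added at \<open>x0\<close> has probability
        zero in the state \<open>\<tau>\<close>, so the completed measurement has the weights of the
        incomplete one.\<close>
      also have "mat_trace (M0 x * \<tau>) = mat_trace (M x * \<tau>)"
      proof (cases "x = x0")
        case True
        have "mat_trace (N * \<tau>) = mat_trace (\<tau> * N)" using Nc tc by (intro mat_trace_comm[of _ ?D ?D]) simp_all
        also have "\<dots> = 0" unfolding tN by (simp add: mat_trace_def)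
        finally have "mat_trace (N * \<tau>) = 0" .
        then show ?thesis unfolding M_def using True M0c Nc tc
          by (simp add: add_mult_distrib_mat[OF M0c Nc tc] mat_trace_add[of _ ?D])
      next
        case False
        then show ?thesis unfolding M_def using M0c by simp
      qed
      finally show ?thesis .
    qed
    have q1: "(\<Sum>x\<in>X. q x) = 1"
    proof -
      have "(\<Sum>x\<in>X. mat_trace (M x * \<tau>)) = mat_trace (1\<^sub>m ?D * \<tau>)"
        using psdM sumM tc by (intro mat_trace_sum) (auto dest: psd_mat_carrier)
      also have "\<dots> = 1" using tc mat_trace_tensor_power_state[OF \<rho>] by (simp add: \<tau>_def)
      finally show ?thesis unfolding q_def by (metis Re_sum one_complex.simps(1))
    qed
    have Oreal: "Im (obs ?O x) = 0" for x
      unfolding obs_eq_trace[OF Oc] by (rule mat_trace_hermitian_real[OF G_mat_hermitian Ob])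
    have Treal: "Im (mat_trace Ob) = 0"
      using mat_trace_hermitian_real[OF Ob, of "1\<^sub>m d"] Oc by (simp add: hermitian_mat_def)
    have treal: "Im (mat_trace (Ob * \<rho>)) = 0"
      using mat_trace_hermitian_real[OF Ob, of \<rho>] r by (simp add: hermitian_mat_def)
    let ?T = "Re (mat_trace Ob)" and ?t = "Re (mat_trace (Ob * \<rho>))"
    have cT: "mat_trace Ob = complex_of_real ?T" and ct: "mat_trace (Ob * \<rho>) = complex_of_real ?t"
      using Treal treal by (simp_all add: complex_eq_iff)
    have co: "obs ?O x = complex_of_real (Re (obs ?O x))" for x using Oreal by (simp add: complex_eq_iff)
    have mom1: "(\<Sum>x\<in>X. weight k R' x * obs ?O x) =
        of_nat s * kernel_trace d ?O + of_nat k * kernel_trace d (kernel_mult d ?O (\<lambda>a b. \<rho> $$ (a, b)))"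
      by (rule first_moment[OF k tr]) (rule R'A)
    have mom2: "(\<Sum>x\<in>X. weight k R' x * (obs ?O x)\<^sup>2) = (of_nat s * kernel_trace d ?O)\<^sup>2 +
      2 * of_nat s * of_nat k * kernel_trace d ?O * kernel_trace d (kernel_mult d ?O (\<lambda>a b. \<rho> $$ (a, b))) +
      of_nat k * (of_nat k - 1) * (kernel_trace d (kernel_mult d ?O (\<lambda>a b. \<rho> $$ (a, b))))\<^sup>2 +
      of_nat s * kernel_trace d (kernel_mult d ?O ?O) + 2 * of_nat k * kernel_trace d (kernel_mult d (kernel_mult d ?O ?O) (\<lambda>a b. \<rho> $$ (a, b)))"
      by (rule second_moment[OF k tr]) (rule R'A)
    have fm: "(\<Sum>x\<in>X. q x * Re (obs ?O x)) = real s * ?T + real k * ?t"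
    proof -
      have "Re (weight k R' x * obs ?O x) = q x * Re (obs ?O x)" if "x \<in> X" for x
        using Oreal wq[OF that] by (simp add: q_def)
      then have "(\<Sum>x\<in>X. q x * Re (obs ?O x)) = Re (\<Sum>x\<in>X. weight k R' x * obs ?O x)" by (simp add: Re_sum)
      also have "\<dots> = Re (of_nat s * complex_of_real ?T + of_nat k * complex_of_real ?t)"
        unfolding mom1 trO trm[OF Oc r(1)] cT[symmetric] ct[symmetric] ..
      finally show ?thesis by simp
    qed
    have sm: "(\<Sum>x\<in>X. q x * (Re (obs ?O x))\<^sup>2) = (real s * ?T)\<^sup>2 + 2 * real k * (real s * ?T) * ?t +
        real k * (real k - 1) * ?t\<^sup>2 + real s * Re (mat_trace (Ob * Ob)) + 2 * real k * Re (mat_trace (Ob * Ob * \<rho>))"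
    proof -
      have "Re (weight k R' x * (obs ?O x)\<^sup>2) = q x * (Re (obs ?O x))\<^sup>2" if "x \<in> X" for x
        using Oreal wq[OF that] by (simp add: q_def power2_eq_square)
      then have "(\<Sum>x\<in>X. q x * (Re (obs ?O x))\<^sup>2) = Re (\<Sum>x\<in>X. weight k R' x * (obs ?O x)\<^sup>2)" by (simp add: Re_sum)
      also have "\<dots> = Re ((of_nat s * complex_of_real ?T)\<^sup>2 + 2 * of_nat s * of_nat k * complex_of_real ?T * complex_of_real ?t +
          of_nat k * (of_nat k - 1) * (complex_of_real ?t)\<^sup>2 + of_nat s * mat_trace (Ob * Ob) +
          2 * of_nat k * mat_trace (Ob * Ob * \<rho>))"
        unfolding mom2 trO trm[OF Oc r(1)] trm[OF Oc Oc] trOO cT[symmetric] ct[symmetric] ..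
      finally show ?thesis by (simp add: power2_eq_square algebra_simps)
    qed
    have gx: "g x Ob = (Re (obs ?O x) - real s * ?T) / real k" for x
      by (simp add: g_def obs_eq_trace[OF Oc])
    show ?thesis
      using sum_combine_moments[OF q1 fm sm] k0
      unfolding gx q_def \<tau>_def by simp
  qed
  show ?thesis using povm main by blast
qed

end

text \<open>Instance with \<open>s = r\<close> and moments up to order \<open>k + 2\<close>. Each
  outcome assigns to every matrix entry a pair that selects a radius and a phase.\<close>

lemma batch_measurement:
  assumes "0 < k"
  shows "\<exists>(X :: (nat \<times> nat \<Rightarrow> nat \<times> nat) set) M g. finite_povm (d ^ k) X M \<and>
    (\<forall>\<rho> Ob. quantum_state d \<rho> \<and> mat_rank d \<rho> \<le> r \<and> hermitian_mat d Ob \<longrightarrow>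
      (\<Sum>x\<in>X. Re (mat_trace (M x * tensor_power \<rho> k)) * g x Ob) = Re (mat_trace (Ob * \<rho>)) \<and>
      (\<Sum>x\<in>X. Re (mat_trace (M x * tensor_power \<rho> k)) * (g x Ob)\<^sup>2) = (1 - 1 / real k) * (Re (mat_trace (Ob * \<rho>)))\<^sup>2 +
        real r * Re (mat_trace (Ob * Ob)) / (real k)\<^sup>2 + 2 * Re (mat_trace (Ob * Ob * \<rho>)) / real k)"
proof -
  obtain X :: "(nat \<times> nat \<Rightarrow> nat \<times> nat) set" and p V
    where "gaussian_family ({..<d} \<times> {..<r}) (Suc (Suc k)) X p V"
    using gaussian_family_exists[of "{..<d} \<times> {..<r}" "Suc (Suc k)"] by auto
  then interpret gaussian_matrix d r "Suc (Suc k)" X p V by (simp add: gaussian_matrix_def)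
  show ?thesis using batch_measurement_exists[OF order_refl assms] by blast
qed

section \<open>Repetition and majority vote\<close>

definition born :: "('x \<Rightarrow> complex mat) \<Rightarrow> complex mat \<Rightarrow> 'x \<Rightarrow> real" where
  "born M \<rho> x = Re (mat_trace (M x * \<rho>))"

lemma finite_povmD:
  assumes "finite_povm D X M"
  shows "finite X" "\<And>x. x \<in> X \<Longrightarrow> psd_mat D (M x)" "\<And>x. x \<in> X \<Longrightarrow> M x \<in> carrier_mat D D"
    "\<And>i j. i < D \<Longrightarrow> j < D \<Longrightarrow> (\<Sum>x\<in>X. M x $$ (i, j)) = 1\<^sub>m D $$ (i, j)"
  using assms by (auto simp: finite_povm_def dest: psd_mat_carrier)

text \<open>In the eigenbasis of the state the trace is a combination of values of a nonnegative
  quadratic form with nonnegative weights.\<close>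

lemma born_nonneg:
  assumes "psd_mat n (M x)" "psd_mat n \<rho>"
  shows "0 \<le> born M \<rho> x"
proof -
  obtain U l where U: "unitary_mat n U" and \<rho>: "\<rho> = spectral_fun n U l" and l: "\<forall>i < n. 0 \<le> l i"
    using psd_spectral[OF assms(2)] by blast
  have uc: "col U k \<in> carrier_vec n" for k using unitary_matD(1)[OF U] by auto
  have "born M \<rho> x = (\<Sum>k<n. l k * Re ((M x *\<^sub>v col U k) \<bullet>c col U k))"
    unfolding born_def \<rho> mat_trace_spectral_fun[OF U psd_mat_carrier[OF assms(1)]] by simp
  also have "\<dots> \<ge> 0"
    using l assms(1) uc by (intro sum_nonneg mult_nonneg_nonneg) (auto simp: psd_mat_def)
  finally show ?thesis .
qed

lemma sum_born:
  assumes M: "finite_povm D X M" and \<rho>: "\<rho> \<in> carrier_mat D D" "mat_trace \<rho> = 1"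
  shows "(\<Sum>x\<in>X. born M \<rho> x) = 1"
proof -
  have "(\<Sum>x\<in>X. mat_trace (M x * \<rho>)) = mat_trace (1\<^sub>m D * \<rho>)"
    using finite_povmD[OF M] \<rho> by (intro mat_trace_sum) auto
  then have "(\<Sum>x\<in>X. mat_trace (M x * \<rho>)) = 1" using \<rho> by simp
  then have "Re (\<Sum>x\<in>X. mat_trace (M x * \<rho>)) = 1" by simp
  then show ?thesis by (simp add: born_def Re_sum)
qed

text \<open>The sum over product outcomes factorises entrywise into Kronecker deltas of the digits,
  and digits determine the basis number.\<close>

lemma finite_povm_power:
  assumes M: "finite_povm D X M"
  shows "finite_povm (D ^ N) (PiE {..<N} (\<lambda>_. X)) (\<lambda>x. tens (\<lambda>l. M (x l)) N)"
  unfolding finite_povm_def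
proof (intro conjI ballI allI impI)
  note m = finite_povmD[OF M]
  show "finite (PiE {..<N} (\<lambda>_. X))" using m(1) by (intro finite_PiE) auto
  show "psd_mat (D ^ N) (tens (\<lambda>l. M (x l)) N)" if "x \<in> PiE {..<N} (\<lambda>_. X)" for x
    using that m(2) by (intro psd_mat_tens) auto
  fix i j assume ij: "i < D ^ N" "j < D ^ N"
  let ?I = "digits D N i" and ?J = "digits D N j"
  have "(\<Sum>x\<in>PiE {..<N} (\<lambda>_. X). tens (\<lambda>l. M (x l)) N $$ (i, j)) =
      (\<Sum>x\<in>PiE {..<N} (\<lambda>_. X). \<Prod>l<N. M (x l) $$ (?I l, ?J l))"
    using m(3) ij by (intro sum.cong refl tens_index) auto
  also have "\<dots> = (\<Prod>l<N. \<Sum>x\<in>X. M x $$ (?I l, ?J l))"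
    using m(1) by (intro prod_sum_PiE[symmetric]) auto
  also have "\<dots> = (\<Prod>l<N. if ?I l = ?J l then 1 else 0)"
    using ij by (intro prod.cong refl) (simp add: m(4) digits_less)
  also have "\<dots> = 1\<^sub>m (D ^ N) $$ (i, j)"
  proof (cases "i = j")
    case True
    then show ?thesis using ij by simp
  next
    case False
    then have "\<not> (\<forall>l<N. digit D i l = digit D j l)" using digits_inj[OF ij] by blast
    then have "\<exists>l\<in>{..<N}. (if ?I l = ?J l then 1 else 0) = (0 :: complex)" by (auto simp: digits_def)
    then have "(\<Prod>l<N. if ?I l = ?J l then 1 else 0) = (0 :: complex)" by (intro prod_zero) simp_all
    then show ?thesis using False ij by simp
  qed
  finally show "(\<Sum>x\<in>PiE {..<N} (\<lambda>_. X). tens (\<lambda>l. M (x l)) N $$ (i, j)) = 1\<^sub>m (D ^ N) $$ (i, j)" .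
qed

text \<open>The trace of a tensor product factorises over the complex numbers; each factor is real
  since both matrices are Hermitian, which lets the real part pass through the product.\<close>

lemma born_power:
  assumes M: "finite_povm D X M" and \<rho>: "hermitian_mat D \<rho>" and x: "x \<in> PiE {..<N} (\<lambda>_. X)"
  shows "born (\<lambda>x. tens (\<lambda>l. M (x l)) N) (tensor_power \<rho> N) x = (\<Prod>l<N. born M \<rho> (x l))"
proof -
  note m = finite_povmD[OF M] and r = hermitian_matD(1)[OF \<rho>]
  have xl: "x l \<in> X" if "l < N" for l using x that by auto
  have "mat_trace (M (x l) * \<rho>) = complex_of_real (born M \<rho> (x l))" if "l < N" for l
    using mat_trace_hermitian_real[of D "M (x l)" \<rho>] m(2)[OF xl[OF that]] \<rho>
    by (simp add: complex_eq_iff born_def psd_mat_def)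
  then have "(\<Prod>l<N. mat_trace (M (x l) * \<rho>)) = complex_of_real (\<Prod>l<N. born M \<rho> (x l))" by simp
  moreover have "mat_trace (tens (\<lambda>l. M (x l)) N * tensor_power \<rho> N) = (\<Prod>l<N. mat_trace (M (x l) * \<rho>))"
    unfolding tensor_power_eq_tens using m(3) xl r
    by (subst tens_mult[of _ _ D D _ D], simp, simp) (intro mat_trace_tens[of _ _ D], simp)
  ultimately show ?thesis by (simp only: born_def Re_complex_of_real)
qed

section \<open>Concentration of averages and majority votes\<close>

lemma chebyshev_weights:
  fixes q g :: "'x \<Rightarrow> real"
  assumes "finite X" "\<And>x. x \<in> X \<Longrightarrow> 0 \<le> q x" "\<epsilon> > 0"
  shows "(\<Sum>x\<in>{x \<in> X. \<bar>g x - t\<bar> > \<epsilon>}. q x) \<le> (\<Sum>x\<in>X. q x * (g x - t)\<^sup>2) / \<epsilon>\<^sup>2"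
proof -
  have "\<epsilon>\<^sup>2 * (\<Sum>x\<in>{x \<in> X. \<bar>g x - t\<bar> > \<epsilon>}. q x) = (\<Sum>x\<in>{x \<in> X. \<bar>g x - t\<bar> > \<epsilon>}. q x * \<epsilon>\<^sup>2)"
    by (simp add: sum_distrib_left mult.commute)
  also have "\<dots> \<le> (\<Sum>x\<in>{x \<in> X. \<bar>g x - t\<bar> > \<epsilon>}. q x * (g x - t)\<^sup>2)"
    using assms by (intro sum_mono mult_left_mono) (auto simp: abs_le_square_iff[symmetric])
  also have "\<dots> \<le> (\<Sum>x\<in>X. q x * (g x - t)\<^sup>2)"
    using assms by (intro sum_mono2) auto
  finally show ?thesis using assms(3) by (simp add: pos_le_divide_eq mult.commute)
qed

text \<open>Centred summands at different places are independent with mean zero, so only the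
  diagonal of the expanded square survives.\<close>

lemma average_variance:
  fixes q g :: "'x \<Rightarrow> real"
  assumes X: "finite X" and q: "(\<Sum>x\<in>X. q x) = 1" and mean: "(\<Sum>x\<in>X. q x * g x) = t" and b: "0 < (b :: nat)"
  shows "(\<Sum>y\<in>PiE {..<b} (\<lambda>_. X). (\<Prod>l<b. q (y l)) * ((\<Sum>l<b. g (y l)) / b - t)\<^sup>2) =
    (\<Sum>x\<in>X. q x * (g x - t)\<^sup>2) / b"
proof -
  let ?Y = "PiE {..<b} (\<lambda>_. X)"
  define h where "h = (\<lambda>x. g x - t)"
  let ?V = "\<Sum>x\<in>X. q x * (h x)\<^sup>2"
  have h0: "(\<Sum>x\<in>X. q x * h x) = 0"
    using q mean by (simp add: h_def right_diff_distrib sum_subtractf sum_distrib_right[symmetric])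
  have cross: "(\<Sum>y\<in>?Y. (\<Prod>n<b. q (y n)) * (h (y l) * h (y m))) = (if l = m then ?V else 0)"
    if lm: "l < b" "m < b" for l m
  proof -
    let ?f = "\<lambda>n x. q x * ((if n = l then h x else 1) * (if n = m then h x else 1))"
    have "(\<Sum>y\<in>?Y. (\<Prod>n<b. q (y n)) * (h (y l) * h (y m))) = (\<Sum>y\<in>?Y. \<Prod>n<b. ?f n (y n))"
      using lm by (intro sum.cong refl) (simp add: prod.distrib)
    also have "\<dots> = (\<Prod>n<b. \<Sum>x\<in>X. ?f n x)" using X by (intro prod_sum_PiE[symmetric]) auto
    also have "\<dots> = (if l = m then ?V else 0)"
    proof (cases "l = m")
      case True
      have "(\<Prod>n<b. \<Sum>x\<in>X. ?f n x) = (\<Prod>n<b. if n = l then ?V else 1)"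
        using True q by (intro prod.cong refl) (auto simp: power2_eq_square)
      then show ?thesis using True lm by simp
    next
      case False
      have "(\<Sum>x\<in>X. ?f l x) = 0" using False h0 by simp
      with lm have "\<exists>n\<in>{..<b}. (\<Sum>x\<in>X. ?f n x) = 0" by blast
      then have "(\<Prod>n<b. \<Sum>x\<in>X. ?f n x) = 0" by (rule prod_zero[OF finite_lessThan])
      then show ?thesis using False by simp
    qed
    finally show ?thesis .
  qed
  have "(\<Sum>y\<in>?Y. (\<Prod>l<b. q (y l)) * ((\<Sum>l<b. g (y l)) / b - t)\<^sup>2) =
      (\<Sum>y\<in>?Y. (\<Sum>l<b. \<Sum>m<b. (\<Prod>n<b. q (y n)) * (h (y l) * h (y m))) / (real b)\<^sup>2)"
  proof (intro sum.cong refl)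
    fix y
    have e: "(\<Sum>l<b. g (y l)) / b - t = (\<Sum>l<b. h (y l)) / b"
      using b by (simp add: h_def sum_subtractf field_simps)
    have e2: "(\<Sum>l<b. h (y l)) * (\<Sum>m<b. h (y m)) = (\<Sum>l<b. \<Sum>m<b. h (y l) * h (y m))"
      by (rule sum_product)
    have e3: "(\<Prod>l<b. q (y l)) * ((\<Sum>l<b. g (y l)) / b - t)\<^sup>2 =
        (\<Prod>l<b. q (y l)) * ((\<Sum>l<b. h (y l)) * (\<Sum>m<b. h (y m))) / (real b)\<^sup>2"
      unfolding e by (simp add: power2_eq_square)
    show "(\<Prod>l<b. q (y l)) * ((\<Sum>l<b. g (y l)) / b - t)\<^sup>2 =
        (\<Sum>l<b. \<Sum>m<b. (\<Prod>n<b. q (y n)) * (h (y l) * h (y m))) / (real b)\<^sup>2"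
      unfolding e3 e2 by (simp only: sum_distrib_left)
  qed
  also have "\<dots> = (\<Sum>l<b. \<Sum>m<b. \<Sum>y\<in>?Y. (\<Prod>n<b. q (y n)) * (h (y l) * h (y m))) / (real b)\<^sup>2"
    unfolding sum_divide_distrib[symmetric]
    by (rule arg_cong[where f = "\<lambda>x. x / (real b)\<^sup>2"], subst sum.swap, rule sum.cong[OF refl], rule sum.swap)
  also have "\<dots> = (\<Sum>l<b. \<Sum>m<b. if l = m then ?V else 0) / (real b)\<^sup>2"
    by (rule arg_cong[where f = "\<lambda>x. x / (real b)\<^sup>2"], intro sum.cong refl cross) auto
  also have "\<dots> = ?V / b" using b by (simp add: power2_eq_square)
  finally show ?thesis by (simp add: h_def)
qed

text \<open>Markov's inequality for the product that has a factor \<open>4\<close> for each bad and \<open>1/4\<close> for each good outcome.\<close>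

lemma majority_failure:
  fixes q :: "'y \<Rightarrow> real"
  assumes Y: "finite Y" "\<And>y. y \<in> Y \<Longrightarrow> 0 \<le> q y" "(\<Sum>y\<in>Y. q y) = 1"
    and bad: "(\<Sum>y\<in>{y \<in> Y. Bad y}. q y) \<le> 1 / 16"
  shows "(\<Sum>z\<in>{z \<in> PiE {..<L} (\<lambda>_. Y). L \<le> 2 * card {l \<in> {..<L}. Bad (z l)}}. \<Prod>l<L. q (z l)) \<le> (1 / 2) ^ L"
proof -
  let ?Z = "PiE {..<L} (\<lambda>_. Y)"
  let ?c = "\<lambda>y. if Bad y then 4 else 1 / 4 :: real"
  have fin: "finite ?Z" using Y(1) by (intro finite_PiE) auto
  have q0: "0 \<le> (\<Prod>l<L. q (z l))" if "z \<in> ?Z" for z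
    using that Y(2) by (intro prod_nonneg) auto
  \<comment> \<open>If at least half of the outcomes are bad, the factors 4 balance the factors 1/4,
    so the product dominates the indicator of failure.\<close>
  have c: "1 \<le> (\<Prod>l<L. ?c (z l))" if "L \<le> 2 * card {l \<in> {..<L}. Bad (z l)}" for z
  proof -
    let ?B = "{l \<in> {..<L}. Bad (z l)}" and ?G = "{l \<in> {..<L}. \<not> Bad (z l)}"
    have "card ?B + card ?G = card (?B \<union> ?G)" by (rule card_Un_disjoint[symmetric]) auto
    also have "?B \<union> ?G = {..<L}" by auto
    finally have "card ?G \<le> card ?B" using that by simp
    then have "(1 / 4 :: real) ^ card ?B \<le> (1 / 4) ^ card ?G" by (intro power_decreasing) auto
    then have "4 ^ card ?B * (1 / 4 :: real) ^ card ?B \<le> 4 ^ card ?B * (1 / 4) ^ card ?G"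
      by (intro mult_left_mono) auto
    moreover have "4 ^ card ?B * (1 / 4 :: real) ^ card ?B = 1"
      by (simp flip: power_mult_distrib)
    moreover have "(\<Prod>l<L. ?c (z l)) = 4 ^ card ?B * (1 / 4) ^ card ?G"
    proof -
      have "{..<L} \<inter> {l. Bad (z l)} = ?B" "{..<L} \<inter> - {l. Bad (z l)} = ?G" by auto
      then show ?thesis by (subst prod.If_cases) (simp_all only: finite_lessThan prod_constant)
    qed
    ultimately show ?thesis by linarith
  qed
  have "(\<Sum>z\<in>{z \<in> ?Z. L \<le> 2 * card {l \<in> {..<L}. Bad (z l)}}. \<Prod>l<L. q (z l)) \<le>
      (\<Sum>z\<in>{z \<in> ?Z. L \<le> 2 * card {l \<in> {..<L}. Bad (z l)}}. (\<Prod>l<L. q (z l)) * (\<Prod>l<L. ?c (z l)))"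
  proof (intro sum_mono)
    fix z assume z: "z \<in> {z \<in> ?Z. L \<le> 2 * card {l \<in> {..<L}. Bad (z l)}}"
    have "(\<Prod>l<L. q (z l)) * 1 \<le> (\<Prod>l<L. q (z l)) * (\<Prod>l<L. ?c (z l))"
      by (intro mult_left_mono c q0) (use z in simp_all)
    then show "(\<Prod>l<L. q (z l)) \<le> (\<Prod>l<L. q (z l)) * (\<Prod>l<L. ?c (z l))" by simp
  qed
  also have "\<dots> \<le> (\<Sum>z\<in>?Z. (\<Prod>l<L. q (z l)) * (\<Prod>l<L. ?c (z l)))"
  proof (rule sum_mono2[OF fin])
    fix z assume "z \<in> ?Z - {z \<in> ?Z. L \<le> 2 * card {l \<in> {..<L}. Bad (z l)}}"
    then have "z \<in> ?Z" by simp
    then show "0 \<le> (\<Prod>l<L. q (z l)) * (\<Prod>l<L. ?c (z l))"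
      by (rule mult_nonneg_nonneg[OF q0 prod_nonneg]) simp
  qed simp
  also have "\<dots> = (\<Prod>l<L. \<Sum>y\<in>Y. q y * ?c y)"
    unfolding prod.distrib[symmetric] using Y(1) by (intro prod_sum_PiE[symmetric]) auto
  also have "\<dots> \<le> (1 / 2) ^ L"
  proof -
    \<comment> \<open>The mean of one factor is \<open>1/4 + 15/4 P(Bad)\<close>, at most
      \<open>31/64\<close> when bad outcomes have probability at most \<open>1/16\<close>.\<close>
    have "(\<Sum>y\<in>Y. q y * ?c y) = (\<Sum>y\<in>Y. q y / 4 + (if Bad y then 15 / 4 * q y else 0))"
      by (intro sum.cong) auto
    also have "\<dots> = (\<Sum>y\<in>Y. q y) / 4 + 15 / 4 * (\<Sum>y\<in>{y \<in> Y. Bad y}. q y)"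
    proof -
      have "(\<Sum>y\<in>Y. if Bad y then 15 / 4 * q y else 0) = 15 / 4 * (\<Sum>y\<in>{y \<in> Y. Bad y}. q y)"
        unfolding sum_distrib_left by (rule sum.inter_filter[OF Y(1), symmetric])
      then show ?thesis by (simp only: sum.distrib sum_divide_distrib)
    qed
    also have "\<dots> \<le> 1 / 2" using bad Y(3) by simp
    finally have "(\<Sum>y\<in>Y. q y * ?c y) \<le> 1 / 2" .
    moreover have "0 \<le> (\<Sum>y\<in>Y. q y * ?c y)" using Y(2) by (intro sum_nonneg) auto
    ultimately show ?thesis by (simp add: power_mono)
  qed
  finally show ?thesis .
qed

text \<open>Outcomes are numbered and stored as constant sequences, with every set of records
  measurable, so any post-processing and any success event is admissible. The law is stated for an
  arbitrary predicate \<open>P\<close> on estimate functions, because the observables are chosen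
  after the record.\<close>

lemma shadow_of_finite_povm:
  assumes Z: "finite_povm D (Z :: 'z set) M"
  shows "\<exists>(\<Omega> :: shadow measure) Q E. povm D \<Omega> Q \<and> post_processing d \<Omega> E \<and>
    (\<forall>\<sigma> P. psd_mat D \<sigma> \<longrightarrow> measure (outcome_law \<Omega> Q \<sigma>) {s \<in> space \<Omega>. P (E s)} =
      (\<Sum>z\<in>{z \<in> Z. P (est z)}. born M \<sigma> z))"
proof -
  note m = finite_povmD[OF Z]
  obtain e :: "'z \<Rightarrow> nat" where e: "inj_on e Z" using m(1) finite_imp_inj_to_nat_seg by blast
  define h :: "'z \<Rightarrow> shadow" where "h = (\<lambda>z _. real (e z))"
  have h: "inj_on h Z" using e by (auto simp: inj_on_def h_def fun_eq_iff)
  define Q where "Q = (\<lambda>S. mat D D (\<lambda>ij. \<Sum>z\<in>{z \<in> Z. h z \<in> S}. M z $$ ij))"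
  define \<Omega> where "\<Omega> = count_space (h ` Z)"
  define E where "E = (\<lambda>s. est (inv_into Z h s))"
  have inv: "inv_into Z h (h z) = z" if "z \<in> Z" for z using that h by simp
  have povm: "povm D \<Omega> Q"
    unfolding povm_def
  proof (intro conjI ballI allI impI)
    show "psd_mat D (Q A)" for A
      unfolding Q_def using m(1,2) by (intro psd_mat_sum) auto
    have "{z \<in> Z. h z \<in> h ` Z} = Z" by auto
    then show "Q (space \<Omega>) = 1\<^sub>m D"
      unfolding Q_def \<Omega>_def using m(4) by (intro eq_matI) auto
    fix A :: "nat \<Rightarrow> shadow set" and i j
    assume disj: "disjoint_family A" and ij: "i < D" "j < D"
    \<comment> \<open>By disjointness each outcome lies in at most one of the events, so its series
      has at most one nonzero term.\<close>
    have s: "(\<lambda>k. if h z \<in> A k then M z $$ (i, j) else 0) sums (if h z \<in> (\<Union>k. A k) then M z $$ (i, j) else 0)" for z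
    proof (cases "h z \<in> (\<Union>k. A k)")
      case True
      then obtain k where k: "h z \<in> A k" by blast
      then have "(h z \<in> A k') = (k' = k)" for k'
        using disj by (auto simp: disjoint_family_on_def)
      then show ?thesis using True sums_single[of k "\<lambda>_. M z $$ (i, j)"] by simp
    qed auto
    have "(\<lambda>k. \<Sum>z\<in>Z. if h z \<in> A k then M z $$ (i, j) else 0) sums
        (\<Sum>z\<in>Z. if h z \<in> (\<Union>k. A k) then M z $$ (i, j) else 0)"
      by (rule sums_sum) (rule s)
    then show "(\<lambda>k. Q (A k) $$ (i, j)) sums (Q (\<Union>k. A k) $$ (i, j))"
      unfolding Q_def using ij by (simp add: sum.inter_filter[OF m(1)])
  qed
  have post: "post_processing d \<Omega> E"
    by (simp add: post_processing_def \<Omega>_def)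
  have law: "measure (outcome_law \<Omega> Q \<sigma>) {s \<in> space \<Omega>. P (E s)} = (\<Sum>z\<in>{z \<in> Z. P (est z)}. born M \<sigma> z)"
    if \<sigma>: "psd_mat D \<sigma>" for \<sigma> P
  proof -
    have pos: "0 \<le> born M \<sigma> z" if "z \<in> Z" for z using born_nonneg[of D M z \<sigma>, OF m(2)[OF that] \<sigma>] .
    have tr: "Re (mat_trace (Q S * \<sigma>)) = (\<Sum>z\<in>{z \<in> Z. h z \<in> S}. born M \<sigma> z)" for S
    proof -
      have "(\<Sum>z\<in>{z \<in> Z. h z \<in> S}. mat_trace (M z * \<sigma>)) = mat_trace (Q S * \<sigma>)"
        using m(3) psd_mat_carrier[OF \<sigma>] by (intro mat_trace_sum) (auto simp: Q_def)
      from this[symmetric] show ?thesis by (simp add: born_def Re_sum)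
    qed
    \<comment> \<open>\<open>measure_of\<close> takes over the prescribed values only when they form
      a measure. Agreement with a point measure on all events supplies countable additivity.\<close>
    define pm where "pm = point_measure (h ` Z) (\<lambda>s. ennreal (born M \<sigma> (inv_into Z h s)))"
    have sp: "space pm = h ` Z" "sets pm = Pow (h ` Z)"
      by (simp_all add: pm_def space_point_measure sets_point_measure)
    have em: "emeasure pm S = ennreal (\<Sum>z\<in>{z \<in> Z. h z \<in> S}. born M \<sigma> z)" if S: "S \<subseteq> h ` Z" for S
    proof -
      have "emeasure pm S = (\<Sum>s\<in>S. ennreal (born M \<sigma> (inv_into Z h s)))"
        unfolding pm_def using m(1) S by (intro emeasure_point_measure_finite) auto
      also have "\<dots> = (\<Sum>z\<in>{z \<in> Z. h z \<in> S}. ennreal (born M \<sigma> (inv_into Z h (h z))))"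
      proof (rule sum.reindex_bij_betw[symmetric])
        show "bij_betw h {z \<in> Z. h z \<in> S} S"
          unfolding bij_betw_def using S by (auto intro: inj_on_subset[OF h])
      qed
      also have "\<dots> = (\<Sum>z\<in>{z \<in> Z. h z \<in> S}. ennreal (born M \<sigma> z))"
        by (intro sum.cong refl) (simp add: inv)
      also have "\<dots> = ennreal (\<Sum>z\<in>{z \<in> Z. h z \<in> S}. born M \<sigma> z)"
        using pos by (intro sum_ennreal) auto
      finally show ?thesis .
    qed
    have "outcome_law \<Omega> Q \<sigma> = measure_of (h ` Z) (Pow (h ` Z)) (emeasure pm)"
      unfolding outcome_law_def \<Omega>_def space_count_space sets_count_space tr
    proof (rule measure_of_eq[OF order_refl])
      fix S assume "S \<in> sigma_sets (h ` Z) (Pow (h ` Z))"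
      then have "S \<subseteq> h ` Z" by (rule sigma_sets_into_sp[OF order_refl])
      then show "ennreal (\<Sum>z\<in>{z \<in> Z. h z \<in> S}. born M \<sigma> z) = emeasure pm S" by (simp add: em)
    qed
    also have "\<dots> = pm" using measure_of_of_measure[of pm] by (simp add: sp)
    finally have ol: "outcome_law \<Omega> Q \<sigma> = pm" .
    have "h z \<in> {s \<in> h ` Z. P (E s)} \<longleftrightarrow> P (est z)" if "z \<in> Z" for z
      using that by (simp add: E_def inv)
    then have set: "{z \<in> Z. h z \<in> {s \<in> h ` Z. P (E s)}} = {z \<in> Z. P (est z)}" by blast
    have sp': "{s \<in> space \<Omega>. P (E s)} = {s \<in> h ` Z. P (E s)}" by (simp add: \<Omega>_def)
    have emP: "emeasure pm {s \<in> space \<Omega>. P (E s)} = ennreal (\<Sum>z\<in>{z \<in> Z. P (est z)}. born M \<sigma> z)"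
      unfolding sp' using em[of "{s \<in> h ` Z. P (E s)}"] unfolding set by blast
    show ?thesis unfolding ol measure_def emP
      by (rule enn2real_ennreal) (auto intro!: sum_nonneg pos)
  qed
  show ?thesis using povm post law by blast
qed

text \<open>
  A batch estimate has variance at most \<open>3 \<beta>\<close>, so the average of \<open>b\<close> of them misses by more than
  \<open>\<epsilon> / 2\<close> with probability at most \<open>12 \<beta> / (b \<epsilon>\<^sup>2) \<le> 1 / 16\<close>, and a majority of \<open>L\<close> averages
  is wrong with probability at most \<open>2\<^sup>-\<^sup>L \<le> 1 / (3 M)\<close>.
\<close>

lemma sample_count_bound:
  fixes r M :: nat and \<epsilon> B \<beta> :: real
  assumes r: "1 \<le> r" and M: "1 \<le> M" and \<epsilon>: "\<epsilon> > 0" and B: "B > 0"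
    and \<beta>: "\<beta> \<le> 1" "\<beta> \<le> B" "\<epsilon>\<^sup>2 < \<beta>"
  shows "\<exists>k b L :: nat. 0 < k \<and> 0 < b \<and> r * B / (real k)\<^sup>2 \<le> \<beta> \<and> 192 * \<beta> / \<epsilon>\<^sup>2 \<le> b \<and> 3 * real M \<le> 2 ^ L \<and>
    real (k * b * L) \<le> 2000 * sqrt (r * B) / \<epsilon>\<^sup>2 * ln (real M + 1)"
proof -
  have \<epsilon>2: "0 < \<epsilon>\<^sup>2" using \<epsilon> by simp
  have \<beta>0: "0 < \<beta>" using \<beta>(3) \<epsilon>2 by linarith
  \<comment> \<open>The unrounded batch size, chosen to make \<open>r B / s^2\<close> equal to
    \<open>\<beta>\<close>. As \<open>\<beta> \<le> B\<close> and \<open>1 \<le> r\<close>, it is at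
    least 1, so rounding up at most doubles it.\<close>
  define s where "s = sqrt (r * B / \<beta>)"
  have "1 \<le> r * B / \<beta>"
    using r B \<beta>(2) \<beta>0 mult_mono[of 1 "real r" \<beta> B] by (simp add: pos_le_divide_eq)
  then have s1: "1 \<le> s" by (simp add: s_def)
  have s2: "s\<^sup>2 = r * B / \<beta>" using B \<beta>0 by (simp add: s_def)
  define k where "k = nat \<lceil>s\<rceil>"
  define b where "b = nat \<lceil>192 * \<beta> / \<epsilon>\<^sup>2\<rceil>"
  define L where "L = nat \<lceil>log 2 (3 * M)\<rceil>"
  \<comment> \<open>This absorbs the \<open>+ 1\<close> from rounding up the number of averaged
    batches: 192 becomes 193.\<close>
  have q1: "1 \<le> \<beta> / \<epsilon>\<^sup>2" using \<beta>(3) \<epsilon>2 by (simp add: pos_le_divide_eq)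
  have lg: "0 \<le> log 2 (3 * M)" using M by simp
  have k: "s \<le> k" "k \<le> s + 1" using s1 unfolding k_def by linarith+
  have b: "192 * \<beta> / \<epsilon>\<^sup>2 \<le> b" "b \<le> 192 * \<beta> / \<epsilon>\<^sup>2 + 1" using q1 unfolding b_def by linarith+
  have L: "log 2 (3 * M) \<le> L" "L \<le> log 2 (3 * M) + 1" using lg unfolding L_def by linarith+
  have "0 < k" "0 < b" using k b s1 q1 by (auto intro: Nat.gr0I)
  moreover have "r * B / (real k)\<^sup>2 \<le> \<beta>"
  proof -
    have "s\<^sup>2 \<le> (real k)\<^sup>2" using k s1 by (intro power_mono) auto
    then have "r * B \<le> \<beta> * (real k)\<^sup>2" unfolding s2 using \<beta>0 by (simp add: pos_divide_le_eq mult.commute)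
    then show ?thesis using \<open>0 < k\<close> by (simp add: pos_divide_le_eq)
  qed
  moreover have "3 * real M \<le> 2 ^ L"
  proof -
    have "3 * real M = 2 powr (log 2 (3 * M))" using M by simp
    also have "\<dots> \<le> 2 powr L" using L by (intro powr_mono) auto
    finally show ?thesis by (simp add: powr_realpow)
  qed
  moreover have "real (k * b * L) \<le> 2000 * sqrt (r * B) / \<epsilon>\<^sup>2 * ln (real M + 1)"
  proof -
    have l0: "0 \<le> ln (real M + 1)" by simp
    \<comment> \<open>The vote count has to be compared with \<open>ln (M + 1)\<close>, also at
      \<open>M = 1\<close>: \<open>6 M \<le> (M + 1)^3\<close> absorbs the rounding, and
      \<open>ln 2 \<ge> 2/3\<close> gives the factor 4.5.\<close>
    have "L \<le> log 2 (6 * M)" using L(2) M log_mult[of 2 "3 * real M" 2] by (simp add: mult.commute)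
    also have "\<dots> \<le> log 2 ((real M + 1) ^ 3)"
    proof -
      have "0 \<le> (real M)\<^sup>2 * real M" by simp
      moreover have "real M \<le> (real M)\<^sup>2" using M by (simp add: power2_eq_square)
      ultimately have "6 * real M \<le> (real M)\<^sup>2 * real M + 3 * (real M)\<^sup>2 + 3 * real M + 1" by linarith
      also have "\<dots> = (real M + 1) ^ 3" by (simp add: power2_eq_square power3_eq_cube algebra_simps)
      finally show ?thesis using M by (subst log_le_cancel_iff) auto
    qed
    also have "\<dots> = 3 * (ln (real M + 1) / ln 2)" by (subst log_nat_power) (simp_all add: log_def)
    also have "\<dots> \<le> 3 * (ln (real M + 1) / (2 / 3))"
      using ln2_ge_two_thirds l0 by (intro mult_left_mono divide_left_mono) auto
    finally have L': "L \<le> 4.5 * ln (real M + 1)" by simp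
    have "b \<le> 193 * (\<beta> / \<epsilon>\<^sup>2)" using b q1 by simp
    moreover have "k \<le> 2 * s" using k s1 by simp
    ultimately have "real k * b \<le> (2 * s) * (193 * (\<beta> / \<epsilon>\<^sup>2))" using s1 by (intro mult_mono) auto
    also have "\<dots> = 386 / \<epsilon>\<^sup>2 * (s * \<beta>)" by simp
    \<comment> \<open>\<open>s \<beta>\<close> equals \<open>sqrt (r B \<beta>)\<close>, and
      \<open>\<beta> \<le> 1\<close> removes the last factor; 386 is twice 193.\<close>
    also have "\<dots> \<le> 386 / \<epsilon>\<^sup>2 * sqrt (r * B)"
    proof (rule mult_left_mono)
      have "s * \<beta> = sqrt (r * B) * sqrt \<beta>"
        unfolding s_def using \<beta>0 by (simp add: real_sqrt_divide real_div_sqrt) (simp add: field_simps)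
      also have "\<dots> \<le> sqrt (r * B) * 1" using \<beta> B \<beta>0 by (intro mult_left_mono) auto
      finally show "s * \<beta> \<le> sqrt (r * B)" by simp
    qed (use \<epsilon> in auto)
    finally have kb: "real k * b \<le> 386 / \<epsilon>\<^sup>2 * sqrt (r * B)" .
    have "real k * b * L \<le> (386 / \<epsilon>\<^sup>2 * sqrt (r * B)) * (4.5 * ln (real M + 1))"
      by (rule mult_mono[OF kb L']) (use B in auto)
    \<comment> \<open>1737 is 386 times 4.5; the constant 2000 rounds it up.\<close>
    also have "\<dots> = 1737 * (sqrt (r * B) / \<epsilon>\<^sup>2 * ln (real M + 1))" by simp
    also have "\<dots> \<le> 2000 * (sqrt (r * B) / \<epsilon>\<^sup>2 * ln (real M + 1))"
      using B l0 by (intro mult_right_mono mult_nonneg_nonneg divide_nonneg_nonneg) auto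
    finally show ?thesis by simp
  qed
  ultimately show ?thesis using b(1) by blast
qed

text \<open>Two values that are each within \<open>\<delta>\<close> of more than half of the
  \<open>u l\<close> have one of these in common, so they differ by at most
  \<open>2 \<delta>\<close>. The choice itself does not refer to \<open>t\<close>.\<close>

lemma majority_consensus:
  fixes u :: "nat \<Rightarrow> real"
  assumes "L < 2 * card {l \<in> {..<L}. \<bar>u l - t\<bar> \<le> \<delta>}"
  shows "\<bar>(SOME v. L < 2 * card {l \<in> {..<L}. \<bar>u l - v\<bar> \<le> \<delta>}) - t\<bar> \<le> 2 * \<delta>"
proof -
  let ?S = "\<lambda>v. {l \<in> {..<L}. \<bar>u l - v\<bar> \<le> \<delta>}"
  define v where "v = (SOME v. L < 2 * card (?S v))"
  have v: "L < 2 * card (?S v)" unfolding v_def using assms by (rule someI)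
  have "?S v \<inter> ?S t \<noteq> {}"
  proof
    assume "?S v \<inter> ?S t = {}"
    then have "card (?S v) + card (?S t) = card (?S v \<union> ?S t)" by (intro card_Un_disjoint[symmetric]) auto
    also have "\<dots> \<le> card {..<L}" by (rule card_mono) auto
    finally show False using v assms by simp
  qed
  then obtain l where "\<bar>u l - v\<bar> \<le> \<delta>" "\<bar>u l - t\<bar> \<le> \<delta>" by blast
  then show ?thesis unfolding v_def[symmetric] by linarith
qed

text \<open>The success weight is compared pointwise: outside \<open>Good\<close> at least one
  failure contributes the full weight \<open>q z\<close>.\<close>

lemma union_bound_weights:
  fixes q :: "'z \<Rightarrow> real" and \<delta> :: real
  assumes Z: "finite Z" "\<And>z. z \<in> Z \<Longrightarrow> 0 \<le> q z" "(\<Sum>z\<in>Z. q z) = 1" and I: "finite I"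
    and fail: "\<And>i. i \<in> I \<Longrightarrow> (\<Sum>z\<in>{z \<in> Z. Fail i z}. q z) \<le> \<delta>"
    and good: "\<And>z. z \<in> Z \<Longrightarrow> (\<And>i. i \<in> I \<Longrightarrow> \<not> Fail i z) \<Longrightarrow> Good z"
  shows "1 - card I * \<delta> \<le> (\<Sum>z\<in>{z \<in> Z. Good z}. q z)"
proof -
  have "1 - card I * \<delta> \<le> 1 - (\<Sum>i\<in>I. \<Sum>z\<in>{z \<in> Z. Fail i z}. q z)"
    using sum_mono[of I "\<lambda>i. \<Sum>z\<in>{z \<in> Z. Fail i z}. q z" "\<lambda>_. \<delta>", OF fail] by simp
  also have "\<dots> = (\<Sum>z\<in>Z. q z - (\<Sum>i\<in>I. if Fail i z then q z else 0))"
  proof -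
    have "(\<Sum>i\<in>I. \<Sum>z\<in>{z \<in> Z. Fail i z}. q z) = (\<Sum>z\<in>Z. \<Sum>i\<in>I. if Fail i z then q z else 0)"
      unfolding sum.inter_filter[OF Z(1)] by (rule sum.swap)
    then show ?thesis using Z(3) by (simp only: sum_subtractf)
  qed
  also have "\<dots> \<le> (\<Sum>z\<in>Z. if Good z then q z else 0)"
  proof (rule sum_mono)
    fix z assume z: "z \<in> Z"
    have nn: "0 \<le> (\<Sum>i\<in>I. if Fail i z then q z else 0)" using Z(2)[OF z] by (intro sum_nonneg) auto
    show "q z - (\<Sum>i\<in>I. if Fail i z then q z else 0) \<le> (if Good z then q z else 0)"
    proof (cases "Good z")
      case True
      then show ?thesis using nn by simp
    next
      case False
      then obtain i where i: "i \<in> I" "Fail i z" using good[OF z] by blast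
      have "(if Fail i z then q z else 0) \<le> (\<Sum>i\<in>I. if Fail i z then q z else 0)"
        using i(1) I Z(2)[OF z] by (intro member_le_sum) auto
      then show ?thesis using False i(2) by simp
    qed
  qed
  also have "\<dots> = (\<Sum>z\<in>{z \<in> Z. Good z}. q z)" by (rule sum.inter_filter[OF Z(1), symmetric])
  finally show ?thesis .
qed

text \<open>No copies are measured: the tensor power is one-dimensional, there is a single outcome,
  and the estimate is constantly 0. This serves the case in which all expectations are at most
  \<open>\<epsilon>\<close> in absolute value.\<close>

lemma trivial_shadow:
  fixes d :: nat
  shows "\<exists>(\<Omega> :: shadow measure) Q E. povm (d ^ 0) \<Omega> Q \<and> post_processing d \<Omega> E \<and>
    (\<forall>\<rho> Ob. quantum_state d \<rho> \<and> mat_rank d \<rho> \<le> r \<and>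
      (\<forall>i \<in> {1..M}. \<bar>Re (mat_trace (Ob i * \<rho>))\<bar> \<le> \<epsilon>) \<longrightarrow>
      measure (outcome_law \<Omega> Q (tensor_power \<rho> 0))
        {s \<in> space \<Omega>. \<forall>i \<in> {1..M}. \<bar>E s (Ob i) - Re (mat_trace (Ob i * \<rho>))\<bar> \<le> \<epsilon>} \<ge> 2 / 3)"
proof -
  have psd1: "psd_mat 1 (1\<^sub>m 1)"
    using psd_mat_gram[of "1\<^sub>m 1" 1 1] by simp
  then have "finite_povm (d ^ 0) {()} (\<lambda>_. 1\<^sub>m 1)" by (simp add: finite_povm_def)
  from shadow_of_finite_povm[OF this, of d "\<lambda>_ _. 0"]
  obtain \<Omega> :: "shadow measure" and Q E where pv: "povm (d ^ 0) \<Omega> Q" "post_processing d \<Omega> E"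
    and law: "\<And>\<sigma> P. psd_mat (d ^ 0) \<sigma> \<Longrightarrow> measure (outcome_law \<Omega> Q \<sigma>) {s \<in> space \<Omega>. P (E s)} =
      (\<Sum>z\<in>{z \<in> {()}. P (\<lambda>_. 0)}. born (\<lambda>_. 1\<^sub>m 1) \<sigma> z)" by blast
  have "measure (outcome_law \<Omega> Q (tensor_power \<rho> 0))
        {s \<in> space \<Omega>. \<forall>i \<in> {1..M}. \<bar>E s (Ob i) - Re (mat_trace (Ob i * \<rho>))\<bar> \<le> \<epsilon>} \<ge> 2 / 3"
    if "\<forall>i \<in> {1..M}. \<bar>Re (mat_trace (Ob i * \<rho>))\<bar> \<le> \<epsilon>" for \<rho> Ob
  proof -
    have "measure (outcome_law \<Omega> Q (tensor_power \<rho> 0))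
        {s \<in> space \<Omega>. \<forall>i \<in> {1..M}. \<bar>E s (Ob i) - Re (mat_trace (Ob i * \<rho>))\<bar> \<le> \<epsilon>} =
      (\<Sum>z\<in>{z \<in> {()}. \<forall>i \<in> {1..M}. \<bar>0 - Re (mat_trace (Ob i * \<rho>))\<bar> \<le> \<epsilon>}. born (\<lambda>_. 1\<^sub>m 1) (tensor_power \<rho> 0) z)"
      using psd1 by (intro law[of _ "\<lambda>f. \<forall>i \<in> {1..M}. \<bar>f (Ob i) - Re (mat_trace (Ob i * \<rho>))\<bar> \<le> \<epsilon>"]) simp
    also have "{z \<in> {()}. \<forall>i \<in> {1..M}. \<bar>0 - Re (mat_trace (Ob i * \<rho>))\<bar> \<le> \<epsilon>} = {()}" using that by auto
    finally show ?thesis by (simp add: born_def mat_trace_def)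
  qed
  then show ?thesis using pv by blast
qed

text \<open>Three nested levels: \<open>k\<close> copies measured jointly, \<open>b\<close> such
  outcomes averaged, \<open>L\<close> averages put to a vote. The norm condition on the observables
  enters through the bound \<open>\<beta>\<close> on \<open>Tr (O^2 \<rho>)\<close>.\<close>

lemma amplified_shadow:
  fixes d r k b L M :: nat and \<epsilon> B \<beta> :: real
  assumes k: "0 < k" and b: "0 < b" and \<epsilon>: "\<epsilon> > 0" and \<beta>: "0 < \<beta>" and kB: "r * B / (real k)\<^sup>2 \<le> \<beta>"
    and b\<beta>: "192 * \<beta> / \<epsilon>\<^sup>2 \<le> b" and L: "3 * real M \<le> 2 ^ L"
  shows "\<exists>(\<Omega> :: shadow measure) Q E. povm (d ^ (k * b * L)) \<Omega> Q \<and> post_processing d \<Omega> E \<and>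
    (\<forall>\<rho> Ob. quantum_state d \<rho> \<and> mat_rank d \<rho> \<le> r \<and>
      (\<forall>i \<in> {1..M}. hermitian_mat d (Ob i) \<and> Re (mat_trace (Ob i * Ob i)) \<le> B \<and>
        Re (mat_trace (Ob i * Ob i * \<rho>)) \<le> \<beta>) \<longrightarrow>
      measure (outcome_law \<Omega> Q (tensor_power \<rho> (k * b * L)))
        {s \<in> space \<Omega>. \<forall>i \<in> {1..M}. \<bar>E s (Ob i) - Re (mat_trace (Ob i * \<rho>))\<bar> \<le> \<epsilon>} \<ge> 2 / 3)"
proof -
  obtain X :: "(nat \<times> nat \<Rightarrow> nat \<times> nat) set" and M0 g where P0: "finite_povm (d ^ k) X M0"
    and mom: "\<And>\<rho> Ob. quantum_state d \<rho> \<Longrightarrow> mat_rank d \<rho> \<le> r \<Longrightarrow> hermitian_mat d Ob \<Longrightarrow>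
      (\<Sum>x\<in>X. born M0 (tensor_power \<rho> k) x * g x Ob) = Re (mat_trace (Ob * \<rho>)) \<and>
      (\<Sum>x\<in>X. born M0 (tensor_power \<rho> k) x * (g x Ob)\<^sup>2) = (1 - 1 / real k) * (Re (mat_trace (Ob * \<rho>)))\<^sup>2 +
        real r * Re (mat_trace (Ob * Ob)) / (real k)\<^sup>2 + 2 * Re (mat_trace (Ob * Ob * \<rho>)) / real k"
    using batch_measurement[OF k, of d r] unfolding born_def by blast
  define Y where "Y = PiE {..<b} (\<lambda>_. X)"
  define M1 where "M1 = (\<lambda>y. tens (\<lambda>l. M0 (y l)) b)"
  define Z where "Z = PiE {..<L} (\<lambda>_. Y)"
  define M2 where "M2 = (\<lambda>z. tens (\<lambda>l. M1 (z l)) L)"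
  define gb where "gb = (\<lambda>y Ob. (\<Sum>l<b. g (y l) Ob) / real b)"
  \<comment> \<open>Half the tolerance, since \<open>majority_consensus\<close> doubles it.\<close>
  define est where "est = (\<lambda>z Ob. SOME v. L < 2 * card {l \<in> {..<L}. \<bar>gb (z l) Ob - v\<bar> \<le> \<epsilon> / 2})"
  have dims: "((d ^ k) ^ b) ^ L = d ^ (k * b * L)" by (simp add: power_mult)
  have P1: "finite_povm ((d ^ k) ^ b) Y M1" unfolding Y_def M1_def by (rule finite_povm_power[OF P0])
  have P2: "finite_povm (d ^ (k * b * L)) Z M2"
    unfolding Z_def M2_def dims[symmetric] by (rule finite_povm_power[OF P1])
  from shadow_of_finite_povm[OF P2, of d est]
  obtain \<Omega> :: "shadow measure" and Q E where pv: "povm (d ^ (k * b * L)) \<Omega> Q" "post_processing d \<Omega> E"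
    and law: "\<And>\<sigma> P. psd_mat (d ^ (k * b * L)) \<sigma> \<Longrightarrow> measure (outcome_law \<Omega> Q \<sigma>) {s \<in> space \<Omega>. P (E s)} =
      (\<Sum>z\<in>{z \<in> Z. P (est z)}. born M2 \<sigma> z)" by blast
  have "measure (outcome_law \<Omega> Q (tensor_power \<rho> (k * b * L)))
        {s \<in> space \<Omega>. \<forall>i \<in> {1..M}. \<bar>E s (Ob i) - Re (mat_trace (Ob i * \<rho>))\<bar> \<le> \<epsilon>} \<ge> 2 / 3"
    if \<rho>: "quantum_state d \<rho>" and rank: "mat_rank d \<rho> \<le> r"
      and Ob: "\<And>i. i \<in> {1..M} \<Longrightarrow> hermitian_mat d (Ob i)"
        "\<And>i. i \<in> {1..M} \<Longrightarrow> Re (mat_trace (Ob i * Ob i)) \<le> B"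
        "\<And>i. i \<in> {1..M} \<Longrightarrow> Re (mat_trace (Ob i * Ob i * \<rho>)) \<le> \<beta>" for \<rho> Ob
  proof -
    note st = quantum_stateD[OF \<rho>]
    have psd: "psd_mat (d ^ m) (tensor_power \<rho> m)" for m
      unfolding tensor_power_eq_tens using st(4) by (intro psd_mat_tens)
    have herm: "hermitian_mat (d ^ m) (tensor_power \<rho> m)" for m using psd by (simp add: psd_mat_def)
    let ?\<rho>1 = "tensor_power \<rho> k" and ?\<rho>2 = "tensor_power \<rho> (k * b)" and ?\<rho>3 = "tensor_power \<rho> (k * b * L)"
    have r2: "?\<rho>2 = tensor_power ?\<rho>1 b" and r3: "?\<rho>3 = tensor_power ?\<rho>2 L" by (rule tensor_power_times)+
    have h2: "hermitian_mat ((d ^ k) ^ b) ?\<rho>2" using herm[of "k * b"] by (simp add: power_mult)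
    let ?q0 = "born M0 ?\<rho>1" and ?q1 = "born M1 ?\<rho>2" and ?q2 = "born M2 ?\<rho>3"
    have q1: "?q1 y = (\<Prod>l<b. ?q0 (y l))" if "y \<in> Y" for y
      unfolding M1_def r2 by (rule born_power[OF P0 herm]) (use that in \<open>simp add: Y_def\<close>)
    have q2: "?q2 z = (\<Prod>l<L. ?q1 (z l))" if "z \<in> Z" for z
      unfolding M2_def r3 by (rule born_power[OF P1 h2]) (use that in \<open>simp add: Z_def\<close>)
    have s0: "(\<Sum>x\<in>X. ?q0 x) = 1"
      by (rule sum_born[OF P0 psd_mat_carrier[OF psd] mat_trace_tensor_power_state[OF \<rho>]])
    have s1: "(\<Sum>y\<in>Y. ?q1 y) = 1"
      using psd_mat_carrier[OF psd[of "k * b"]]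
      by (intro sum_born[OF P1 _ mat_trace_tensor_power_state[OF \<rho>]]) (simp add: power_mult)
    have s2: "(\<Sum>z\<in>Z. ?q2 z) = 1"
      by (rule sum_born[OF P2 psd_mat_carrier[OF psd] mat_trace_tensor_power_state[OF \<rho>]])
    have n1: "0 \<le> ?q1 y" if "y \<in> Y" for y
      using psd[of "k * b"] finite_povmD(2)[OF P1 that] by (intro born_nonneg[of "(d ^ k) ^ b"]) (simp_all add: power_mult)
    have n2: "0 \<le> ?q2 z" if "z \<in> Z" for z
      by (rule born_nonneg[of "d ^ (k * b * L)" M2 z ?\<rho>3, OF finite_povmD(2)[OF P2 that] psd])
    define Bad where "Bad = (\<lambda>i y. \<bar>gb y (Ob i) - Re (mat_trace (Ob i * \<rho>))\<bar> > \<epsilon> / 2)"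
    have bad: "(\<Sum>y\<in>{y \<in> Y. Bad i y}. ?q1 y) \<le> 1 / 16" if i: "i \<in> {1..M}" for i
    proof -
      let ?t = "Re (mat_trace (Ob i * \<rho>))" and ?g = "\<lambda>x. g x (Ob i)"
      note m = mom[OF \<rho> rank Ob(1)[OF i]]
      have "(\<Sum>x\<in>X. ?q0 x * (?g x - ?t)\<^sup>2) = (\<Sum>x\<in>X. ?q0 x * (?g x)\<^sup>2 - 2 * ?t * (?q0 x * ?g x) + ?t\<^sup>2 * ?q0 x)"
        by (intro sum.cong refl) (simp add: power2_diff algebra_simps)
      also have "\<dots> = (\<Sum>x\<in>X. ?q0 x * (?g x)\<^sup>2) - 2 * ?t * (\<Sum>x\<in>X. ?q0 x * ?g x) + ?t\<^sup>2 * (\<Sum>x\<in>X. ?q0 x)"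
        by (simp only: sum.distrib sum_subtractf sum_distrib_left)
      \<comment> \<open>Subtracting the squared mean turns the summand \<open>(1 - 1/k) t^2\<close>
        of the second moment into \<open>- t^2 / k\<close>, which is then discarded.\<close>
      also have "\<dots> = - (?t\<^sup>2 / k) + r * Re (mat_trace (Ob i * Ob i)) / (real k)\<^sup>2 +
          2 * Re (mat_trace (Ob i * Ob i * \<rho>)) / real k"
        using m s0 by (simp add: power2_eq_square algebra_simps)
      also have "\<dots> \<le> 0 + \<beta> + 2 * \<beta>"
      proof (intro add_mono)
        show "- (?t\<^sup>2 / k) \<le> 0" by simp
        have "r * Re (mat_trace (Ob i * Ob i)) / (real k)\<^sup>2 \<le> r * B / (real k)\<^sup>2"
          using Ob(2)[OF i] by (intro divide_right_mono mult_left_mono) auto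
        then show "r * Re (mat_trace (Ob i * Ob i)) / (real k)\<^sup>2 \<le> \<beta>" using kB by linarith
        have "2 * Re (mat_trace (Ob i * Ob i * \<rho>)) / real k \<le> 2 * \<beta> / real k"
          using Ob(3)[OF i] by (intro divide_right_mono) auto
        also have "\<dots> \<le> 2 * \<beta> / 1" using k \<beta> by (intro divide_left_mono) auto
        finally show "2 * Re (mat_trace (Ob i * Ob i * \<rho>)) / real k \<le> 2 * \<beta>" by simp
      qed
      finally have var: "(\<Sum>x\<in>X. ?q0 x * (?g x - ?t)\<^sup>2) \<le> 3 * \<beta>" by simp
      have "(\<Sum>y\<in>{y \<in> Y. Bad i y}. ?q1 y) \<le> (\<Sum>y\<in>Y. ?q1 y * (gb y (Ob i) - ?t)\<^sup>2) / (\<epsilon> / 2)\<^sup>2"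
        unfolding Bad_def using finite_povmD(1)[OF P1] n1 \<epsilon> by (intro chebyshev_weights) auto
      also have "(\<Sum>y\<in>Y. ?q1 y * (gb y (Ob i) - ?t)\<^sup>2) = (\<Sum>y\<in>Y. (\<Prod>l<b. ?q0 (y l)) * ((\<Sum>l<b. ?g (y l)) / b - ?t)\<^sup>2)"
        by (intro sum.cong refl) (simp add: q1 gb_def)
      also have "\<dots> = (\<Sum>x\<in>X. ?q0 x * (?g x - ?t)\<^sup>2) / b"
        unfolding Y_def using m by (intro average_variance[OF finite_povmD(1)[OF P0] s0 _ b]) blast
      also have "\<dots> / (\<epsilon> / 2)\<^sup>2 \<le> 3 * \<beta> / b / (\<epsilon> / 2)\<^sup>2"
        using var by (intro divide_right_mono) auto
      also have "\<dots> = 12 * \<beta> / \<epsilon>\<^sup>2 / b" by (simp add: power_divide)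
      also have "\<dots> = 192 * \<beta> / \<epsilon>\<^sup>2 / b / 16" by simp
      also have "192 * \<beta> / \<epsilon>\<^sup>2 / b \<le> 1"
        by (rule divide_le_eq_1_pos[THEN iffD2, OF _ b\<beta>]) (use b in simp)
      finally show ?thesis by simp
    qed
    define Fail where "Fail = (\<lambda>i z. L \<le> 2 * card {l \<in> {..<L}. Bad i (z l)})"
    have fail: "(\<Sum>z\<in>{z \<in> Z. Fail i z}. ?q2 z) \<le> (1 / 2) ^ L" if "i \<in> {1..M}" for i
    proof -
      have "(\<Sum>z\<in>{z \<in> Z. Fail i z}. ?q2 z) = (\<Sum>z\<in>{z \<in> Z. Fail i z}. \<Prod>l<L. ?q1 (z l))"
        by (intro sum.cong refl) (simp add: q2)
      also have "\<dots> \<le> (1 / 2) ^ L"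
        unfolding Fail_def Z_def by (rule majority_failure[OF finite_povmD(1)[OF P1] n1 s1 bad[OF that]])
      finally show ?thesis .
    qed
    have good: "\<forall>i\<in>{1..M}. \<bar>est z (Ob i) - Re (mat_trace (Ob i * \<rho>))\<bar> \<le> \<epsilon>"
      if "\<And>i. i \<in> {1..M} \<Longrightarrow> \<not> Fail i z" for z
    proof
      fix i assume i: "i \<in> {1..M}"
      let ?t = "Re (mat_trace (Ob i * \<rho>))"
      let ?G = "{l \<in> {..<L}. \<bar>gb (z l) (Ob i) - ?t\<bar> \<le> \<epsilon> / 2}" and ?B = "{l \<in> {..<L}. Bad i (z l)}"
      have "card ?G + card ?B = card (?G \<union> ?B)"
        by (rule card_Un_disjoint[symmetric]) (auto simp: Bad_def)
      also have "?G \<union> ?B = {..<L}" by (auto simp: Bad_def)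
      finally have "L < 2 * card ?G" using that[OF i] by (simp add: Fail_def)
      from majority_consensus[OF this] show "\<bar>est z (Ob i) - ?t\<bar> \<le> \<epsilon>" by (simp add: est_def)
    qed
    have "2 / 3 \<le> 1 - real M * (1 / 2) ^ L"
      using L by (simp add: power_one_over field_simps)
    also have "\<dots> = 1 - card {1..M} * (1 / 2) ^ L" by simp
    also have "\<dots> \<le> (\<Sum>z\<in>{z \<in> Z. \<forall>i\<in>{1..M}. \<bar>est z (Ob i) - Re (mat_trace (Ob i * \<rho>))\<bar> \<le> \<epsilon>}. ?q2 z)"
      by (rule union_bound_weights[OF finite_povmD(1)[OF P2] n2 s2 _ fail good]) auto
    also have "\<dots> = measure (outcome_law \<Omega> Q ?\<rho>3)
        {s \<in> space \<Omega>. \<forall>i \<in> {1..M}. \<bar>E s (Ob i) - Re (mat_trace (Ob i * \<rho>))\<bar> \<le> \<epsilon>}"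
      by (rule law[OF psd, symmetric, of "\<lambda>f. \<forall>i \<in> {1..M}. \<bar>f (Ob i) - Re (mat_trace (Ob i * \<rho>))\<bar> \<le> \<epsilon>"])
    finally show ?thesis .
  qed
  then show ?thesis using pv by blast
qed

theorem theorem1:
  shows "\<exists>C :: real. C > 0 \<and>
    (\<forall>(d :: nat) (r :: nat) (M :: nat) (\<epsilon> :: real) (B :: real).
      1 \<le> d \<and> 1 \<le> r \<and> r \<le> d \<and> 1 \<le> M \<and> \<epsilon> > 0 \<and> B > 0 \<longrightarrow>
      (\<exists>(n :: nat) (\<Omega> :: shadow measure) (Q :: shadow set \<Rightarrow> complex mat)
          (E :: shadow \<Rightarrow> complex mat \<Rightarrow> real).
        int n \<le> \<lceil>C * sqrt (real r * B) / \<epsilon>\<^sup>2 * ln (real M + 1)\<rceil> \<and>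
        povm (d ^ n) \<Omega> Q \<and>
        post_processing d \<Omega> E \<and>
        (\<forall>(\<rho> :: complex mat) (Ob :: nat \<Rightarrow> complex mat).
          quantum_state d \<rho> \<and> mat_rank d \<rho> \<le> r \<and>
          (\<forall>i \<in> {1..M}. hermitian_mat d (Ob i) \<and> spectral_norm (Ob i) \<le> 1 \<and>
             Re (mat_trace (Ob i * Ob i)) \<le> B) \<longrightarrow>
          measure (outcome_law \<Omega> Q (tensor_power \<rho> n))
            {s \<in> space \<Omega>. \<forall>i \<in> {1..M}. \<bar>E s (Ob i) - Re (mat_trace (Ob i * \<rho>))\<bar> \<le> \<epsilon>} \<ge> 2 / 3)))"
proof (rule exI[of _ 2000], intro conjI allI impI)
  fix d r M :: nat and \<epsilon> B :: real
  assume "1 \<le> d \<and> 1 \<le> r \<and> r \<le> d \<and> 1 \<le> M \<and> \<epsilon> > 0 \<and> B > 0"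
  then have r: "1 \<le> r" and M: "1 \<le> M" and \<epsilon>: "\<epsilon> > 0" and B: "B > 0" by auto
  txt \<open>\<open>\<beta>\<close> bounds \<open>Tr (O\<^sup>2 \<rho>) \<ge> (Tr (O \<rho>))\<^sup>2\<close>, so if \<open>\<beta> \<le> \<epsilon>\<^sup>2\<close> then the estimate \<open>0\<close> needs no copies.\<close>
  define \<beta> where "\<beta> = min 1 B"
  have u: "Re (mat_trace (X * X * \<rho>)) \<le> \<beta>"
    if "quantum_state d \<rho>" "hermitian_mat d X" "spectral_norm X \<le> 1" "Re (mat_trace (X * X)) \<le> B" for X \<rho>
    using state_observable_bounds(2,3)[OF that(1,2)] that(3,4) by (simp add: \<beta>_def)
  show "\<exists>(n :: nat) (\<Omega> :: shadow measure) (Q :: shadow set \<Rightarrow> complex mat)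
          (E :: shadow \<Rightarrow> complex mat \<Rightarrow> real).
        int n \<le> \<lceil>2000 * sqrt (real r * B) / \<epsilon>\<^sup>2 * ln (real M + 1)\<rceil> \<and>
        povm (d ^ n) \<Omega> Q \<and>
        post_processing d \<Omega> E \<and>
        (\<forall>(\<rho> :: complex mat) (Ob :: nat \<Rightarrow> complex mat).
          quantum_state d \<rho> \<and> mat_rank d \<rho> \<le> r \<and>
          (\<forall>i \<in> {1..M}. hermitian_mat d (Ob i) \<and> spectral_norm (Ob i) \<le> 1 \<and>
             Re (mat_trace (Ob i * Ob i)) \<le> B) \<longrightarrow>
          measure (outcome_law \<Omega> Q (tensor_power \<rho> n))
            {s \<in> space \<Omega>. \<forall>i \<in> {1..M}. \<bar>E s (Ob i) - Re (mat_trace (Ob i * \<rho>))\<bar> \<le> \<epsilon>} \<ge> 2 / 3)"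
  proof (cases "\<beta> \<le> \<epsilon>\<^sup>2")
    case True
    have small: "\<bar>Re (mat_trace (X * \<rho>))\<bar> \<le> \<epsilon>"
      if "quantum_state d \<rho>" "hermitian_mat d X" "spectral_norm X \<le> 1" "Re (mat_trace (X * X)) \<le> B" for X \<rho>
    proof -
      have "(Re (mat_trace (X * \<rho>)))\<^sup>2 \<le> \<epsilon>\<^sup>2"
        using state_observable_bounds(1)[OF that(1,2)] u[OF that] True by linarith
      then show ?thesis using \<epsilon> by (simp add: abs_le_square_iff[symmetric])
    qed
    have "0 \<le> 2000 * sqrt (real r * B) / \<epsilon>\<^sup>2 * ln (real M + 1)" using B by simp
    then have n: "int 0 \<le> \<lceil>2000 * sqrt (real r * B) / \<epsilon>\<^sup>2 * ln (real M + 1)\<rceil>"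
      by (metis ceiling_mono ceiling_zero of_nat_0)
    obtain \<Omega> :: "shadow measure" and Q E where *: "povm (d ^ 0) \<Omega> Q" "post_processing d \<Omega> E"
      "\<And>\<rho> Ob. quantum_state d \<rho> \<Longrightarrow> mat_rank d \<rho> \<le> r \<Longrightarrow>
        (\<forall>i \<in> {1..M}. \<bar>Re (mat_trace (Ob i * \<rho>))\<bar> \<le> \<epsilon>) \<Longrightarrow>
        measure (outcome_law \<Omega> Q (tensor_power \<rho> 0))
          {s \<in> space \<Omega>. \<forall>i \<in> {1..M}. \<bar>E s (Ob i) - Re (mat_trace (Ob i * \<rho>))\<bar> \<le> \<epsilon>} \<ge> 2 / 3"
      using trivial_shadow[of d r M \<epsilon>] by blast
    show ?thesis
      by (rule exI[of _ 0], rule exI[of _ \<Omega>], rule exI[of _ Q], rule exI[of _ E])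
        (intro conjI n * allI impI, (use small in blast)+)
  next
    case False
    then obtain k b L :: nat where kbL: "0 < k" "0 < b" "r * B / (real k)\<^sup>2 \<le> \<beta>" "192 * \<beta> / \<epsilon>\<^sup>2 \<le> b"
      "3 * real M \<le> 2 ^ L" and n: "real (k * b * L) \<le> 2000 * sqrt (r * B) / \<epsilon>\<^sup>2 * ln (real M + 1)"
      using sample_count_bound[OF r M \<epsilon> B, of \<beta>] by (auto simp: \<beta>_def not_le)
    have \<beta>0: "0 < \<beta>" using B by (simp add: \<beta>_def)
    have n': "int (k * b * L) \<le> \<lceil>2000 * sqrt (real r * B) / \<epsilon>\<^sup>2 * ln (real M + 1)\<rceil>"
      using ceiling_mono[OF n] by (simp only: ceiling_of_nat)
    obtain \<Omega> :: "shadow measure" and Q E where *: "povm (d ^ (k * b * L)) \<Omega> Q" "post_processing d \<Omega> E"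
      "\<And>\<rho> Ob. quantum_state d \<rho> \<Longrightarrow> mat_rank d \<rho> \<le> r \<Longrightarrow>
        (\<forall>i \<in> {1..M}. hermitian_mat d (Ob i) \<and> Re (mat_trace (Ob i * Ob i)) \<le> B \<and>
          Re (mat_trace (Ob i * Ob i * \<rho>)) \<le> \<beta>) \<Longrightarrow>
        measure (outcome_law \<Omega> Q (tensor_power \<rho> (k * b * L)))
          {s \<in> space \<Omega>. \<forall>i \<in> {1..M}. \<bar>E s (Ob i) - Re (mat_trace (Ob i * \<rho>))\<bar> \<le> \<epsilon>} \<ge> 2 / 3"
      using amplified_shadow[OF kbL(1,2) \<epsilon> \<beta>0 kbL(3-5), of d] by blast
    show ?thesis
      by (rule exI[of _ "k * b * L"], rule exI[of _ \<Omega>], rule exI[of _ Q], rule exI[of _ E])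
        (intro conjI n' * allI impI, (use u in blast)+)
  qed
qed simp

end
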